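(* Let $\Gamma$ be a finite connected non-complete graph of girth $3$ and valency $4$. Then $\Gamma$ is $2$-geodesic transitive if and only if $\Gamma$ is either $L(K_4)\cong K_{3[2]}$ or $\Gamma\cong L(\Sigma)$ for some connected $3$-arc transitive cubic graph $\Sigma$. Moreover, $\Gamma$ is geodesic transitive if and only if $\Gamma\cong L(\Sigma)$ for a cubic distance transitive graph $\Sigma$, namely $\Sigma$ is one of $K_4$, $K_{3,3}$, the Petersen graph, the Heawood graph, or Tutte's $8$-cage.
   Context: All graphs are finite, simple and undirected. The girth of a graph is the length of its shortest cycle. For a graph $\Sigma$, the line graph $L(\Sigma)$ has vertex set the edge set of $\Sigma$, two edges being adjacent in $L(\Sigma)$ iff they share a vertex. $K_{3[2]}$ denotes the complete multipartite graph with $3$ parts of size $2$. An $s$-arc is a walk $(v_0,v_1,\ldots,v_s)$ with $v_{j-1}\neq v_{j+1}$ for $1\le j\le s-1$; a graph is $s$-arc transitive if its automorphism group is transitive on the set of $t$-arcs for every $t\le s$. For $1\le s\le \mathrm{diam}(\Gamma)$, an $s$-geodesic is a walk $(v_0,\ldots,v_s)$ with $d_\Gamma(v_0,v_s)=s$. $\Gamma$ is $s$-geodesic transitive if $\mathrm{Aut}(\Gamma)$ is transitive on the set of $i$-geodesics for each $1\le i\le s$, and geodesic transitive if it is $\mathrm{diam}(\Gamma)$-geodesic transitive. A graph is distance transitive if its automorphism group is transitive on ordered pairs of vertices at distance $t$, for each $t\le\mathrm{diam}$. *)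

theory Defs
  imports Main "HOL-Library.Extended_Nat"
begin

record 'a ugraph =
  gverts :: "'a set"
  gedges :: "'a set set"

definition simple_graph :: "'a ugraph \<Rightarrow> bool" where
  "simple_graph G \<longleftrightarrow> finite (gverts G) \<and> (\<forall>e\<in>gedges G. e \<subseteq> gverts G \<and> card e = 2)"

definition adjacent :: "'a ugraph \<Rightarrow> 'a \<Rightarrow> 'a \<Rightarrow> bool" where
  "adjacent G u v \<longleftrightarrow> {u, v} \<in> gedges G"

definition is_complete :: "'a ugraph \<Rightarrow> bool" where
  "is_complete G \<longleftrightarrow> (\<forall>u\<in>gverts G. \<forall>v\<in>gverts G. u \<noteq> v \<longrightarrow> adjacent G u v)"

definition valency :: "'a ugraph \<Rightarrow> 'a \<Rightarrow> nat" where
  "valency G v = card {u \<in> gverts G. adjacent G v u}"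

definition regular_graph :: "'a ugraph \<Rightarrow> nat \<Rightarrow> bool" where
  "regular_graph G k \<longleftrightarrow> (\<forall>v\<in>gverts G. valency G v = k)"

abbreviation cubic :: "'a ugraph \<Rightarrow> bool" where
  "cubic G \<equiv> regular_graph G 3"

text \<open>A walk \<open>(v\<^sub>0, \<dots>, v\<^sub>s)\<close> of length \<open>s\<close> is the list of its \<open>s + 1\<close> vertices.\<close>

definition walks :: "'a ugraph \<Rightarrow> nat \<Rightarrow> 'a list set" where
  "walks G s = {xs. length xs = Suc s \<and> set xs \<subseteq> gverts G \<and> (\<forall>i<s. adjacent G (xs ! i) (xs ! Suc i))}"

definition connected_graph :: "'a ugraph \<Rightarrow> bool" where
  "connected_graph G \<longleftrightarrow> gverts G \<noteq> {} \<and>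
     (\<forall>u\<in>gverts G. \<forall>v\<in>gverts G. \<exists>s. \<exists>xs\<in>walks G s. hd xs = u \<and> last xs = v)"

text \<open>Distance, diameter and girth take values in \<^typ>\<open>enat\<close>: the distance between vertices of
  different components, and the girth of a forest, are \<open>\<infinity>\<close> (infimum of the empty set).\<close>

definition gdist :: "'a ugraph \<Rightarrow> 'a \<Rightarrow> 'a \<Rightarrow> enat" where
  "gdist G u v = Inf {enat s | s. \<exists>xs\<in>walks G s. hd xs = u \<and> last xs = v}"

definition gdiam :: "'a ugraph \<Rightarrow> enat" where
  "gdiam G = Sup {gdist G u v | u v. u \<in> gverts G \<and> v \<in> gverts G}"

definition cycles :: "'a ugraph \<Rightarrow> nat \<Rightarrow> 'a list set" where
  "cycles G n = {xs. 3 \<le> n \<and> length xs = n \<and> distinct xs \<and> set xs \<subseteq> gverts G \<and>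
     (\<forall>i<n. adjacent G (xs ! i) (xs ! (Suc i mod n)))}"

definition girth :: "'a ugraph \<Rightarrow> enat" where
  "girth G = Inf {enat n | n. cycles G n \<noteq> {}}"

definition graph_iso :: "('a \<Rightarrow> 'b) \<Rightarrow> 'a ugraph \<Rightarrow> 'b ugraph \<Rightarrow> bool" where
  "graph_iso f G H \<longleftrightarrow> bij_betw f (gverts G) (gverts H) \<and>
     (\<forall>u\<in>gverts G. \<forall>v\<in>gverts G. adjacent G u v \<longleftrightarrow> adjacent H (f u) (f v))"

definition graph_isomorphic :: "'a ugraph \<Rightarrow> 'b ugraph \<Rightarrow> bool" where
  "graph_isomorphic G H \<longleftrightarrow> (\<exists>f. graph_iso f G H)"

definition graph_auts :: "'a ugraph \<Rightarrow> ('a \<Rightarrow> 'a) set" where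
  "graph_auts G = {f. graph_iso f G G}"

definition aut_transitive_on :: "'a ugraph \<Rightarrow> 'a list set \<Rightarrow> bool" where
  "aut_transitive_on G X \<longleftrightarrow> (\<forall>xs\<in>X. \<forall>ys\<in>X. \<exists>f\<in>graph_auts G. map f xs = ys)"

definition arcs :: "'a ugraph \<Rightarrow> nat \<Rightarrow> 'a list set" where
  "arcs G s = {xs \<in> walks G s. \<forall>j. 1 \<le> j \<and> j < s \<longrightarrow> xs ! (j - 1) \<noteq> xs ! (j + 1)}"

definition arc_transitive :: "nat \<Rightarrow> 'a ugraph \<Rightarrow> bool" where
  "arc_transitive s G \<longleftrightarrow> (\<forall>t\<le>s. aut_transitive_on G (arcs G t))"

definition geodesics :: "'a ugraph \<Rightarrow> nat \<Rightarrow> 'a list set" where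
  "geodesics G s = {xs \<in> walks G s. gdist G (hd xs) (last xs) = enat s}"

definition s_geodesic_transitive :: "nat \<Rightarrow> 'a ugraph \<Rightarrow> bool" where
  "s_geodesic_transitive s G \<longleftrightarrow> 1 \<le> s \<and> enat s \<le> gdiam G \<and>
     (\<forall>i. 1 \<le> i \<and> i \<le> s \<longrightarrow> aut_transitive_on G (geodesics G i))"

definition geodesic_transitive :: "'a ugraph \<Rightarrow> bool" where
  "geodesic_transitive G \<longleftrightarrow> (\<exists>d. gdiam G = enat d \<and> s_geodesic_transitive d G)"

definition distance_transitive :: "'a ugraph \<Rightarrow> bool" where
  "distance_transitive G \<longleftrightarrow> (\<forall>t. enat t \<le> gdiam G \<longrightarrow>
     aut_transitive_on G {[u, v] | u v. u \<in> gverts G \<and> v \<in> gverts G \<and> gdist G u v = enat t})"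

text \<open>\<open>R\<close> is symmetric in every use below.\<close>

definition graph_of :: "'a set \<Rightarrow> ('a \<Rightarrow> 'a \<Rightarrow> bool) \<Rightarrow> 'a ugraph" where
  "graph_of V R = \<lparr>gverts = V, gedges = {{u, v} | u v. u \<in> V \<and> v \<in> V \<and> u \<noteq> v \<and> R u v}\<rparr>"

definition line_graph :: "'a ugraph \<Rightarrow> 'a set ugraph" where
  "line_graph G = graph_of (gedges G) (\<lambda>e f. e \<inter> f \<noteq> {})"

definition complete_graph :: "nat \<Rightarrow> nat ugraph" where
  "complete_graph n = graph_of {..<n} (\<lambda>_ _. True)"

text \<open>\<open>complete_multipartite m b\<close> is \<open>K\<^bsub>m[b]\<^esub>\<close>, with \<open>m\<close> parts of size \<open>b\<close>;
  thus \<open>complete_multipartite 2 3\<close> is \<open>K\<^bsub>3,3\<^esub>\<close>.\<close>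

definition complete_multipartite :: "nat \<Rightarrow> nat \<Rightarrow> (nat \<times> nat) ugraph" where
  "complete_multipartite m b = graph_of ({..<m} \<times> {..<b}) (\<lambda>u v. fst u \<noteq> fst v)"

definition pairs_upto :: "nat \<Rightarrow> nat set set" where
  "pairs_upto n = {p. p \<subseteq> {..<n} \<and> card p = 2}"

text \<open>The Petersen graph as the Kneser graph on the 2-subsets of a 5-set.\<close>

definition petersen_graph :: "nat set ugraph" where
  "petersen_graph = graph_of (pairs_upto 5) (\<lambda>p q. p \<inter> q = {})"

definition incidence_graph :: "'a set \<Rightarrow> 'a set set \<Rightarrow> ('a + 'a set) ugraph" where
  "incidence_graph P L = \<lparr>gverts = Inl ` P \<union> Inr ` L,
     gedges = {{Inl p, Inr l} | p l. p \<in> P \<and> l \<in> L \<and> p \<in> l}\<rparr>"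

text \<open>The Heawood graph: point-line incidence graph of the Fano plane, whose lines are the
  translates of the difference set \<open>{0, 1, 3}\<close> modulo 7.\<close>

definition heawood_graph :: "(nat + nat set) ugraph" where
  "heawood_graph = incidence_graph {..<7} {{i, (i + 1) mod 7, (i + 3) mod 7} | i. i < 7}"

text \<open>Tutte's 8-cage: incidence graph of the 15 duads (2-subsets of a 6-set) and the 15 synthemes
  (partitions of the 6-set into three duads), that is, of the generalized quadrangle of order
  \<open>(2, 2)\<close>. Three duads covering six points are automatically pairwise disjoint.\<close>

definition tutte_8_cage :: "(nat set + nat set set) ugraph" where
  "tutte_8_cage = incidence_graph (pairs_upto 6)
     {M. M \<subseteq> pairs_upto 6 \<and> card M = 3 \<and> \<Union>M = {..<6}}"

definition geodesic_root :: "'a ugraph \<Rightarrow> bool" where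
  "geodesic_root S \<longleftrightarrow>
     graph_isomorphic S (complete_graph 4) \<or>
     graph_isomorphic S (complete_multipartite 2 3) \<or>
     graph_isomorphic S petersen_graph \<or>
     graph_isomorphic S heawood_graph \<or>
     graph_isomorphic S tutte_8_cage"

end

theory Submission
  imports Defs
begin

text \<open>Arc-transitivity forces every edge of \<open>\<Gamma>\<close> to lie in the same number of triangles. Two triangles per
  edge give the octahedron; one triangle per edge makes \<open>\<Gamma>\<close> the line graph of the cubic graph
  \<open>\<Sigma>\<close> whose vertices are the triangles, and \<open>i\<close>-geodesics of \<open>L(\<Sigma>)\<close> are then
  edge sequences of \<open>(i + 1)\<close>-arcs of \<open>\<Sigma>\<close>.

  If \<open>L(\<Sigma>)\<close> is geodesic transitive and \<open>\<Sigma>\<close> has girth \<open>g\<close>, put \<open>t = \<lfloor>g/2\<rfloor> + 1\<close>. All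
  \<open>t\<close>-arcs come from geodesics, so \<open>\<Sigma>\<close> is \<open>t\<close>-arc-transitive, and since some \<open>t\<close>-arc lies on a
  \<open>g\<close>-cycle, every one does: \<open>\<Sigma>\<close> is a Moore graph (\<open>g\<close> odd) or the incidence graph of a
  generalized polygon (\<open>g\<close> even). Automorphisms fixing a \<open>t\<close>-arc are trivial, and Tutte's commutator
  argument on the involutions fixing \<open>(t - 1)\<close>-arcs of a \<open>g\<close>-cycle gives \<open>t \<le> 5\<close>. Counting \<open>g\<close>-cycles
  excludes \<open>g = 7, 9\<close>. For \<open>g \<in> {3, 4, 5, 6, 8}\<close> a \<open>t\<close>-arc determines a labelling of all
  vertices for which adjacency is forced; this gives at once the uniqueness of the five graphs and
  their \<open>t\<close>-arc-transitivity.\<close>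

section \<open>Non-backtracking walks\<close>

text \<open>The commutator argument does not yield \<open>t \<le> 5\<close> outright. With
  \<open>lam\<close> the least index gap at which two of the involutions fail to commute, it gives
  \<open>2 * lam \<le> t + 1\<close> and \<open>2 * (t - 1) \<le> 3 * lam\<close>. Above 5 this
  leaves exactly \<open>t = 7\<close>, \<open>lam = 4\<close>, which for \<open>g = 12\<close> would
  mean a generalized hexagon; a separate computation with a reflection of the cycle removes it.

  The counting that excludes 7 and 9 is elementary: rotation acts freely on based, oriented
  \<open>g\<close>-cycles, and these correspond to \<open>t\<close>-arcs, so \<open>g\<close>
  divides the number of \<open>t\<close>-arcs.

  For odd \<open>g\<close> the line graph may have geodesics of length \<open>t\<close>, whose
  \<open>t + 1\<close> edges exceed a \<open>t\<close>-arc. Their last step is forced: it must avoid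
  both the arc and the walk closing the arc to a \<open>g\<close>-cycle, and a cubic graph leaves
  one neighbour.

  In the labellings only the positive adjacencies have to be derived. They form a locally injective
  homomorphism, and between cubic graphs of small diameter and large girth such a map is an
  isomorphism.\<close>

fun chain :: "('v \<Rightarrow> 'v \<Rightarrow> bool) \<Rightarrow> 'v list \<Rightarrow> bool" where
  "chain E [] = True"
| "chain E [x] = True"
| "chain E [x, y] = E x y"
| "chain E (x # y # z # zs) = (E x y \<and> x \<noteq> z \<and> chain E (y # z # zs))"

lemma chain_induct [case_names Nil single pair triple]:
  assumes "P []" "\<And>x. P [x]" "\<And>x y. P [x, y]"
    and "\<And>x y z zs. P (y # z # zs) \<Longrightarrow> P (x # y # z # zs)"
  shows "P xs"
  using assms by induction_schema (pat_completeness, lexicographic_order)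

lemma snoc2E:
  assumes "2 \<le> length xs"
  obtains ys p v where "xs = ys @ [p, v]"
proof -
  from assms have "xs \<noteq> []" by auto
  then obtain zs v where v: "xs = zs @ [v]" by (metis append_butlast_last_id)
  with assms have "zs \<noteq> []" by auto
  then obtain ys p where "zs = ys @ [p]" by (metis append_butlast_last_id)
  with v that show ?thesis by simp
qed

text \<open>The two pieces overlap in two vertices because the condition against backtracking reads
  three vertices in a row.\<close>

lemma chain_append:
  "chain E (xs @ p # v # zs) \<longleftrightarrow> chain E (xs @ [p, v]) \<and> chain E (p # v # zs)"
proof (induction xs rule: chain_induct)
  case (single x)
  then show ?case by (cases zs) auto
next
  case (pair x y)
  then show ?case by (cases zs) auto
qed (cases zs; auto)+

lemma chain_Cons: "chain E (x # y # zs) \<Longrightarrow> E x y \<and> chain E (y # zs)"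
  by (cases zs) auto

lemma chain_tl: "chain E xs \<Longrightarrow> chain E (tl xs)"
  by (cases xs; cases "tl xs") (auto dest: chain_Cons)

lemma chain_butlast: "chain E xs \<Longrightarrow> chain E (butlast xs)"
proof (induction xs rule: chain_induct)
  case (triple x y z zs)
  then show ?case by (cases zs) auto
qed auto

lemma chain_snoc: "chain E (xs @ [p, v, w]) \<longleftrightarrow> chain E (xs @ [p, v]) \<and> p \<noteq> w \<and> E v w"
  by (subst chain_append[where zs = "[w]"]) (induction xs rule: chain_induct, auto dest: chain_Cons simp: chain_append)

lemma chain_rev:
  assumes "\<And>x y. E x y \<Longrightarrow> E y x"
  shows "chain E xs \<Longrightarrow> chain E (rev xs)"
proof (induction xs rule: chain_induct)
  case (triple x y z zs)
  then have "chain E (rev zs @ [z, y])" by simp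
  with triple assms show ?case by (auto simp: chain_snoc)
qed (use assms in auto)

text \<open>The positional form serves walks that are given by index functions, such as
  cycles.\<close>

lemma chain_nth:
  "chain E xs \<longleftrightarrow> (\<forall>i. Suc i < length xs \<longrightarrow> E (xs ! i) (xs ! Suc i)) \<and>
    (\<forall>i. Suc (Suc i) < length xs \<longrightarrow> xs ! i \<noteq> xs ! Suc (Suc i))"
proof (induction xs rule: chain_induct)
  case (triple x y z zs)
  have all: "(\<forall>i. P i) \<longleftrightarrow> P 0 \<and> (\<forall>i. P (Suc i))" for P :: "nat \<Rightarrow> bool"
    by (metis not0_implies_Suc)
  let ?xs = "x # y # z # zs"
  show ?case
    unfolding chain.simps triple all[of "\<lambda>i. Suc i < length ?xs \<longrightarrow> E (?xs ! i) (?xs ! Suc i)"]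
      all[of "\<lambda>i. Suc (Suc i) < length ?xs \<longrightarrow> ?xs ! i \<noteq> ?xs ! Suc (Suc i)"]
    by simp blast
qed auto

text \<open>A closed walk may still backtrack at its base point, but in a simple graph a shortest
  closed non-backtracking walk is a cycle, so this is a lower bound on the girth. Lists count
  vertices, one more than edges, hence the strict inequality.\<close>

definition girth_ge :: "('v \<Rightarrow> 'v \<Rightarrow> bool) \<Rightarrow> nat \<Rightarrow> bool" where
  "girth_ge E g \<longleftrightarrow> (\<forall>xs. chain E xs \<longrightarrow> 2 \<le> length xs \<longrightarrow> hd xs = last xs \<longrightarrow> g < length xs)"

text \<open>Compare the final steps. If they agree, they are peeled off; if they differ, one walk
  followed by the reverse of the other does not backtrack and closes up with fewer than
  \<open>g\<close> edges. The bound \<open>g + 2\<close> counts vertices, one extra for each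
  walk.\<close>

lemma chain_unique:
  assumes E: "\<And>x y. E x y \<Longrightarrow> E y x" and girth: "girth_ge E g"
  shows "chain E xs \<Longrightarrow> chain E ys \<Longrightarrow> xs \<noteq> [] \<Longrightarrow> ys \<noteq> [] \<Longrightarrow> hd xs = hd ys \<Longrightarrow> last xs = last ys \<Longrightarrow>
    length xs + length ys < g + 2 \<Longrightarrow> xs = ys"
proof (induction xs arbitrary: ys rule: rev_induct)
  case (snoc v xs)
  have no_closed: False if "chain E zs" "2 \<le> length zs" "hd zs = last zs" "length zs \<le> g" for zs
    using that girth unfolding girth_ge_def by fastforce
  obtain ys' where ys: "ys = ys' @ [v]"
    using snoc.prems by (metis append_butlast_last_id last_snoc)
  show ?case
  proof (cases "xs = [] \<or> ys' = []")
    case True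
    have "xs = []" if "ys' = []"
    proof (rule ccontr)
      assume "xs \<noteq> []"
      moreover have "hd xs = v" using snoc.prems ys that \<open>xs \<noteq> []\<close> by auto
      ultimately show False
        using no_closed[of "xs @ [v]"] snoc.prems ys by (cases xs) auto
    qed
    moreover have "ys' = []" if "xs = []"
    proof (rule ccontr)
      assume "ys' \<noteq> []"
      moreover have "hd ys' = v" using snoc.prems ys that \<open>ys' \<noteq> []\<close> by auto
      ultimately show False
        using no_closed[of "ys' @ [v]"] snoc.prems ys that by (cases ys') auto
    qed
    ultimately show ?thesis using True ys by auto
  next
    case False
    then obtain xs' p ys'' q where xs': "xs = xs' @ [p]" and ys'': "ys' = ys'' @ [q]"
      by (metis append_butlast_last_id)
    show ?thesis
    proof (cases "p = q")
      case True
      have "xs = ys'"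
      proof (rule snoc.IH)
        show "chain E xs" "chain E ys'"
          using snoc.prems(1,2) ys chain_butlast by (metis butlast_snoc)+
        show "hd xs = hd ys'"
          using snoc.prems ys False by auto
      qed (use snoc.prems ys xs' ys'' True in auto)
      then show ?thesis using ys by simp
    next
      case False
      have "chain E (rev (ys'' @ [q, v]))"
        using chain_rev[of E "ys'' @ [q, v]"] E snoc.prems(2) ys ys'' by auto
      then have *: "chain E (v # q # rev ys'')" by simp
      have xs: "chain E (xs' @ [p, v])" using snoc.prems(1) xs' by simp
      then have "E p v" by (metis chain.simps(3) chain_append)
      with * False have "chain E (p # v # q # rev ys'')" by simp
      with xs have "chain E (xs' @ p # v # q # rev ys'')"
        by (auto simp: chain_append[of E xs' p v "q # rev ys''"])
      moreover have "hd (xs' @ p # v # q # rev ys'') = last (xs' @ p # v # q # rev ys'')"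
      proof -
        have "last (q # rev ys'') = hd (ys'' @ [q])" by (simp add: last_rev hd_append last_ConsR)
        then show ?thesis
          using snoc.prems(5) xs' ys ys'' by (simp add: hd_append split: if_splits)
      qed
      ultimately show ?thesis
        using no_closed snoc.prems(7) xs' ys ys'' by fastforce
    qed
  qed
qed simp

section \<open>Cubic graphs\<close>

locale cubic_graph =
  fixes V :: "'v set" and E :: "'v \<Rightarrow> 'v \<Rightarrow> bool"
  assumes fin: "finite V" and ne: "V \<noteq> {}" and E_in: "E x y \<Longrightarrow> x \<in> V"
    and adj_sym: "E x y \<Longrightarrow> E y x" and irrefl: "\<not> E x x"
    and deg: "x \<in> V \<Longrightarrow> card {y. E x y} = 3"
    and conn: "x \<in> V \<Longrightarrow> y \<in> V \<Longrightarrow> E\<^sup>*\<^sup>* x y"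
begin

lemma E_in2: "E x y \<Longrightarrow> y \<in> V"
  using E_in adj_sym by blast

text \<open>Meaningful only for distinct neighbours \<open>a\<close>, \<open>b\<close> of
  \<open>x\<close>. The remaining neighbour is unique, so automorphisms respect it
  (\<open>auts_third\<close>).\<close>

definition third :: "'v \<Rightarrow> 'v \<Rightarrow> 'v \<Rightarrow> 'v" where
  "third x a b = (SOME c. c \<noteq> a \<and> c \<noteq> b \<and> E x c)"

lemma third:
  assumes "E x a" "E x b" "a \<noteq> b"
  shows "third x a b \<noteq> a" "third x a b \<noteq> b" "E x (third x a b)"
    and "E x y \<longleftrightarrow> y = a \<or> y = b \<or> y = third x a b"
proof -
  have "card {y. E x y} = 3" using assms deg E_in by blast
  then obtain p q r where pqr: "{y. E x y} = {p, q, r}" "p \<noteq> q" "q \<noteq> r" "p \<noteq> r"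
    by (auto simp: card_3_iff)
  then have "E x p" "E x q" "E x r" by blast+
  with pqr(2-) have "\<exists>c. c \<noteq> a \<and> c \<noteq> b \<and> E x c" by metis
  then have c: "third x a b \<noteq> a \<and> third x a b \<noteq> b \<and> E x (third x a b)"
    unfolding third_def by (rule someI_ex)
  then show "third x a b \<noteq> a" "third x a b \<noteq> b" "E x (third x a b)" by auto
  show "E x y \<longleftrightarrow> y = a \<or> y = b \<or> y = third x a b"
    using c assms \<open>E x p\<close> \<open>E x q\<close> \<open>E x r\<close> pqr(1) by (smt (verit) insert_iff mem_Collect_eq singletonD)
qed

lemma third_unique: "E x a \<Longrightarrow> E x b \<Longrightarrow> a \<noteq> b \<Longrightarrow> E x y \<Longrightarrow> y \<noteq> a \<Longrightarrow> y \<noteq> b \<Longrightarrow> y = third x a b"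
  using third(4) by blast

lemma ex_nbr2:
  assumes "x \<in> V"
  obtains y z where "E x y" "E x z" "y \<noteq> z" "y \<noteq> p" "z \<noteq> p"
proof -
  obtain a b c where abc: "{y. E x y} = {a, b, c}" "a \<noteq> b" "b \<noteq> c" "a \<noteq> c"
    using deg[OF assms] by (auto simp: card_3_iff)
  then have "E x a" "E x b" "E x c" by blast+
  with abc that show ?thesis by (cases "p = a"; cases "p = b") auto
qed

lemma chain_extend:
  assumes "chain E (xs @ [p, v])"
  obtains w where "chain E (xs @ [p, v, w])"
proof -
  have "E p v" using assms by (metis chain.simps(3) chain_append)
  then have "v \<in> V" by (rule E_in2)
  then obtain w where "E v w" "w \<noteq> p" by (rule ex_nbr2)
  with assms that[of w] show ?thesis by (auto simp: chain_snoc)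
qed

lemma chain_extend_to:
  assumes "chain E xs" "2 \<le> length xs" "length xs \<le> n"
  shows "\<exists>ys. chain E (xs @ ys) \<and> length (xs @ ys) = n"
  using assms(3)
proof (induction n rule: dec_induct)
  case base
  show ?case using assms by (intro exI[of _ "[]"]) auto
next
  case (step n)
  then obtain ys where ys: "chain E (xs @ ys)" "length (xs @ ys) = n" by blast
  have "2 \<le> length (xs @ ys)" using assms(2) by simp
  then obtain zs p v where zs: "xs @ ys = zs @ [p, v]" by (rule snoc2E)
  then obtain w where "chain E (zs @ [p, v, w])" using ys(1) chain_extend by metis
  then have "chain E (xs @ ys @ [w])" using zs by (metis append.assoc append_Cons append_Nil)
  then show ?case using ys(2) by (intro exI[of _ "ys @ [w]"]) auto
qed

lemma chain_in_V: "chain E xs \<Longrightarrow> 2 \<le> length xs \<Longrightarrow> set xs \<subseteq> V"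
proof (induction xs rule: chain_induct)
  case (triple x y z zs)
  then have "E x y" "set (y # z # zs) \<subseteq> V" by auto
  then show ?case using E_in by auto
next
  case (pair x y)
  then show ?case using E_in E_in2 by auto
qed auto

lemma chain_rev': "chain E (rev xs) \<longleftrightarrow> chain E xs"
  using chain_rev[of E xs, OF adj_sym] chain_rev[of E "rev xs", OF adj_sym] by auto

text \<open>Automorphisms are total bijections that fix everything outside \<open>V\<close>, so
  agreement on \<open>V\<close> is equality of functions and conclusions like \<open>f = id\<close>
  make sense.\<close>

definition auts :: "('v \<Rightarrow> 'v) set" where
  "auts = {f. bij f \<and> (\<forall>x. x \<notin> V \<longrightarrow> f x = x) \<and> (\<forall>x y. E (f x) (f y) \<longleftrightarrow> E x y)}"

lemma auts_id: "id \<in> auts"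
  by (auto simp: auts_def bij_def)

lemma auts_comp: "f \<in> auts \<Longrightarrow> h \<in> auts \<Longrightarrow> f \<circ> h \<in> auts"
  by (auto simp: auts_def bij_comp)

lemma auts_E: "f \<in> auts \<Longrightarrow> E (f x) (f y) \<longleftrightarrow> E x y"
  by (auto simp: auts_def)

lemma auts_eq: "f \<in> auts \<Longrightarrow> f x = f y \<longleftrightarrow> x = y"
  by (auto simp: auts_def bij_def inj_eq)

lemma auts_chain: "f \<in> auts \<Longrightarrow> chain E (map f xs) \<longleftrightarrow> chain E xs"
  by (induction xs rule: chain_induct) (auto simp: auts_E auts_eq)

lemma auts_third:
  assumes "f \<in> auts" "E x a" "E x b" "a \<noteq> b"
  shows "f (third x a b) = third (f x) (f a) (f b)"
  by (rule third_unique) (use assms third(1-3)[OF assms(2-4)] in \<open>simp_all add: auts_E auts_eq\<close>)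

end

text \<open>With \<open>g = 2 t - 1\<close> these are the cubic Moore graphs of diameter \<open>t - 1\<close>, with \<open>g = 2 t - 2\<close> the
  incidence graphs of the generalized \<open>(t - 1)\<close>-gons of order \<open>(2, 2)\<close>.\<close>

locale cage = cubic_graph +
  fixes t g :: nat
  assumes t2: "2 \<le> t" and g3: "3 \<le> g" and tg: "g + 2 = 2 * t \<or> g + 1 = 2 * t"
    and girth: "girth_ge E g"
    and closing: "chain E xs \<Longrightarrow> length xs = Suc t \<Longrightarrow>
      \<exists>ys. chain E ys \<and> length ys = Suc (g - t) \<and> hd ys = hd xs \<and> last ys = last xs"
begin

lemma unique: "chain E xs \<Longrightarrow> chain E ys \<Longrightarrow> xs \<noteq> [] \<Longrightarrow> ys \<noteq> [] \<Longrightarrow> hd xs = hd ys \<Longrightarrow> last xs = last ys \<Longrightarrow>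
    length xs + length ys < g + 2 \<Longrightarrow> xs = ys"
  using chain_unique[OF adj_sym girth] by blast

text \<open>If the closing walk shared its first or last edge with the arc, deleting that edge would
  leave two walks with common ends and \<open>g - 2\<close> edges together. They would be equal,
  although they have \<open>t - 1\<close> and \<open>g - t - 1\<close> edges.\<close>

lemma closing_ends:
  assumes "chain E xs" "length xs = Suc t" "chain E ys" "length ys = Suc (g - t)" "hd ys = hd xs" "last ys = last xs"
  shows "ys ! (g - t - 1) \<noteq> xs ! (t - 1)" "ys ! 1 \<noteq> xs ! 1"
proof -
  have t: "t > g - t" "g - t \<ge> 1" using tg t2 g3 by auto
  show "ys ! (g - t - 1) \<noteq> xs ! (t - 1)"
  proof
    assume *: "ys ! (g - t - 1) = xs ! (t - 1)"
    have "butlast xs = butlast ys"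
    proof (rule unique)
      show "chain E (butlast xs)" "chain E (butlast ys)" using assms chain_butlast by auto
      show "hd (butlast xs) = hd (butlast ys)"
        using assms t by (cases xs; cases ys) auto
      have "butlast xs \<noteq> []" "butlast ys \<noteq> []" using assms t
        by (simp_all flip: length_greater_0_conv)
      then show "last (butlast xs) = last (butlast ys)"
        using * assms t by (simp add: last_conv_nth nth_butlast)
    qed (use assms t tg g3 in \<open>auto simp flip: length_greater_0_conv\<close>)
    then have "length (butlast xs) = length (butlast ys)" by simp
    then show False using assms t by simp
  qed
  show "ys ! 1 \<noteq> xs ! 1"
  proof
    assume *: "ys ! 1 = xs ! 1"
    have "tl xs = tl ys"
    proof (rule unique)
      show "chain E (tl xs)" "chain E (tl ys)" using assms chain_tl by auto
      show "hd (tl xs) = hd (tl ys)"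
        using * assms t by (cases xs; cases "tl xs"; cases ys; cases "tl ys") auto
      show "last (tl xs) = last (tl ys)"
        using assms t by (cases xs; cases "tl xs"; cases ys; cases "tl ys") auto
    qed (use assms t tg g3 in \<open>auto simp flip: length_greater_0_conv\<close>)
    then have "length (tl xs) = length (tl ys)" by simp
    then show False using assms t by simp
  qed
qed

end

section \<open>Cycles and rigidity in cages\<close>

context cage
begin

text \<open>A \<open>g\<close>-cycle is kept as a periodic map on the integers, so rotations and
  reflections become index arithmetic without reduction modulo \<open>g\<close>.\<close>

definition cyc :: "(int \<Rightarrow> 'a) \<Rightarrow> bool" where
  "cyc c \<longleftrightarrow> (\<forall>i. E (c i) (c (i + 1)) \<and> c i \<noteq> c (i + 2) \<and> c (i + int g) = c i)"

text \<open>The arc followed by the reverse of its closing walk has \<open>g\<close> edges, and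
  \<open>closing_ends\<close> prevents backtracking at both junctions.\<close>

lemma ex_cyc:
  assumes xs: "chain E xs" "length xs = Suc t"
  obtains c where "cyc c" "\<And>j. j \<le> t \<Longrightarrow> c (int j) = xs ! j"
proof -
  obtain ys where ys: "chain E ys" "length ys = Suc (g - t)" "hd ys = hd xs" "last ys = last xs"
    using closing[OF xs] by blast
  have gt: "g - t \<ge> 1" "t < g" using tg t2 g3 by auto
  note ends = closing_ends[OF xs ys]
  have "2 \<le> length xs" "2 \<le> length ys" using xs ys t2 gt by auto
  then obtain xs' p v ys' q v' where xs': "xs = xs' @ [p, v]" and ys': "ys = ys' @ [q, v']"
    by (metis snoc2E)
  have v': "v' = v" using xs' ys' ys(4) by simp
  have "length xs' = t - 1" "length ys' = g - t - 1" using xs xs' ys ys' by auto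
  then have "q \<noteq> p" using ends(1) xs' ys' by (auto simp: nth_append)
  define zs where "zs = xs' @ p # v # q # rev ys'"
  have "chain E (v # q # rev ys')"
    using chain_rev[of E ys, OF adj_sym] ys(1) ys' v' by simp
  moreover have "E p v" using xs(1) xs' by (metis chain.simps(3) chain_append)
  ultimately have zs: "chain E zs"
    using xs(1) xs' \<open>q \<noteq> p\<close> chain_append[of E xs' p v "q # rev ys'"] by (auto simp: zs_def)
  have len: "length zs = Suc g" using xs ys xs' ys' gt by (simp add: zs_def)
  have zs_xs: "zs ! j = xs ! j" if "j \<le> t" for j
    using that xs(2) by (auto simp: zs_def xs' nth_append nth_Cons split: nat.splits)
  have zs_ys: "zs ! (g - j) = ys ! j" if "j \<le> g - t" for j
  proof -
    have "zs = xs' @ p # rev ys" using ys' v' by (simp add: zs_def)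
    moreover have "length (xs' @ [p]) = t" using xs(2) xs' by simp
    moreover have "g - j \<ge> t" "g - j - t < length ys" using that ys(2) gt by auto
    ultimately have "zs ! (g - j) = rev ys ! (g - j - t)"
      using nth_append[of "xs' @ [p]" "rev ys" "g - j"] by simp
    also have "\<dots> = ys ! j" using that ys(2) gt by (simp add: rev_nth)
    finally show ?thesis .
  qed
  have E: "E (zs ! j) (zs ! Suc j)" if "j < g" for j
    using zs len that unfolding chain_nth by auto
  have N: "zs ! j \<noteq> zs ! Suc (Suc j)" if "Suc j < g" for j
    using zs len that unfolding chain_nth by auto
  have wrap: "zs ! g = zs ! 0"
    using zs_ys[of 0] zs_xs[of 0] ys(3) xs(2) ys(2) by (cases xs; cases ys) auto
  have N': "zs ! 1 \<noteq> zs ! (g - 1)"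
    using zs_ys[of 1] zs_xs[of 1] ends(2) gt t2 by auto
  define c where "c i = zs ! nat (i mod int g)" for i
  have m0: "0 \<le> i mod int g" "i mod int g < int g" for i using g3 by auto
  have m_end: "(i + 1) mod int g = 0" if "Suc (nat (i mod int g)) = g" for i
  proof -
    have "i mod int g = int g - 1" using that m0[of i] by linarith
    then show ?thesis by (metis add_diff_cancel_right' diff_add_cancel mod_add_left_eq mod_self)
  qed
  have m_Suc: "(i + 1) mod int g = i mod int g + 1" if "Suc (nat (i mod int g)) \<noteq> g" for i
  proof -
    have "i mod int g + 1 < int g" using that m0[of i] by linarith
    then have "(i mod int g + 1) mod int g = i mod int g + 1" using m0(1)[of i] by simp
    then show ?thesis by (simp add: mod_add_left_eq)
  qed
  have c_Suc: "c (i + 1) = zs ! Suc (nat (i mod int g))" for i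
  proof (cases "Suc (nat (i mod int g)) = g")
    case True
    then show ?thesis using wrap m_end[OF True] by (simp add: c_def)
  next
    case False
    then show ?thesis using m0(1)[of i] m_Suc[OF False] by (simp add: c_def nat_add_distrib)
  qed
  have lt: "nat (i mod int g) < g" for i
    using g3 by (simp add: nat_less_iff)
  have "c i \<noteq> c (i + 2)" for i
  proof (cases "Suc (nat (i mod int g)) = g")
    case True
    then have "c (i + 1 + 1) = zs ! 1" using m_end[OF True] by (subst c_Suc) simp
    moreover have "c i = zs ! (g - 1)" using True by (metis c_def diff_Suc_1)
    ultimately show ?thesis using N' by (simp add: add.assoc)
  next
    case False
    then have l: "Suc (nat (i mod int g)) < g" using lt[of i] by simp
    have "nat ((i + 1) mod int g) = Suc (nat (i mod int g))"
      using m0(1)[of i] m_Suc[OF False] by (simp add: nat_add_distrib)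
    then have "c (i + 1 + 1) = zs ! Suc (Suc (nat (i mod int g)))" by (subst c_Suc) simp
    then show ?thesis using N[OF l] by (simp add: add.assoc c_def)
  qed
  moreover have "E (c i) (c (i + 1))" for i
    using E[OF lt] by (simp add: c_Suc) (simp add: c_def)
  ultimately have "cyc c" by (auto simp: cyc_def c_def)
  moreover have "c (int j) = xs ! j" if "j \<le> t" for j
    using that zs_xs[OF that] gt by (simp add: c_def nat_mod_as_int[symmetric] flip: zmod_int)
  ultimately show ?thesis by (rule that)
qed

text \<open>The walk closing the arc is unique, hence fixed as well, and it supplies a second fixed
  neighbour of the last vertex; then the third neighbour is fixed too. Sliding the arc forwards and
  backwards carries this to every vertex, by connectedness.\<close>

lemma rigid:
  assumes f: "f \<in> auts" and xs: "chain E xs" "length xs = Suc t" and fx: "\<And>x. x \<in> set xs \<Longrightarrow> f x = x"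
  shows "f = id"
proof -
  define P where "P xs \<longleftrightarrow> chain E xs \<and> length xs = Suc t \<and> (\<forall>x\<in>set xs. f x = x)" for xs
  have rev: "P (rev xs)" if "P xs" for xs using that chain_rev' by (auto simp: P_def)
  have nbrs: "f w = w" if "P xs" "E (last xs) w" for xs w
  proof -
    have xs: "chain E xs" "length xs = Suc t" and fx: "\<And>x. x \<in> set xs \<Longrightarrow> f x = x"
      using that by (auto simp: P_def)
    obtain ys where ys: "chain E ys" "length ys = Suc (g - t)" "hd ys = hd xs" "last ys = last xs"
      using closing[OF xs] by blast
    have gt: "g - t \<ge> 1" "t < g" using tg t2 g3 by auto
    note ends = closing_ends[OF xs ys]
    have ne: "xs \<noteq> []" "ys \<noteq> []" using xs ys by auto
    \<comment> \<open>Uniqueness applies to the closing walk and its image because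
      \<open>2 * (g - t) < g\<close>.\<close>
    have "map f ys = ys"
    proof (rule unique)
      show "chain E (map f ys)" using auts_chain f ys by blast
      show "hd (map f ys) = hd ys" "last (map f ys) = last ys"
        using ys ne fx by (auto simp: hd_map last_map)
    qed (use ys ne tg t2 gt in auto)
    then have fy: "f y = y" if "y \<in> set ys" for y using that by (metis map_idI map_eq_conv list.map_ident)
    have "2 \<le> length xs" "2 \<le> length ys" using xs ys t2 gt by auto
    then obtain xs' p v ys' q v' where xs': "xs = xs' @ [p, v]" and ys': "ys = ys' @ [q, v']"
      by (metis snoc2E)
    have v': "v' = v" using xs' ys' ys(4) by simp
    have "length xs' = t - 1" "length ys' = g - t - 1" using xs xs' ys ys' by auto
    then have "q \<noteq> p" using ends(1) xs' ys' by (auto simp: nth_append)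
    have "E v p" using xs(1) xs' adj_sym by (metis chain.simps(3) chain_append)
    moreover have "E v q" using ys(1) ys' v' adj_sym by (metis chain.simps(3) chain_append)
    moreover have "f (third v p q) = third v p q"
      using auts_third[OF f \<open>E v p\<close> \<open>E v q\<close>] \<open>q \<noteq> p\<close> fx[of v] fx[of p] fy[of q] xs' ys' by auto
    moreover have "f p = p" "f q = q" using fx fy xs' ys' by auto
    ultimately show ?thesis
      using third(4)[of v p q w] \<open>q \<noteq> p\<close> that(2) xs' by auto
  qed
  have step: "\<exists>ys. P ys \<and> last ys = w" if "P xs" "E (last xs) w" for xs w
  proof -
    have xs: "chain E xs" "length xs = Suc t" and fx: "\<And>x. x \<in> set xs \<Longrightarrow> f x = x"
      using that by (auto simp: P_def)
    then have "2 \<le> length xs" using t2 by simp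
    then obtain xs' p v where xs': "xs = xs' @ [p, v]" by (rule snoc2E)
    show ?thesis
    proof (cases "w = p")
      case False
      then have "chain E (xs @ [w])" using that xs(1) xs' by (auto simp: chain_snoc)
      then have "P (tl (xs @ [w]))"
        using xs fx nbrs[OF that] chain_tl[of E "xs @ [w]"] xs' unfolding P_def
        by (cases xs') auto
      then show ?thesis using xs' by (intro exI[of _ "tl (xs @ [w])"]) (cases xs', auto)
    next
      case True
      \<comment> \<open>Moving on to \<open>p\<close> means sliding the arc one step back; its new
        first vertex is fixed by the previous argument for the reversed arc.\<close>
      have "hd xs \<in> V" using chain_in_V xs \<open>2 \<le> length xs\<close> by (metis hd_in_set le_zero_eq length_0_conv subset_eq zero_neq_numeral)
      then obtain y where y: "E (hd xs) y" "y \<noteq> xs ! 1" by (rule ex_nbr2)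
      have "f y = y" using nbrs[OF rev[OF that(1)], of y] y xs by (cases "xs = []") (auto simp: last_rev)
      moreover have "chain E (y # xs)"
        using xs \<open>2 \<le> length xs\<close> y adj_sym by (cases xs; cases "tl xs") auto
      then have "chain E (butlast (y # xs))" by (rule chain_butlast)
      ultimately have "P (butlast (y # xs))"
        using xs fx by (auto simp: P_def dest: in_set_butlastD)
      moreover have "last (butlast (y # xs)) = w" using True xs' by (simp add: butlast_append)
      ultimately show ?thesis by blast
    qed
  qed
  have "P xs" using assms by (simp add: P_def)
  have "last xs \<in> V" using chain_in_V[OF xs(1)] xs t2 by (metis Suc_le_mono last_in_set le_SucI le_zero_eq length_0_conv numeral_2_eq_2 nat.simps(3) subset_eq)
  have "\<exists>ys. P ys \<and> last ys = y" if "E\<^sup>*\<^sup>* (last xs) y" for y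
    using that by (induction rule: rtranclp_induct) (use \<open>P xs\<close> step in blast)+
  then have "f y = y" if "y \<in> V" for y
    using conn[OF \<open>last xs \<in> V\<close> that] unfolding P_def by (metis last_in_set length_0_conv nat.simps(3))
  then show ?thesis using f by (auto simp: auts_def fun_eq_iff)
qed

lemma cyc_chain:
  assumes "cyc c"
  shows "chain E (map c [a..b])"
proof -
  have c: "E (c i) (c (i + 1))" "c i \<noteq> c (i + 2)" for i using assms by (auto simp: cyc_def)
  show ?thesis
    unfolding chain_nth
  proof (intro conjI allI impI)
    fix i assume "Suc i < length (map c [a..b])"
    then show "E (map c [a..b] ! i) (map c [a..b] ! Suc i)"
      using c(1)[of "a + int i"] by (simp add: algebra_simps)
  next
    fix i assume "Suc (Suc i) < length (map c [a..b])"
    then show "map c [a..b] ! i \<noteq> map c [a..b] ! Suc (Suc i)"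
      using c(2)[of "a + int i"] by (simp add: algebra_simps)
  qed
qed

lemma periodic_mod:
  fixes c :: "int \<Rightarrow> 'b"
  assumes "\<And>i. c (i + int g) = c i"
  shows "c j = c (j mod int g)"
proof -
  have "c (i + int k * int g) = c i" for i k
    by (induction k) (use assms in \<open>auto simp: algebra_simps\<close>, metis add.assoc add.commute)
  then have up: "c (i + k * int g) = c i" if "k \<ge> 0" for i k
    using that by (metis nat_0_le)
  have "c (i + k * int g) = c i" for i k
  proof (cases "k \<ge> 0")
    case False
    then show ?thesis using up[of "-k" "i + k * int g"] by simp
  qed (rule up)
  then show ?thesis by (metis mult.commute mod_mult_div_eq)
qed

text \<open>The rest of a period, from \<open>t\<close> to \<open>g\<close>, has
  \<open>g - t\<close> edges, fewer than half of \<open>g\<close>, so its two ends determine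
  it.\<close>

lemma cyc_determined:
  assumes c: "\<And>i. c (i + int g) = c i" "\<And>a b. chain E (map c [a..b])"
    and c': "\<And>i. c' (i + int g) = c' i" "\<And>a b. chain E (map c' [a..b])"
    and eq: "\<And>j. 0 \<le> j \<Longrightarrow> j \<le> int t \<Longrightarrow> c j = c' j"
  shows "c j = c' j"
proof -
  have gt: "g - t \<ge> 1" "t < g" using tg t2 g3 by auto
  have "map c [int t..int g] = map c' [int t..int g]"
  proof (rule unique[OF c(2) c'(2)])
    have "[int t..int g] \<noteq> []" using gt by simp
    then show "map c [int t..int g] \<noteq> []" "map c' [int t..int g] \<noteq> []" by simp_all
    have l: "last [int t..int g] = int g"
      using gt by (simp add: upto_rec2)
    show "hd (map c [int t..int g]) = hd (map c' [int t..int g])"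
      using gt eq[of "int t"] by (simp add: upto_rec1)
    show "last (map c [int t..int g]) = last (map c' [int t..int g])"
      using eq[of 0] c(1)[of 0] c'(1)[of 0] l \<open>[int t..int g] \<noteq> []\<close> by (simp add: last_map)
    show "length (map c [int t..int g]) + length (map c' [int t..int g]) < g + 2"
      using gt tg by auto
  qed
  then have "c j = c' j" if "int t \<le> j" "j \<le> int g" for j
    using that by auto
  with eq have *: "c j = c' j" if "0 \<le> j" "j \<le> int g" for j
    using that by (cases "j \<le> int t") auto
  have "c j = c (j mod int g)" using periodic_mod[of c j] c by simp
  also have "\<dots> = c' (j mod int g)" using g3 by (intro *) (auto intro: less_imp_le)
  also have "\<dots> = c' j" using periodic_mod[of c' j] c'(1) by simp
  finally show ?thesis .
qed

end

section \<open>Tutte's bound on arc-transitivity\<close>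

locale arc_transitive_cage = cage V E t g for V :: "'v set" and E t g +
  assumes arc_trans: "chain E xs \<Longrightarrow> chain E ys \<Longrightarrow> length xs = Suc t \<Longrightarrow> length ys = Suc t \<Longrightarrow>
    \<exists>f\<in>auts. map f xs = ys"

locale cage_with_cycle = cage V E t g for V :: "'v set" and E t g +
  fixes c :: "int \<Rightarrow> 'v"
  assumes cyc: "cyc c"
begin

lemma c_E: "E (c i) (c (i + 1))" "E (c (i + 1)) (c i)" "E (c i) (c (i - 1))" "E (c (i - 1)) (c i)"
  and c_neq: "c (i - 1) \<noteq> c (i + 1)" "c (i + 1) \<noteq> c (i - 1)"
  and c_g: "c (i + int g) = c i"
proof -
  have *: "E (c i) (c (i + 1))" "c i \<noteq> c (i + 2)" "c (i + int g) = c i" for i using cyc by (auto simp: cyc_def)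
  show "E (c i) (c (i + 1))" "E (c (i + 1)) (c i)" "E (c i) (c (i - 1))" "E (c (i - 1)) (c i)"
    using *(1)[of i] *(1)[of "i - 1"] adj_sym by auto
  show "c (i - 1) \<noteq> c (i + 1)" "c (i + 1) \<noteq> c (i - 1)"
    using *(2)[of "i - 1"] by (auto simp: add.commute)
  show "c (i + int g) = c i" by (rule *)
qed

lemma c_chain: "chain E (map c [a..b])" "chain E (map (\<lambda>i. c (s - i)) [a..b])"
proof -
  have neq: "c i \<noteq> c (i + 2)" for i using c_neq(1)[of "i + 1"] by (simp add: add.assoc)
  show "chain E (map c [a..b])" by (rule cyc_chain[OF cyc])
  show "chain E (map (\<lambda>i. c (s - i)) [a..b])"
    unfolding chain_nth
  proof (intro conjI allI impI)
    fix i assume "Suc i < length (map (\<lambda>i. c (s - i)) [a..b])"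
    then show "E (map (\<lambda>i. c (s - i)) [a..b] ! i) (map (\<lambda>i. c (s - i)) [a..b] ! Suc i)"
      using c_E(3)[of "s - (a + int i)"] by (simp add: algebra_simps)
  next
    fix i assume "Suc (Suc i) < length (map (\<lambda>i. c (s - i)) [a..b])"
    then show "map (\<lambda>i. c (s - i)) [a..b] ! i \<noteq> map (\<lambda>i. c (s - i)) [a..b] ! Suc (Suc i)"
      using neq[of "s - (a + int i) - 2"] by (simp add: algebra_simps)
  qed
qed

definition u :: "int \<Rightarrow> 'v" where
  "u i = third (c i) (c (i - 1)) (c (i + 1))"

lemma nbr_c: "E (c i) y \<longleftrightarrow> y = c (i - 1) \<or> y = c (i + 1) \<or> y = u i"
  and u: "u i \<noteq> c (i - 1)" "u i \<noteq> c (i + 1)" "E (c i) (u i)"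
  using third[OF c_E(3) c_E(1) c_neq(1)] by (auto simp: u_def)

end

locale cage_cycle = cage_with_cycle V E t g c + arc_transitive_cage V E t g
  for V :: "'v set" and E t g c
begin

lemma determined_on_cycle:
  assumes f: "f \<in> auts" and c': "\<And>i. c' (i + int g) = c' i" "\<And>a b. chain E (map c' [a..b])"
    and eq: "\<And>j. 0 \<le> j \<Longrightarrow> j \<le> int t \<Longrightarrow> f (c j) = c' j"
  shows "f (c j) = c' j"
proof -
  have chain: "chain E (map (f \<circ> c) [a..b])" for a b
    using auts_chain[OF f] c_chain(1) by (simp flip: map_map)
  have per: "(f \<circ> c) (i + int g) = (f \<circ> c) i" for i by (simp add: c_g)
  have "(f \<circ> c) j = c' j"
    by (rule cyc_determined[OF per chain c']) (use eq in auto)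
  then show ?thesis by simp
qed

text \<open>Arc-transitivity moves the first \<open>t\<close> edges of the cycle to any other
  stretch of it, and \<open>t\<close> edges determine the whole cycle.\<close>

lemma ex_shift: obtains f where "f \<in> auts" "\<And>j. f (c j) = c (j + d)"
proof -
  have e: "map c [d..d + int t] = map (\<lambda>j. c (j + d)) [0..int t]"
    by (rule nth_equalityI) (auto simp: add.commute)
  have len: "length (map c' [a..a + int t]) = Suc t" for c' :: "int \<Rightarrow> 'v" and a by simp
  obtain f where f: "f \<in> auts" "map f (map c [0..int t]) = map c [d..d + int t]"
    using arc_trans[OF c_chain(1) c_chain(1) len len, of 0 d] by auto
  have "map (\<lambda>j. c (j + d)) [a..b] = map c [a + d..b + d]" for a b
    by (rule nth_equalityI) (auto simp: algebra_simps)
  then have chain: "chain E (map (\<lambda>j. c (j + d)) [a..b])" for a b using c_chain(1) by simp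
  have per: "c (i + int g + d) = c (i + d)" for i using c_g[of "i + d"] by (simp add: algebra_simps)
  have "f (c j) = c (j + d)" if "0 \<le> j" "j \<le> int t" for j
    using f(2) that unfolding e by auto
  then have "f (c j) = c (j + d)" for j
    by (rule determined_on_cycle[OF f(1) per chain])
  with f that show ?thesis by blast
qed

lemma ex_reflect: obtains f where "f \<in> auts" "\<And>j. f (c j) = c (s - j)"
proof -
  have len: "length (map c' [0..int t]) = Suc t" for c' :: "int \<Rightarrow> 'v" by simp
  obtain f where f: "f \<in> auts" "map f (map c [0..int t]) = map (\<lambda>j. c (s - j)) [0..int t]"
    using arc_trans[OF c_chain(1) c_chain(2) len len] by auto
  have "c (s - (i + int g)) = c (s - i)" for i
    using c_g[of "s - (i + int g)"] by simp
  moreover have "f (c j) = c (s - j)" if "0 \<le> j" "j \<le> int t" for j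
    using f(2) that by auto
  ultimately have "f (c j) = c (s - j)" for j
    by (rule determined_on_cycle[OF f(1) _ c_chain(2)])
  with f that show ?thesis by blast
qed

section \<open>Pointwise stabilizers of segments of a shortest cycle, and the involutions generating
  them\<close>

definition F :: "int \<Rightarrow> int \<Rightarrow> ('v \<Rightarrow> 'v) set" where
  "F a b = {f \<in> auts. \<forall>j. a \<le> j \<longrightarrow> j \<le> b \<longrightarrow> f (c j) = c j}"

lemma F_id: "f \<in> F a b \<Longrightarrow> a + int t \<le> b \<Longrightarrow> f = id"
  by (rule rigid[where xs = "map c [a..a + int t]"]) (use c_chain in \<open>auto simp: F_def\<close>)

lemma F_comp: "f \<in> F a b \<Longrightarrow> h \<in> F a b \<Longrightarrow> f \<circ> h \<in> F a b"
  using auts_comp by (auto simp: F_def)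

lemma F_mono: "f \<in> F a b \<Longrightarrow> a \<le> a' \<Longrightarrow> b' \<le> b \<Longrightarrow> f \<in> F a' b'"
  by (auto simp: F_def)

lemma F_ext_up: "f \<in> F a b \<Longrightarrow> f (c (b + 1)) = c (b + 1) \<Longrightarrow> f \<in> F a (b + 1)"
  by (auto simp: F_def) (metis zle_add1_eq_le le_less)

lemma F_ext_down: "f \<in> F a b \<Longrightarrow> f (c (a - 1)) = c (a - 1) \<Longrightarrow> f \<in> F (a - 1) b"
  by (auto simp: F_def) (metis diff_add_cancel le_less zless_imp_add1_zle)

lemma nbr_image: "f \<in> auts \<Longrightarrow> f (c i) = c i \<Longrightarrow> E (c i) y \<Longrightarrow> E (c i) (f y)"
  by (metis auts_E)

lemma swap_up:
  assumes f: "f \<in> auts" "f (c (i - 1)) = c (i - 1)" "f (c i) = c i" "f (c (i + 1)) \<noteq> c (i + 1)"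
  shows "f (c (i + 1)) = u i" "f (u i) = c (i + 1)"
proof -
  show *: "f (c (i + 1)) = u i"
    using nbr_image[OF f(1,3) c_E(1)] f auts_eq[OF f(1)] c_neq unfolding nbr_c by metis
  show "f (u i) = c (i + 1)"
    using nbr_image[OF f(1,3) u(3)] f * auts_eq[OF f(1)] u unfolding nbr_c by metis
qed

lemma swap_down:
  assumes f: "f \<in> auts" "f (c (i + 1)) = c (i + 1)" "f (c i) = c i" "f (c (i - 1)) \<noteq> c (i - 1)"
  shows "f (c (i - 1)) = u i" "f (u i) = c (i - 1)"
proof -
  show *: "f (c (i - 1)) = u i"
    using nbr_image[OF f(1,3) c_E(3)] f auts_eq[OF f(1)] c_neq unfolding nbr_c by metis
  show "f (u i) = c (i - 1)"
    using nbr_image[OF f(1,3) u(3)] f * auts_eq[OF f(1)] u unfolding nbr_c by metis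
qed

text \<open>An interior vertex of the fixed segment has two fixed neighbours already.\<close>

lemma fix_u: "f \<in> F a b \<Longrightarrow> a < i \<Longrightarrow> i < b \<Longrightarrow> f (u i) = u i"
  using auts_third[of f "c i" "c (i - 1)" "c (i + 1)"] c_E c_neq by (auto simp: F_def u_def)

text \<open>A nontrivial automorphism fixing the \<open>(t - 1)\<close>-arc that starts at
  \<open>c i\<close>. The stabilizer of that arc turns out to have order two, so the choice is no
  choice.\<close>

definition X :: "int \<Rightarrow> 'v \<Rightarrow> 'v" where
  "X i = (SOME f. f \<in> F i (i + int t - 1) \<and> f \<noteq> id)"

text \<open>Arc-transitivity sends the \<open>t\<close>-arc along the cycle to the one that leaves
  the cycle at its last step. The automorphism obtained fixes the first \<open>t\<close> vertices
  and moves the last one.\<close>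

lemma X: "X i \<in> F i (i + int t - 1)" "X i \<noteq> id"
proof -
  let ?b = "i + int t - 1"
  have len: "[i..?b] = [i..?b - 1] @ [?b]" "[i..?b - 1] = [i..?b - 2] @ [?b - 1]"
     "[i..?b + 1] = [i..?b] @ [?b + 1]"
    using t2 by (simp_all add: upto_rec2)
  have xs: "chain E (map c [i..?b] @ [u ?b])"
    using c_chain(1)[of i ?b] u(1)[of ?b] u(3)[of ?b] unfolding len by (auto simp: chain_snoc)
  obtain f where f: "f \<in> auts" "map f (map c [i..?b + 1]) = map c [i..?b] @ [u ?b]"
    using arc_trans[OF c_chain(1)[of i "?b + 1"] xs] by (auto simp: nat_add_distrib)
  then have *: "map (f \<circ> c) [i..?b] = map c [i..?b]" "f (c (?b + 1)) = u ?b"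
    using len(3) by auto
  then have "f (c j) = c j" if "i \<le> j" "j \<le> ?b" for j
    using that by auto
  with * f(1) u(2)[of ?b] have "f \<in> F i ?b \<and> f \<noteq> id" by (auto simp: F_def)
  then have "X i \<in> F i ?b \<and> X i \<noteq> id" unfolding X_def by (rule someI[where P = "\<lambda>f. f \<in> F i ?b \<and> f \<noteq> id"])
  then show "X i \<in> F i ?b" "X i \<noteq> id" by auto
qed

lemma X_auts: "X i \<in> auts" using X by (auto simp: F_def)

lemma X_fix: "i \<le> j \<Longrightarrow> j \<le> i + int t - 1 \<Longrightarrow> X i (c j) = c j"
  using X(1)[of i] by (auto simp: F_def)

lemma X_F: "i \<le> a \<Longrightarrow> b \<le> i + int t - 1 \<Longrightarrow> X i \<in> F a b"
  using X(1) F_mono by blast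

text \<open>By rigidity the next vertex of the cycle cannot be fixed, so it is exchanged with the
  only other neighbour available.\<close>

lemma moves_up:
  assumes "f \<in> F i (i + int t - 1)" "f \<noteq> id" "j = i + int t"
  shows "f (c j) = u (j - 1)" "f (u (j - 1)) = c j"
proof -
  have "f (c j) \<noteq> c j"
  proof
    assume "f (c j) = c j"
    then have "f \<in> F i (i + int t)"
      using F_ext_up[OF assms(1)] assms(3) by simp
    with F_id assms show False by blast
  qed
  then have "f (c (j - 1 + 1)) \<noteq> c (j - 1 + 1)" by simp
  moreover have "f \<in> auts" "f (c (j - 1 - 1)) = c (j - 1 - 1)" "f (c (j - 1)) = c (j - 1)"
    using assms(1,3) t2 by (auto simp: F_def)
  ultimately show "f (c j) = u (j - 1)" "f (u (j - 1)) = c j"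
    using swap_up[of f "j - 1"] by simp_all
qed

lemma moves_down:
  assumes "f \<in> F i (i + int t - 1)" "f \<noteq> id"
  shows "f (c (i - 1)) = u i" "f (u i) = c (i - 1)"
proof -
  have "f (c (i - 1)) \<noteq> c (i - 1)"
  proof
    assume "f (c (i - 1)) = c (i - 1)"
    then have "f \<in> F (i - 1) (i + int t - 1)"
      using F_ext_down[OF assms(1)] by simp
    with F_id assms show False by force
  qed
  moreover have "f \<in> auts" "f (c (i + 1)) = c (i + 1)" "f (c i) = c i"
    using assms(1) t2 by (auto simp: F_def)
  ultimately show "f (c (i - 1)) = u i" "f (u i) = c (i - 1)"
    using swap_down[of f i] by simp_all
qed

lemmas X_up = moves_up[OF X] and X_down = moves_down[OF X]

text \<open>Both factors exchange \<open>c (i + int t)\<close> with the same vertex, so the product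
  fixes a \<open>t\<close>-arc. The stabilizer therefore has order two.\<close>

lemma X_unique_comp:
  assumes "f \<in> F i (i + int t - 1)" "f \<noteq> id" "h \<in> F i (i + int t - 1)" "h \<noteq> id"
  shows "f \<circ> h = id"
proof (rule F_id)
  have "f (h (c (i + int t))) = c (i + int t)"
    using moves_up(1)[OF assms(3,4) refl] moves_up(2)[OF assms(1,2) refl] by simp
  then show "f \<circ> h \<in> F i (i + int t)"
    using F_ext_up[OF F_comp[OF assms(1,3)]] by simp
qed simp

lemma X_invol: "X i (X i v) = v"
  using X_unique_comp[OF X X] by (metis comp_apply id_apply)

lemma X_unique:
  assumes "f \<in> F i (i + int t - 1)" "f \<noteq> id"
  shows "f = X i"
proof -
  have "f (X i v) = v" for v
    using X_unique_comp[OF assms X] by (metis comp_apply id_apply)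
  then show ?thesis by (metis X_invol ext)
qed

text \<open>The stabilizer of a segment is generated by the involutions whose own segments contain
  it, stated as an induction principle. If \<open>f\<close> moves \<open>c (b + 1)\<close>, the
  involution whose segment ends at \<open>c b\<close> undoes that move without disturbing the
  segment, so the fixed part grows until rigidity applies. With \<open>a < b\<close>, the image of
  \<open>c (b + 1)\<close> has only two possible values.\<close>

lemma F_generate:
  assumes "f \<in> F a b" "a < b" "id \<in> S"
    and S: "\<And>j h. b - int t + 1 \<le> j \<Longrightarrow> j \<le> a \<Longrightarrow> h \<in> S \<Longrightarrow> X j \<circ> h \<in> S"
  shows "f \<in> S"
  using assms(1,2) S
proof (induction "nat (a + int t - b)" arbitrary: f b)
  case 0
  then have "f = id" using F_id by simp
  then show ?case using assms(3) by blast
next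
  case (Suc n)
  have IH: "f \<in> S" if "f \<in> F a (b + 1)" for f
    by (rule Suc.hyps(1)[of "b + 1"]) (use that Suc in auto)
  show ?case
  proof (cases "f (c (b + 1)) = c (b + 1)")
    case True
    then show ?thesis using F_ext_up[OF Suc.prems(1)] IH by blast
  next
    case False
    let ?j = "b - int t + 1"
    have f: "f \<in> auts" "f (c (b - 1)) = c (b - 1)" "f (c b) = c b"
      using Suc.prems by (auto simp: F_def)
    have j: "?j \<le> a" using Suc.hyps(2) by simp
    have "X ?j (f (c (b + 1))) = c (b + 1)"
      using swap_up(1)[OF f False] X_up(2)[of "b + 1" ?j] by simp
    moreover have "X ?j \<circ> f \<in> F a b"
      using F_comp X_F j Suc.prems(1) by auto
    ultimately have "X ?j \<circ> f \<in> F a (b + 1)"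
      using F_ext_up by simp
    then have "X ?j \<circ> (X ?j \<circ> f) \<in> S" using IH Suc.prems(3) j by blast
    moreover have "X ?j \<circ> (X ?j \<circ> f) = f" by (simp add: fun_eq_iff X_invol)
    ultimately show ?thesis by simp
  qed
qed

section \<open>Conjugation and commutation of the involutions\<close>

definition comm :: "('v \<Rightarrow> 'v) \<Rightarrow> ('v \<Rightarrow> 'v) \<Rightarrow> bool" where
  "comm f h \<longleftrightarrow> (\<forall>v. f (h v) = h (f v))"

lemma comm_sym: "comm f h \<longleftrightarrow> comm h f"
  by (auto simp: comm_def)

lemma F_comm:
  assumes "f \<in> F a b" "a < b" and "\<And>j. b - int t + 1 \<le> j \<Longrightarrow> j \<le> a \<Longrightarrow> comm (X j) h"
  shows "comm f h"
  using F_generate[where S = "{f. comm f h}", OF assms(1,2)] assms(3) by (auto simp: comm_def)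

text \<open>Conjugation carries the stabilizer of a segment to that of the image segment, whose
  nontrivial element is unique. For a reflection, \<open>s - i - int t + 1\<close> is the lower end
  of the image of the segment from \<open>i\<close> to \<open>i + int t - 1\<close>.\<close>

lemma X_conj:
  assumes f: "f \<in> auts" "\<And>j. f (c j) = c (s + e * j)" and e: "e = 1 \<and> k = s + i \<or> e = -1 \<and> k = s - i - int t + 1"
  shows "f (X i v) = X k (f v)"
proof -
  have bij: "bij f" using f by (simp add: auts_def)
  define h where "h = f \<circ> X i \<circ> inv f"
  have inv: "inv f (f v) = v" "f (inv f v) = v" for v
    using bij by (simp_all add: bij_is_inj bij_is_surj surj_f_inv_f)
  have "h \<in> auts"
    unfolding auts_def
  proof (intro CollectI conjI allI impI)
    show "bij h" unfolding h_def using bij X_auts by (auto simp: auts_def intro!: bij_comp bij_imp_bij_inv)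
    show "h x = x" if "x \<notin> V" for x
    proof -
      have "f x = x" using f that by (auto simp: auts_def)
      then have "inv f x = x" using inv by metis
      then show ?thesis using \<open>f x = x\<close> X_auts that by (auto simp: auts_def h_def)
    qed
    show "E (h x) (h y) = E x y" for x y
      by (metis h_def comp_apply f(1) X_auts auts_E inv(2))
  qed
  have h_f: "h (f v) = f (X i v)" for v by (simp add: h_def inv)
  have "h \<in> F k (k + int t - 1)"
  proof -
    have "h (c j) = c j" if "k \<le> j" "j \<le> k + int t - 1" for j
    proof -
      define j' where "j' = e * (j - s)"
      have j': "i \<le> j'" "j' \<le> i + int t - 1" "c j = f (c j')" using that e f(2)[of j'] by (auto simp: j'_def)
      then show ?thesis using h_f X_fix by simp
    qed
    with \<open>h \<in> auts\<close> show ?thesis by (simp add: F_def)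
  qed
  moreover have "h \<noteq> id"
  proof
    assume "h = id"
    then have "X i v = v" for v using h_f[of v] inv(1) by (metis id_apply)
    with X(2)[of i] show False by (auto simp: fun_eq_iff)
  qed
  ultimately have "h = X k" by (rule X_unique)
  with h_f show ?thesis by simp
qed

lemma comm_shift: "comm (X i) (X j) \<longleftrightarrow> comm (X (i + d)) (X (j + d))"
proof -
  have "comm (X (i + d)) (X (j + d))" if "comm (X i) (X j)" for i j d
  proof -
    obtain f where f: "f \<in> auts" "\<And>j. f (c j) = c (j + d)" using ex_shift[of d] by blast
    have conj: "f (X i v) = X (i + d) (f v)" for i v
      by (rule X_conj[where s = d and e = 1]) (use f in \<open>auto simp: add.commute\<close>)
    have "X (i + d) (X (j + d) (f v)) = X (j + d) (X (i + d) (f v))" for v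
      using that conj[of i "X j v"] conj[of j "X i v"] conj[of i v] conj[of j v] by (simp add: comm_def)
    moreover have "surj f" using f(1) by (auto simp: auts_def bij_def)
    ultimately show ?thesis unfolding comm_def by (metis surjD)
  qed
  from this[of i j d] this[of "i + d" "j + d" "- d"] show ?thesis by auto
qed

text \<open>Each involution exchanges two vertices just beyond its own segment that the other
  involution fixes. So the commutator fixes the common segment and one more vertex on either
  side.\<close>

lemma commutator_F:
  assumes "i < j" "j \<le> i + int t - 2"
  shows "X i \<circ> X j \<circ> X i \<circ> X j \<in> F (j - 1) (i + int t)" (is ?P)
    and "X j \<circ> X i \<circ> X j \<circ> X i \<in> F (j - 1) (i + int t)" (is ?Q)
proof -
  have mid: "X i (c l) = c l" "X j (c l) = c l" if "j \<le> l" "l \<le> i + int t - 1" for l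
    using that assms by (auto intro: X_fix)
  have lo: "X i (c (j - 1)) = c (j - 1)" "X i (u j) = u j" "X j (c (j - 1)) = u j" "X j (u j) = c (j - 1)"
    using assms X_down[of j] fix_u[OF X(1)[of i], of j] X_fix[of i "j - 1"] by auto
  let ?k = "i + int t"
  have hi: "X j (c ?k) = c ?k" "X j (u (?k - 1)) = u (?k - 1)" "X i (c ?k) = u (?k - 1)" "X i (u (?k - 1)) = c ?k"
    using assms X_up[of ?k i] fix_u[OF X(1)[of j], of "?k - 1"] X_fix[of j ?k] by auto
  have cases: "l = j - 1 \<or> l = ?k \<or> (j \<le> l \<and> l \<le> i + int t - 1)" if "j - 1 \<le> l" "l \<le> ?k" for l
    using that by auto
  show ?P ?Q
    unfolding F_def by (auto intro!: auts_comp X_auts dest!: cases simp: mid lo hi)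
qed

end

context cage_cycle
begin

text \<open>The four involutions act transitively on the neighbours of two adjacent vertices, so
  everything they generate is transitive on edges; an automorphism commuting with all of them and
  fixing the common edge fixes everything.\<close>

lemma not_comm_all:
  assumes j: "1 \<le> j" "j \<le> int t - 1"
    and comm: "comm (X j) (X 0)" "comm (X j) (X 1)" "comm (X j) (X (int t - 1))" "comm (X j) (X (int t))"
  shows False
proof -
  define H where "H = {h \<in> auts. comm (X j) h}"
  have H: "X 0 \<in> H" "X 1 \<in> H" "X (int t - 1) \<in> H" "X (int t) \<in> H" "id \<in> H"
    using comm X_auts auts_id by (auto simp: H_def comm_def)
  have H_comp: "h \<circ> k \<in> H" if "h \<in> H" "k \<in> H" for h k
    using that auts_comp by (auto simp: H_def comm_def)
  let ?a = "c (int t - 1)" and ?b = "c (int t)"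
  define P where "P v \<longleftrightarrow> (\<exists>h\<in>H. v = h ?a \<or> v = h ?b)" for v
  have P_img: "P (h v)" if "h \<in> H" "P v" for h v
  proof -
    from that(2) obtain k where "k \<in> H" and v: "v = k ?a \<or> v = k ?b" unfolding P_def by blast
    then show ?thesis
      using H_comp[OF that(1) \<open>k \<in> H\<close>] unfolding P_def by (intro bexI[of _ "h \<circ> k"]) (use v in auto)
  qed
  have Pa: "P ?a" and Pb: "P ?b" using H(5) unfolding P_def by (auto intro!: bexI[of _ id])
  \<comment> \<open>\<open>X 0\<close> and \<open>X (int t - 1)\<close> fix \<open>?a\<close> and
    permute its three neighbours transitively; \<open>X (int t)\<close> and \<open>X 1\<close> do
    the same at \<open>?b\<close>.\<close>
  have ua: "u (int t - 1) = X 0 ?b" using X_up(1)[of "int t" 0] by simp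
  have ca: "c (int t - 1 - 1) = X (int t - 1) (u (int t - 1))"
    using X_down(2)[of "int t - 1"] by simp
  have ub: "u (int t) = X (int t) ?a" using X_down(1)[of "int t"] by simp
  have cb: "c (int t + 1) = X 1 (u (int t))" using X_up(2)[of "int t + 1" 1] by simp
  have nbr: "P y" if "E ?a y \<or> E ?b y" for y
    using that Pa Pb P_img H ua ca ub cb unfolding nbr_c by auto
  have step: "P w" if "P v" "E v w" for v w
  proof -
    obtain h x where h: "h \<in> H" "v = h x" "x = ?a \<or> x = ?b" using \<open>P v\<close> unfolding P_def by blast
    have "surj h" using h(1) by (auto simp: H_def auts_def bij_def)
    then obtain y where y: "w = h y" by (metis surjD)
    then have "E x y" using h \<open>E v w\<close> by (auto simp: H_def auts_E)
    then have "P y" using nbr h(3) by blast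
    then show ?thesis using P_img h(1) y by blast
  qed
  have P_all: "P v" if "v \<in> V" for v
  proof -
    have "?a \<in> V" using c_E(1) E_in by blast
    from conn[OF this that] show ?thesis
      by (induction rule: rtranclp_induct) (use Pa step in blast)+
  qed
  have "X j v = v" for v
  proof (cases "v \<in> V")
    case True
    then obtain h x where h: "h \<in> H" "v = h x" "x = ?a \<or> x = ?b" using P_all unfolding P_def by blast
    then show ?thesis using X_fix[of j "int t - 1"] X_fix[of j "int t"] j by (auto simp: H_def comm_def)
  next
    case False
    then show ?thesis using X_auts by (auto simp: auts_def)
  qed
  with X(2) show False by (auto simp: fun_eq_iff)
qed

text \<open>By \<open>comm_shift\<close> commutation depends only on the difference of the indices,
  so one number records where it first fails along the whole cycle.\<close>

definition lam :: nat where
  "lam = (LEAST k. 1 \<le> k \<and> \<not> comm (X 0) (X (int k)))"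

lemma lam: "1 \<le> lam" "\<not> comm (X 0) (X (int lam))" "lam \<le> t - 1"
  and comm_less: "\<bar>i - j\<bar> < int lam \<Longrightarrow> comm (X i) (X j)"
proof -
  \<comment> \<open>At gap \<open>t - 1\<close> the two index segments share only
    \<open>t - 1\<close>, and the two products send \<open>c (int t)\<close> to different neighbours
    of \<open>c (int t - 1)\<close>.\<close>
  have "\<not> comm (X 0) (X (int (t - 1)))"
  proof
    assume "comm (X 0) (X (int (t - 1)))"
    then have "X 0 (X (int t - 1) (c (int t))) = X (int t - 1) (X 0 (c (int t)))"
      using t2 by (simp add: comm_def of_nat_diff)
    moreover have "X (int t - 1) (c (int t)) = c (int t)" using t2 by (intro X_fix) auto
    moreover have "X 0 (c (int t)) = u (int t - 1)" using X_up(1)[of "int t" 0] by simp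
    moreover have "X (int t - 1) (u (int t - 1)) = c (int t - 1 - 1)" by (rule X_down)
    ultimately show False using u(1)[of "int t - 1"] by simp
  qed
  then have ex: "1 \<le> t - 1 \<and> \<not> comm (X 0) (X (int (t - 1)))" using t2 by simp
  from LeastI[of "\<lambda>k. 1 \<le> k \<and> \<not> comm (X 0) (X (int k))", OF ex]
  show "1 \<le> lam" "\<not> comm (X 0) (X (int lam))" by (auto simp: lam_def)
  from Least_le[of "\<lambda>k. 1 \<le> k \<and> \<not> comm (X 0) (X (int k))", OF ex]
  show "lam \<le> t - 1" by (auto simp: lam_def)
  have up: "comm (X i) (X (i + int k))" if "k < lam" for i k
  proof (cases "k = 0")
    case True
    then show ?thesis by (simp add: comm_def)
  next
    case False
    then have "comm (X 0) (X (int k))"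
      using not_less_Least[of k "\<lambda>k. 1 \<le> k \<and> \<not> comm (X 0) (X (int k))"] that by (auto simp: lam_def)
    then show ?thesis using comm_shift[of 0 "int k" i] by (simp add: add.commute)
  qed
  show "comm (X i) (X j)" if "\<bar>i - j\<bar> < int lam"
  proof (cases "i \<le> j")
    case True
    then show ?thesis using that up[of "nat (j - i)" i] by simp
  next
    case False
    then show ?thesis using that up[of "nat (i - j)" j] by (simp add: comm_sym)
  qed
qed

lemma not_comm_lam: "j = i + int lam \<Longrightarrow> \<not> comm (X i) (X j)"
  using lam(2) comm_shift[of 0 "int lam" i] by (simp add: add.commute)

text \<open>Otherwise the index \<open>int lam - 1\<close> has gap less than \<open>lam\<close> from
  each of 0, 1, \<open>int t - 1\<close> and \<open>int t\<close>, so its involution commutes with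
  all four in \<open>not_comm_all\<close>.\<close>

lemma lam_upper: "2 * lam \<le> t + 1"
proof (rule ccontr)
  assume *: "\<not> 2 * lam \<le> t + 1"
  show False
    by (rule not_comm_all[of "int lam - 1"]) (use * lam t2 in \<open>auto intro!: comm_less\<close>)
qed

lemma commutator_eq_id_imp_comm: "X i \<circ> X j \<circ> X i \<circ> X j = id \<Longrightarrow> comm (X i) (X j)"
  unfolding comm_def fun_eq_iff by (metis X_invol comp_apply id_apply)

text \<open>A three-subgroup argument for involutions. Since \<open>X y\<close> commutes with
  \<open>X l\<close>, the second hypothesis says that the conjugate of \<open>X y\<close> by
  \<open>X a\<close> does so too. Conjugating back, \<open>X y\<close> commutes with the conjugate
  of \<open>X l\<close> by \<open>X a\<close>, hence with the commutator.\<close>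

lemma commutator_comm:
  assumes "comm (X y) (X l)" and "comm (X a \<circ> X y \<circ> X a \<circ> X y) (X l)"
  shows "comm (X a \<circ> X l \<circ> X a \<circ> X l) (X y)"
proof -
  have 1: "X y (X l v) = X l (X y v)" for v using assms(1) by (auto simp: comm_def)
  have "X a (X y (X a (X y (X l v)))) = X l (X a (X y (X a (X y v))))" for v
    using assms(2) by (auto simp: comm_def)
  then have "X a (X y (X a (X l v))) = X l (X a (X y (X a v)))" for v
    by (metis 1 X_invol)
  then have "X y (X a (X l (X a v))) = X a (X l (X a (X y v)))" for v
    by (metis X_invol)
  then show ?thesis by (simp add: comm_def 1)
qed

lemma comm_cancel: "comm (X s \<circ> f) h \<Longrightarrow> comm f h \<Longrightarrow> bij f \<Longrightarrow> comm (X s) h"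
  unfolding comm_def by (metis comp_apply bij_pointE)

text \<open>The commutator \<open>q\<close> of \<open>X 0\<close> and \<open>X lam\<close> is a product of \<open>X j\<close> with \<open>s \<le> j \<le> r\<close>, both bounds
  attained. If \<open>lam + s\<close> were small, \<open>q\<close> would commute with \<open>X (lam + s)\<close>, as would all its factors
  other than \<open>X s\<close>, contradicting the choice of \<open>lam\<close>; symmetrically for \<open>r\<close>.\<close>

lemma lam_commutator:
  assumes "lam + 2 \<le> t"
  obtains s r where "1 \<le> s" "s \<le> r" "r \<le> int lam - 1" "int t - 1 \<le> int lam + s" "int t - 1 \<le> 2 * int lam - r"
    "X 0 \<circ> X (int lam) \<circ> X 0 \<circ> X (int lam) \<in> F r (int t)"
proof -
  let ?l = "int lam" and ?t = "int t"
  define q where "q = X 0 \<circ> X ?l \<circ> X 0 \<circ> X ?l"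
  have qF: "q \<in> F (?l - 1) ?t"
    using commutator_F(1)[of 0 ?l] assms lam(1) by (simp add: q_def)
  have q_id: "q \<noteq> id" using commutator_eq_id_imp_comm lam(2) unfolding q_def by blast
  have bij: "bij q" using qF by (auto simp: F_def auts_def)

  have q_F: "q \<in> F (?l - 1) (?t + int 0) \<and> \<not> q \<in> F (?l - 1) (?t + int (lam - 1))"
    using qF q_id F_id[of q "?l - 1" "?t + int (lam - 1)"] lam(1) by auto
  \<comment> \<open>\<open>t + k\<close> is as far up as \<open>q\<close> fixes the cycle; being
    nontrivial, \<open>q\<close> must move something before a whole \<open>t\<close>-arc is
    fixed.\<close>
  then obtain k where k: "k < lam - 1" "q \<in> F (?l - 1) (?t + int k)" "q \<notin> F (?l - 1) (?t + int (Suc k))"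
    using ex_least_nat_less[of "\<lambda>k. q \<notin> F (?l - 1) (?t + int k)" "lam - 1"]
    by (metis (no_types, lifting) Suc_le_lessD less_Suc_eq_le lessI nat_less_le not_less_eq_eq)
  \<comment> \<open>The segment of \<open>X s\<close> ends at index \<open>t + k\<close>, so
    \<open>X s\<close> corrects the first vertex that \<open>q\<close> moves.\<close>
  define s where "s = int k + 1"
  have s: "1 \<le> s" "s \<le> ?l - 1" "q \<in> F (?l - 1) (s + ?t - 1)" "q (c (s + ?t)) \<noteq> c (s + ?t)"
    using k F_ext_up[OF k(2)] by (auto simp: s_def algebra_simps)
  have q_F': "q \<in> F (?l - 1 - int 0) ?t \<and> \<not> q \<in> F (?l - 1 - int (lam - 1)) ?t"
    using qF q_id F_id[of q 0 ?t] lam(1) by (auto simp: of_nat_diff)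
  then obtain m where m: "m < lam - 1" "q \<in> F (?l - 1 - int m) ?t" "q \<notin> F (?l - 1 - int (Suc m)) ?t"
    using ex_least_nat_less[of "\<lambda>k. q \<notin> F (?l - 1 - int k) ?t" "lam - 1"]
    by (metis (no_types, lifting) Suc_le_lessD less_Suc_eq_le lessI nat_less_le not_less_eq_eq)
  define r where "r = ?l - 1 - int m"
  have r: "1 \<le> r" "r \<le> ?l - 1" "q \<in> F r ?t" "q (c (r - 1)) \<noteq> c (r - 1)"
    using m F_ext_down[OF m(2)] by (auto simp: r_def algebra_simps)
  have q_aut: "q \<in> auts" using qF by (simp add: F_def)

  have "s \<le> r"
  proof (rule ccontr)
    assume "\<not> s \<le> r"
    have "q (c j) = c j" if "r \<le> j" "j \<le> s + ?t - 1" for j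
      using that s(3) r(3) assms by (cases "j \<le> ?t") (auto simp: F_def)
    then have "q \<in> F r (s + ?t - 1)" using q_aut by (simp add: F_def)
    with q_id F_id[of q r "s + ?t - 1"] \<open>\<not> s \<le> r\<close> show False by auto
  qed

  have s_bound: "?t - 1 \<le> ?l + s"
  proof (rule ccontr)
    assume small: "\<not> ?t - 1 \<le> ?l + s"
    let ?y = "?l + s"
    have "comm (X ?y) (X ?l)" using s by (intro comm_less) auto
    \<comment> \<open>This commutator is a product of \<open>X j\<close> with
      \<open>1 \<le> j\<close> and \<open>j < ?l + s\<close>, all at gap less than
      \<open>lam\<close> from \<open>?l\<close>.\<close>
    moreover have "comm (X 0 \<circ> X ?y \<circ> X 0 \<circ> X ?y) (X ?l)"
      by (rule F_comm[OF commutator_F(1)]) (use small s in \<open>auto intro!: comm_less\<close>)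
    ultimately have q_comm: "comm q (X ?y)" unfolding q_def by (rule commutator_comm)
    have fx: "q (c (s + ?t - 1 - 1)) = c (s + ?t - 1 - 1)" "q (c (s + ?t - 1)) = c (s + ?t - 1)"
      using s assms by (auto simp: F_def)
    have "X s (q (c (s + ?t))) = c (s + ?t)"
      using swap_up(1)[OF q_aut fx] s(4) X_up(2)[of "s + ?t" s] by simp
    moreover have "X s \<circ> q \<in> F (?l - 1) (s + ?t - 1)"
      using s X_F F_comp by auto
    ultimately have "X s \<circ> q \<in> F (?l - 1) (s + ?t)" using F_ext_up[of "X s \<circ> q" _ "s + ?t - 1"] by simp
    \<comment> \<open>What remains of \<open>q\<close> is a product of \<open>X j\<close> with
      \<open>s < j\<close> and \<open>j < ?l\<close>, at gap less than \<open>lam\<close> from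
      \<open>?y\<close>. Only \<open>X s\<close> itself stands at gap exactly
      \<open>lam\<close>.\<close>
    then have "comm (X s \<circ> q) (X ?y)"
      by (rule F_comm) (use s assms in \<open>auto intro!: comm_less\<close>)
    with q_comm have "comm (X s) (X ?y)" using comm_cancel bij by blast
    with not_comm_lam[of ?y s] show False by simp
  qed

  have r_bound: "?t - 1 \<le> 2 * ?l - r"
  proof (rule ccontr)
    assume small: "\<not> ?t - 1 \<le> 2 * ?l - r"
    \<comment> \<open>The mirror image of the previous bound, with 0 and \<open>?l\<close>
      exchanged; the commutator then first appears as the inverse of \<open>q\<close>.\<close>
    let ?y = "r - ?l"
    have "comm (X ?y) (X 0)" using r by (intro comm_less) auto
    moreover have "comm (X ?l \<circ> X ?y \<circ> X ?l \<circ> X ?y) (X 0)"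
      by (rule F_comm[OF commutator_F(2)]) (use small r in \<open>auto intro!: comm_less\<close>)
    ultimately have *: "comm (X ?l \<circ> X 0 \<circ> X ?l \<circ> X 0) (X ?y)" by (rule commutator_comm)
    have q_comm: "comm q (X ?y)"
      unfolding comm_def
    proof
      fix v
      have "X ?l (X 0 (X ?l (X 0 (X ?y (q v))))) = X ?y (X ?l (X 0 (X ?l (X 0 (q v)))))"
        using * by (simp add: comm_def)
      also have "\<dots> = X ?y v" by (simp add: q_def X_invol)
      finally show "q (X ?y v) = X ?y (q v)" by (simp add: q_def) (metis X_invol)
    qed
    have fx: "q (c (r + 1)) = c (r + 1)" "q (c r) = c r"
      using r assms by (auto simp: F_def)
    have "X r (q (c (r - 1))) = c (r - 1)"
      using swap_down(1)[OF q_aut fx r(4)] X_down(2)[of r] by simp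
    moreover have "X r \<circ> q \<in> F r ?t"
      using r X_F F_comp by auto
    ultimately have "X r \<circ> q \<in> F (r - 1) ?t" using F_ext_down by simp
    then have "comm (X r \<circ> q) (X ?y)"
      by (rule F_comm) (use r assms in \<open>auto intro!: comm_less\<close>)
    with q_comm have "comm (X r) (X ?y)" using comm_cancel bij by blast
    with not_comm_lam[of r ?y] show False by (simp add: comm_sym)
  qed
  from s(1) \<open>s \<le> r\<close> r(2) s_bound r_bound r(3) show ?thesis unfolding q_def by (rule that)
qed

lemma X_swap: "X i v = w \<Longrightarrow> v = X i w"
  by (auto simp: X_invol)

text \<open>Involutions at gap at most 3 commute here, those at gap 4 do not. The commutator
  \<open>w\<close> of \<open>X 0\<close> and \<open>X 5\<close> fixes \<open>X 6 (c 4)\<close>,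
  since its factors are under control. A reflection about \<open>c 6\<close>, corrected so as to fix
  \<open>c 5\<close>, shows that \<open>w\<close> sends \<open>X 6 (u 5)\<close> to the same vertex,
  against injectivity.\<close>

lemma t_neq_7:
  assumes t: "t = 7" and lam4: "lam = 4"
  shows False
proof -
  note inv = X_invol
  define w where "w = X 0 \<circ> X 5 \<circ> X 0 \<circ> X 5"
  have wF: "w \<in> F 4 7" using commutator_F(1)[of 0 5] t by (simp add: w_def)
  have w_aut: "w \<in> auts" using wF by (simp add: F_def)
  have "w \<in> {f. (\<forall>v. f (f v) = v) \<and> (\<forall>j. 1 \<le> j \<longrightarrow> j \<le> 4 \<longrightarrow> comm (X j) f)}"
  proof (rule F_generate[OF wF])
    fix j h assume "7 - int t + 1 \<le> j" "j \<le> 4"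
      and h: "h \<in> {f. (\<forall>v. f (f v) = v) \<and> (\<forall>j. 1 \<le> j \<longrightarrow> j \<le> 4 \<longrightarrow> comm (X j) f)}"
    then have j: "1 \<le> j" "j \<le> 4" using t by auto
    have "comm (X k) (X j)" if "1 \<le> k" "k \<le> 4" for k
      by (rule comm_less) (use that j lam4 in auto)
    with h j show "X j \<circ> h \<in> {f. (\<forall>v. f (f v) = v) \<and> (\<forall>j. 1 \<le> j \<longrightarrow> j \<le> 4 \<longrightarrow> comm (X j) f)}"
      by (simp add: comm_def inv)
  qed (auto simp: comm_def)
  then have w_invol: "w (w v) = v" for v by simp
  \<comment> \<open>Conjugating a commutator of two involutions by one of them inverts it, and
    \<open>w\<close> is its own inverse.\<close>
  have w5: "comm w (X 5)"
    unfolding comm_def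
  proof
    fix v
    have "X 5 (w (X 5 v)) = w (w (X 5 (w (X 5 v))))" by (simp add: w_invol)
    also have "w (X 5 (w (X 5 v))) = v" by (simp add: w_def inv)
    finally show "w (X 5 v) = X 5 (w v)" by (rule X_swap)
  qed
  \<comment> \<open>If \<open>w\<close> moved \<open>c 8\<close>, it would be \<open>X 1\<close>
    times a product of \<open>X 2\<close>, \<open>X 3\<close>, \<open>X 4\<close>. Since
    \<open>w\<close> and the latter three commute with \<open>X 5\<close>, so would
    \<open>X 1\<close>, at gap 4.\<close>
  have "w (c 8) = c 8"
  proof (rule ccontr)
    assume "w (c 8) \<noteq> c 8"
    then have "w (c 8) = u 7" using swap_up(1)[OF w_aut, of 7] wF by (auto simp: F_def)
    then have "X 1 (w (c 8)) = c 8" using X_up(2)[of 8 1] t by simp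
    moreover have "X 1 \<circ> w \<in> F 4 7" by (rule F_comp[OF X_F wF]) (use t in auto)
    ultimately have "X 1 \<circ> w \<in> F 4 8" using F_ext_up[of "X 1 \<circ> w" 4 7] by simp
    then have "comm (X 1 \<circ> w) (X 5)"
    proof (rule F_comm)
      fix j assume "8 - int t + 1 \<le> j" "j \<le> 4"
      then have "2 \<le> j" "j \<le> 4" using t by simp_all
      then show "comm (X j) (X 5)" by (intro comm_less) (simp add: lam4)
    qed simp
    then have "comm (X 1) (X 5)" using w5 comm_cancel w_aut by (auto simp: auts_def)
    with not_comm_lam[of 5 1] lam4 show False by simp
  qed
  with wF have wF': "w \<in> F 4 8" using F_ext_up[of w 4 7] by simp

  have fix_X2: "X 2 (X 6 (X 2 (X 6 (c 4)))) = c 4"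
  proof -
    have "lam + 2 \<le> t" using t lam4 by simp
    then obtain s r where "int t - 1 \<le> 2 * int lam - r"
      and q: "X 0 \<circ> X (int lam) \<circ> X 0 \<circ> X (int lam) \<in> F r (int t)"
      by (rule lam_commutator)
    \<comment> \<open>The bound on \<open>r\<close> puts the commutator of \<open>X 0\<close> and
      \<open>X 4\<close> into \<open>F 2 7\<close>; rotating by two turns its fixed vertex
      \<open>c 2\<close> into \<open>c 4\<close>.\<close>
    then have "r \<le> 2" using t lam4 by simp
    with q have q2: "X 0 (X 4 (X 0 (X 4 (c 2)))) = c 2" using lam4 t by (simp add: F_def)
    obtain f where f: "f \<in> auts" "\<And>j. f (c j) = c (j + 2)" using ex_shift[of 2] by blast
    have conj: "f (X i v) = X (i + 2) (f v)" for i v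
      by (rule X_conj[where s = 2 and e = 1]) (use f in \<open>auto simp: add.commute\<close>)
    show ?thesis
      using arg_cong[OF q2, of f] by (simp add: conj f(2))
  qed
  \<comment> \<open>\<open>w\<close> is a product of \<open>X 2\<close>, \<open>X 3\<close> and
    \<open>X 4\<close>, and the conjugates of all three by \<open>X 6\<close> fix
    \<open>c 4\<close>.\<close>
  have "w \<in> {f. X 6 (f (X 6 (c 4))) = c 4}"
  proof (rule F_generate[OF wF'])
    fix j h assume "8 - int t + 1 \<le> j" "j \<le> 4" and h: "h \<in> {f. X 6 (f (X 6 (c 4))) = c 4}"
    then have "2 \<le> j" using t by simp
    with \<open>j \<le> 4\<close> consider "j = 2" | "j = 3 \<or> j = 4" by linarith
    then have "X 6 (X j (X 6 (c 4))) = c 4"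
    proof cases
      case 1
      have "X 2 (c 4) = c 4" using t by (intro X_fix) auto
      then have "X 6 (X 2 (X 6 (c 4))) = c 4"
        using X_swap[OF fix_X2] by simp
      with 1 show ?thesis by simp
    next
      case 2
      then have "comm (X 6) (X j)" using lam4 by (intro comm_less) auto
      moreover have "X j (c 4) = c 4" using 2 t by (intro X_fix) auto
      ultimately show ?thesis by (simp add: comm_def inv)
    qed
    moreover have "h (X 6 (c 4)) = X 6 (c 4)" using h by (auto dest: X_swap)
    ultimately show "X j \<circ> h \<in> {f. X 6 (f (X 6 (c 4))) = c 4}" by simp
  qed (auto simp: inv)
  then have w6: "X 6 (w (X 6 (c 4))) = c 4" by simp

  \<comment> \<open>\<open>y\<close> reverses the path \<open>c 5\<close>, \<open>c 6\<close>,
    \<open>c 7\<close>, and so does the reflection about \<open>c 6\<close>. Their composite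
    \<open>f\<close> fixes \<open>c 5\<close> and \<open>c 6\<close>, so it can only permute the
    other two neighbours of \<open>c 5\<close>, both of which \<open>X 1\<close> fixes.\<close>
  define y where "y = X 0 \<circ> X 6 \<circ> X 0"
  have y_invol: "y (y v) = v" for v by (simp add: y_def inv)
  have y_c: "y (c 5) = c 7" "y (c 6) = c 6" "y (c 7) = c 5"
  proof -
    have "X 0 (c 5) = c 5" "X 0 (c 6) = c 6" "X 6 (c 6) = c 6"
      using X_fix[of 0 5] X_fix[of 0 6] X_fix[of 6 6] t by simp_all
    moreover have "X 6 (c 5) = u 6" "X 6 (u 6) = c 5" using X_down[of 6] by simp_all
    moreover have "X 0 (c 7) = u 6" "X 0 (u 6) = c 7" using X_up[of 7 0] t by simp_all
    ultimately show "y (c 5) = c 7" "y (c 6) = c 6" "y (c 7) = c 5" by (simp_all add: y_def)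
  qed
  obtain r where r: "r \<in> auts" "\<And>j. r (c j) = c (12 - j)" using ex_reflect[of 12] by blast
  have conj: "r (X 1 v) = X 5 (r v)" for v
    by (rule X_conj[where s = 12 and e = "-1"]) (use r t in auto)
  define f where "f = y \<circ> r"
  have f_aut: "f \<in> auts" unfolding f_def y_def by (intro auts_comp X_auts r)
  have f_c: "f (c 5) = c 5" "f (c 6) = c 6" by (simp_all add: f_def r y_c)
  have "surj f" using f_aut by (auto simp: auts_def bij_def)
  then obtain z where z: "f z = c 4" by (metis surjD)
  have "E (c 5) z" using auts_E[OF f_aut, of "c 5" z] c_E(3)[of 5] z f_c by simp
  moreover have "z \<noteq> c 6" using z f_c c_neq(1)[of 5] by auto
  ultimately have "z = c 4 \<or> z = u 5" using nbr_c[of 5 z] by simp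
  moreover have "X 1 (c 4) = c 4" "X 1 (u 5) = u 5"
    using X_fix[of 1 4] fix_u[OF X(1)[of 1], of 5] t by simp_all
  ultimately have "X 1 z = z" by auto
  then have "X 5 (r z) = r z" using conj by metis
  moreover have "r z = y (c 4)" using z y_invol[of "r z"] by (simp add: f_def)
  moreover have "y (c 4) = X 0 (X 6 (c 4))"
    using X_fix[of 0 4] t2 t by (simp add: y_def)
  ultimately have "X 5 (X 0 (X 6 (c 4))) = X 0 (X 6 (c 4))" by simp
  then have "w (X 5 (X 6 (c 4))) = X 6 (c 4)" by (simp add: w_def inv)
  moreover have "comm (X 5) (X 6)" using lam4 by (intro comm_less) auto
  moreover have "X 5 (c 4) = u 5" using X_down(1)[of 5] by simp
  ultimately have "w (X 6 (u 5)) = X 6 (c 4)" by (simp add: comm_def)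
  moreover have "w (X 6 (c 4)) = X 6 (c 4)" using w6 by (rule X_swap)
  ultimately have "X 6 (u 5) = X 6 (c 4)" using auts_eq[OF w_aut] by metis
  then show False using auts_eq[OF X_auts] u(1)[of 5] by auto
qed

lemma t_le_5: "t \<le> 5"
proof (rule ccontr)
  assume "\<not> t \<le> 5"
  then have t: "6 \<le> t" by simp
  have up: "2 * lam \<le> t + 1" by (rule lam_upper)
  have "lam + 2 \<le> t" using up t by simp
  then obtain s r where "s \<le> r" "int t - 1 \<le> int lam + s" "int t - 1 \<le> 2 * int lam - r"
    by (rule lam_commutator)
  then have "2 * (t - 1) \<le> 3 * lam" by linarith
  with up t have "t = 7 \<and> lam = 4" by presburger
  with t_neq_7 show False by blast
qed

end

lemma (in arc_transitive_cage) arc_transitivity_le_5: "t \<le> 5"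
proof -
  obtain x where "x \<in> V" using ne by blast
  then obtain y where "E x y" using ex_nbr2 by blast
  then have "chain E [x, y]" by simp
  from chain_extend_to[OF this, of "Suc t"] t2 obtain xs where xs: "chain E xs" "length xs = Suc t" by auto
  obtain c where "cyc c" by (rule ex_cyc[OF xs])
  then interpret cage_cycle V E t g c by unfold_locales
  show ?thesis by (rule t_le_5)
qed

section \<open>Counting arcs in Moore graphs\<close>

context cubic_graph
begin

definition arcs_from :: "nat \<Rightarrow> 'v \<Rightarrow> 'v list set" where
  "arcs_from k v = {xs. chain E xs \<and> length xs = Suc k \<and> hd xs = v}"

lemma arcs_from_1:
  assumes "v \<in> V"
  shows "finite (arcs_from 1 v)" "card (arcs_from 1 v) = 3"
proof -
  have *: "arcs_from 1 v = (\<lambda>w. [v, w]) ` {w. E v w}"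
    by (auto simp: arcs_from_def length_Suc_conv)
  have "card {w. E v w} = 3" using deg assms by blast
  then show "finite (arcs_from 1 v)" "card (arcs_from 1 v) = 3"
    unfolding * by (auto simp: card_image inj_on_def intro: card_ge_0_finite)
qed

text \<open>Three choices for the first step, two for every later one.\<close>

lemma card_arcs_from:
  assumes "v \<in> V" "1 \<le> k"
  shows "finite (arcs_from k v) \<and> card (arcs_from k v) = 3 * 2 ^ (k - 1)"
  using assms(2)
proof (induction k rule: dec_induct)
  case base
  then show ?case using arcs_from_1[OF assms(1)] by simp
next
  case (step k)
  define S where "S xs = {w. E (last xs) w \<and> w \<noteq> xs ! (k - 1)}" for xs
  have S: "finite (S xs) \<and> card (S xs) = 2" if "xs \<in> arcs_from k v" for xs
  proof -
    have "2 \<le> length xs" using that step by (simp add: arcs_from_def)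
    then obtain ys p q where xs: "xs = ys @ [p, q]" by (rule snoc2E)
    then have "E p q" using that by (metis (mono_tags) arcs_from_def mem_Collect_eq chain.simps(3) chain_append)
    moreover have "xs ! (k - 1) = p" using that xs step by (auto simp: arcs_from_def nth_append)
    moreover have "card {w. E q w} = 3" using deg \<open>E p q\<close> E_in2 by blast
    moreover from this have "finite {w. E q w}" by (intro card_ge_0_finite) simp
    moreover have "{w. E q w \<and> w \<noteq> p} = {w. E q w} - {p}" by auto
    ultimately show ?thesis using xs adj_sym[OF \<open>E p q\<close>] by (simp add: S_def)
  qed
  have "bij_betw (\<lambda>(xs, w). xs @ [w]) (Sigma (arcs_from k v) S) (arcs_from (Suc k) v)"
  proof (rule bij_betw_byWitness[where f' = "\<lambda>ys. (butlast ys, last ys)"])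
    have conv: "chain E (xs @ [w]) \<longleftrightarrow> E (last xs) w \<and> w \<noteq> xs ! (k - 1)"
      if "chain E xs" "length xs = Suc k" for xs w
    proof -
      have "2 \<le> length xs" using that step by simp
      then obtain ys p q where xs: "xs = ys @ [p, q]" by (rule snoc2E)
      then show ?thesis using that step by (auto simp: chain_snoc nth_append)
    qed
    show "(\<lambda>(xs, w). xs @ [w]) ` Sigma (arcs_from k v) S \<subseteq> arcs_from (Suc k) v"
      by (auto simp: arcs_from_def S_def conv hd_append)
    show "(\<lambda>ys. (butlast ys, last ys)) ` arcs_from (Suc k) v \<subseteq> Sigma (arcs_from k v) S"
    proof
      fix z assume "z \<in> (\<lambda>ys. (butlast ys, last ys)) ` arcs_from (Suc k) v"
      then obtain ys where ys: "chain E ys" "length ys = Suc (Suc k)" "hd ys = v" "z = (butlast ys, last ys)"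
        by (auto simp: arcs_from_def)
      obtain xs w where xs: "ys = xs @ [w]" using ys(2) by (metis append_butlast_last_id length_0_conv nat.simps(3))
      then have "chain E xs" using chain_butlast[OF ys(1)] by simp
      then show "z \<in> Sigma (arcs_from k v) S"
        using ys xs conv[of xs w] by (auto simp: arcs_from_def S_def hd_append)
    qed
    show "\<forall>a\<in>Sigma (arcs_from k v) S. (butlast (case a of (xs, w) \<Rightarrow> xs @ [w]), last (case a of (xs, w) \<Rightarrow> xs @ [w])) = a"
      by auto
    show "\<forall>a'\<in>arcs_from (Suc k) v. (case (butlast a', last a') of (xs, w) \<Rightarrow> xs @ [w]) = a'"
      by (auto simp: arcs_from_def intro!: append_butlast_last_id)
  qed
  moreover have "finite (Sigma (arcs_from k v) S)" using step S by auto
  moreover have "card (Sigma (arcs_from k v) S) = 3 * 2 ^ (Suc k - 1)"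
  proof -
    have "card (Sigma (arcs_from k v) S) = (\<Sum>xs\<in>arcs_from k v. card (S xs))"
      using step S by (intro card_SigmaI) auto
    also have "\<dots> = 2 * (3 * 2 ^ (k - 1))" using step S by simp
    finally show ?thesis using step by (cases k) auto
  qed
  ultimately show ?case using bij_betw_finite bij_betw_same_card by metis
qed

lemma card_arcs:
  assumes "1 \<le> k"
  shows "card {xs. chain E xs \<and> length xs = Suc k} = card V * (3 * 2 ^ (k - 1))"
    "finite {xs. chain E xs \<and> length xs = Suc k}"
proof -
  have *: "{xs. chain E xs \<and> length xs = Suc k} = (\<Union>v\<in>V. arcs_from k v)"
  proof -
    have "hd xs \<in> V" if "chain E xs" "length xs = Suc k" for xs
    proof -
      have "2 \<le> length xs" using that assms by simp
      then have "set xs \<subseteq> V" "xs \<noteq> []" using chain_in_V that by auto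
      then show ?thesis by auto
    qed
    then show ?thesis by (auto simp: arcs_from_def)
  qed
  show "finite {xs. chain E xs \<and> length xs = Suc k}"
    unfolding * using fin card_arcs_from assms by auto
  have "card (\<Union>v\<in>V. arcs_from k v) = (\<Sum>v\<in>V. card (arcs_from k v))"
    by (rule card_UN_disjoint) (use fin card_arcs_from assms in \<open>auto simp: arcs_from_def\<close>)
  then show "card {xs. chain E xs \<and> length xs = Suc k} = card V * (3 * 2 ^ (k - 1))"
    unfolding * using card_arcs_from assms by simp
qed

end

text \<open>Whenever a walk being extended grows into a \<open>t\<close>-arc, its closing walk, with
  only \<open>g - t < t\<close> edges, takes its place. So the diameter is at most
  \<open>t - 1\<close>.\<close>

lemma (in cage) ex_short_chain:
  assumes "v \<in> V" "w \<in> V"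
  shows "\<exists>xs. chain E xs \<and> xs \<noteq> [] \<and> length xs \<le> t \<and> hd xs = v \<and> last xs = w"
  using conn[OF assms]
proof (induction rule: rtranclp_induct)
  case base
  then show ?case using t2 by (intro exI[of _ "[v]"]) auto
next
  case (step y z)
  then obtain xs where xs: "chain E xs" "xs \<noteq> []" "length xs \<le> t" "hd xs = v" "last xs = y" by blast
  show ?case
  proof (cases "length xs = 1")
    case True
    then have "xs = [y]" using xs by (cases xs) auto
    then show ?thesis using xs step t2 by (intro exI[of _ "[y, z]"]) auto
  next
    case False
    then have "2 \<le> length xs" using xs(2) by (cases xs; cases "tl xs") auto
    then obtain ys p q where ys: "xs = ys @ [p, q]" by (rule snoc2E)
    show ?thesis
    proof (cases "z = p")
      case True
      then show ?thesis using xs ys chain_butlast[OF xs(1)]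
        by (intro exI[of _ "butlast xs"]) (auto simp: butlast_append hd_append)
    next
      case False
      then have xz: "chain E (xs @ [z])" using xs ys step by (auto simp: chain_snoc)
      show ?thesis
      proof (cases "length xs = t")
        case True
        obtain ws where ws: "chain E ws" "length ws = Suc (g - t)" "hd ws = v" "last ws = z"
          using closing[OF xz] True xs by auto
        then show ?thesis using tg t2 g3 by (intro exI[of _ ws]) auto
      next
        case False
        then show ?thesis using xz xs by (intro exI[of _ "xs @ [z]"]) auto
      qed
    qed
  qed
qed

text \<open>The Moore bound is attained: two walks from a vertex with at most \<open>t - 1\<close>
  edges each have fewer than \<open>g\<close> edges together, so different walks end differently,
  and they reach every vertex.\<close>

lemma (in cage) card_V_odd:
  assumes odd: "g + 1 = 2 * t"
  shows "card V + 2 = 3 * 2 ^ (t - 1)"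
proof -
  obtain v where v: "v \<in> V" using ne by blast
  define B where "B = {xs. chain E xs \<and> xs \<noteq> [] \<and> length xs \<le> t \<and> hd xs = v}"
  have "bij_betw last B V"
    unfolding bij_betw_def
  proof
    show "inj_on last B"
    proof
      fix xs ys assume "xs \<in> B" "ys \<in> B" "last xs = last ys"
      then show "xs = ys" using odd by (intro unique) (auto simp: B_def)
    qed
    have "last xs \<in> V" if "xs \<in> B" for xs
    proof (cases "2 \<le> length xs")
      case True
      then show ?thesis using chain_in_V[of xs] that unfolding B_def by auto
    next
      case False
      then show ?thesis using that v by (cases xs; cases "tl xs") (auto simp: B_def)
    qed
    then show "last ` B = V" using ex_short_chain[OF v] by (auto simp: B_def image_iff)
  qed
  then have "card B = card V" by (rule bij_betw_same_card)
  moreover have "B = {[v]} \<union> (\<Union>k\<in>{1..<t}. arcs_from k v)"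
  proof -
    have "xs = [v] \<or> (\<exists>k\<in>{1..<t}. length xs = Suc k)" if "xs \<in> B" for xs
      using that by (cases xs; cases "tl xs") (auto simp: B_def)
    then show ?thesis using t2 by (auto simp: B_def arcs_from_def)
  qed
  moreover have "card ({[v]} \<union> (\<Union>k\<in>{1..<t}. arcs_from k v)) = 1 + (\<Sum>k\<in>{1..<t}. 3 * 2 ^ (k - 1))"
  proof -
    have "card (\<Union>k\<in>{1..<t}. arcs_from k v) = (\<Sum>k\<in>{1..<t}. card (arcs_from k v))"
      by (rule card_UN_disjoint) (use card_arcs_from v in \<open>auto simp: arcs_from_def\<close>)
    also have "\<dots> = (\<Sum>k\<in>{1..<t}. 3 * 2 ^ (k - 1))" using card_arcs_from v by (intro sum.cong) auto
    finally show ?thesis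
      using card_arcs_from v by (subst card_Un_disjoint) (auto simp: arcs_from_def)
  qed
  moreover have "(\<Sum>k\<in>{1..<Suc m}. 3 * 2 ^ (k - 1)) + 3 = 3 * (2::nat) ^ m" for m
    by (induction m) auto
  from this[of "t - 1"] have "(\<Sum>k\<in>{1..<t}. 3 * 2 ^ (k - 1)) + 3 = 3 * (2::nat) ^ (t - 1)"
    using t2 by simp
  ultimately show ?thesis by simp
qed

text \<open>Restriction to the indices from 0 to \<open>t\<close> matches the maps satisfying
  \<open>cyc\<close> with the \<open>t\<close>-arcs, and rotation splits these maps into orbits of
  size exactly \<open>g\<close>.\<close>

lemma (in cage) g_dvd_card_arcs: "g dvd card V * (3 * 2 ^ (t - 1))"
proof -
  define C where "C = Collect cyc"
  have gt: "t < g" using tg t2 g3 by auto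
  have per: "c (i + int g) = c i" if "c \<in> C" for c i using that unfolding C_def cyc_def by blast
  have "bij_betw (\<lambda>c. map c [0..int t]) C {xs. chain E xs \<and> length xs = Suc t}"
    unfolding bij_betw_def
  proof
    show "inj_on (\<lambda>c. map c [0..int t]) C"
    proof
      fix c c' assume c: "c \<in> C" "c' \<in> C" and eq: "map c [0..int t] = map c' [0..int t]"
      have eq: "c j = c' j" if "0 \<le> j" "j \<le> int t" for j
        using eq that by auto
      have "cyc c" "cyc c'" using c by (simp_all add: C_def)
      from cyc_determined[OF per[OF c(1)] cyc_chain[OF this(1)] per[OF c(2)] cyc_chain[OF this(2)] eq]
      have "c j = c' j" for j by simp
      then show "c = c'" by blast
    qed
    have "xs \<in> (\<lambda>c. map c [0..int t]) ` C" if xs: "chain E xs" "length xs = Suc t" for xs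
    proof -
      obtain c where c: "cyc c" "\<And>j. j \<le> t \<Longrightarrow> c (int j) = xs ! j" using ex_cyc[OF xs] by blast
      have "map c [0..int t] = xs" by (rule nth_equalityI) (use c xs in auto)
      with c show ?thesis by (auto simp: C_def)
    qed
    then show "(\<lambda>c. map c [0..int t]) ` C = {xs. chain E xs \<and> length xs = Suc t}"
      using cyc_chain by (auto simp: C_def)
  qed
  moreover have t1: "1 \<le> t" using t2 by simp
  ultimately have C: "card C = card V * (3 * 2 ^ (t - 1))" "finite C"
    using card_arcs[OF t1] bij_betw_same_card bij_betw_finite by metis+
  define sh where "sh c n = (\<lambda>i. c (i + int n))" for c :: "int \<Rightarrow> 'a" and n
  have shC: "sh c n \<in> C" if "c \<in> C" for c n
  proof -
    have "E (c (i + int n)) (c (i + int n + 1))" "c (i + int n) \<noteq> c (i + int n + 2)"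
      "c (i + int n + int g) = c (i + int n)" for i
      using that unfolding C_def cyc_def by blast+
    then show ?thesis by (simp add: C_def cyc_def sh_def algebra_simps)
  qed
  have sh_sh: "sh (sh c n) m = sh c (n + m)" for c n m
    by (auto simp: sh_def algebra_simps)
  have sh_mod: "sh c n = sh c (n mod g)" if "c \<in> C" for c n
  proof
    fix i
    have per: "(\<lambda>j. c (i + j)) (j + int g) = (\<lambda>j. c (i + j)) j" for j
      using per[OF that, of "i + j"] by (simp add: add.assoc)
    show "sh c n i = sh c (n mod g) i"
      using periodic_mod[of "\<lambda>j. c (i + j)", OF per, of "int n"] by (simp add: sh_def zmod_int)
  qed
  define cls where "cls c = sh c ` {..<g}" for c
  \<comment> \<open>Two equal rotations would make the cycle revisit a vertex in fewer than
    \<open>g\<close> steps.\<close>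
  have inj: "inj_on (sh c) {..<g}" if "c \<in> C" for c
  proof
    fix n m assume nm: "n \<in> {..<g}" "m \<in> {..<g}" "sh c n = sh c m"
    have False if "n < m" "m < g" "sh c n = sh c m" for n m
    proof -
      have "c (int n) = c (int m)" using fun_cong[OF that(3), of 0] by (simp add: sh_def)
      moreover have "chain E (map c [int n..int m])" using cyc_chain \<open>c \<in> C\<close> by (simp add: C_def)
      moreover have "hd (map c [int n..int m]) = c (int n)" using that by (simp add: upto_rec1)
      moreover have "last (map c [int n..int m]) = c (int m)" using that by (simp add: upto_rec2)
      moreover have "2 \<le> length (map c [int n..int m])" using that by simp
      ultimately have "g < length (map c [int n..int m])"
        using girth unfolding girth_ge_def by metis
      then show False using that by simp
    qed
    then show "n = m" using nm by (metis lessThan_iff nat_neq_iff)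
  qed
  have mem: "c \<in> cls c" for c using g3 unfolding cls_def sh_def by (auto intro!: image_eqI[of _ _ 0])
  have cls_eq: "cls (sh c n) = cls c" if "c \<in> C" for c n
  proof -
    have sub: "cls (sh c n) \<subseteq> cls c" if "c \<in> C" for c n
    proof
      fix d assume "d \<in> cls (sh c n)"
      then obtain m where "d = sh c (n + m)" by (auto simp: cls_def sh_sh)
      then have "d = sh c ((n + m) mod g)" using sh_mod[OF that] by simp
      then show "d \<in> cls c" using g3 by (auto simp: cls_def)
    qed
    have "n mod g \<le> g" using g3 by (simp add: less_imp_le)
    have "sh (sh c n) (g - n mod g) = sh (sh c (n mod g)) (g - n mod g)" using sh_mod[OF that, of n] by simp
    also have "\<dots> = sh c g" using \<open>n mod g \<le> g\<close> by (simp add: sh_sh)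
    also have "\<dots> = c" using sh_mod[OF that, of g] by (simp add: sh_def)
    finally have "cls c \<subseteq> cls (sh c n)" using sub[OF shC[OF that]] by metis
    with sub[OF that] show ?thesis by blast
  qed
  have U: "\<Union> (cls ` C) = C" using mem shC by (auto simp: cls_def)
  have "g dvd card (\<Union> (cls ` C))"
  proof (rule dvd_partition)
    show "finite (\<Union> (cls ` C))" using U C by simp
    show "\<forall>c\<in>cls ` C. g dvd card c" using inj by (auto simp: cls_def card_image)
    show "\<forall>c1\<in>cls ` C. \<forall>c2\<in>cls ` C. c1 \<noteq> c2 \<longrightarrow> c1 \<inter> c2 = {}"
    proof (intro ballI impI)
      fix c1 c2 assume "c1 \<in> cls ` C" "c2 \<in> cls ` C" "c1 \<noteq> c2"
      then obtain c d where cd: "c \<in> C" "d \<in> C" "c1 = cls c" "c2 = cls d" by blast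
      show "c1 \<inter> c2 = {}"
      proof (rule ccontr)
        assume "c1 \<inter> c2 \<noteq> {}"
        then obtain n m where "sh c n = sh d m" using cd by (auto simp: cls_def)
        then have "cls c = cls d" using cls_eq cd by metis
        with cd \<open>c1 \<noteq> c2\<close> show False by simp
      qed
    qed
  qed
  then show ?thesis using U C by simp
qed

text \<open>The Moore count gives 22 and 46 vertices, but 7 does not divide \<open>22 * 24\<close>,
  nor 9 \<open>46 * 48\<close>.\<close>

lemma (in cage) exceptional:
  assumes "g + 1 = 2 * t"
  shows "t \<noteq> 4" "t \<noteq> 5"
proof -
  have V: "card V + 2 = 3 * 2 ^ (t - 1)" using card_V_odd[OF assms] .
  have dvd: "g dvd card V * (3 * 2 ^ (t - 1))" by (rule g_dvd_card_arcs)
  show "t \<noteq> 4"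
  proof
    assume "t = 4"
    then have "card V = 22" "g = 7" using V assms by auto
    with dvd \<open>t = 4\<close> show False by simp
  qed
  show "t \<noteq> 5"
  proof
    assume "t = 5"
    then have "card V = 46" "g = 9" using V assms by auto
    with dvd \<open>t = 5\<close> show False by simp
  qed
qed

section \<open>Canonical labellings around a shortest cycle\<close>

context cage_with_cycle
begin

lemma closeE:
  assumes xs: "chain E xs" "length xs = Suc t"
  obtains ys where "chain E ys" "length ys = Suc (g - t)" "hd ys = hd xs" "last ys = last xs"
    "ys ! (g - t - 1) \<noteq> xs ! (t - 1)" "ys ! 1 \<noteq> xs ! 1"
  using closing[OF xs] closing_ends[OF xs] by metis

lemma c_wrap: "k = j + int g \<Longrightarrow> c k = c j"
  using c_g by simp

lemma u_wrap: "k = j + int g \<Longrightarrow> u k = u j"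
  unfolding u_def by (simp add: c_wrap[of "j + int g" j] c_wrap[of "j + int g - 1" "j - 1"] c_wrap[of "j + int g + 1" "j + 1"])

lemma nbr_c':
  shows "E (c (i + 1)) y \<or> E y (c (i + 1)) \<Longrightarrow> y = c i \<or> y = c (i + 2) \<or> y = u (i + 1)"
    and "E (c (i + 2)) y \<or> E y (c (i + 2)) \<Longrightarrow> y = c (i + 1) \<or> y = c (i + 3) \<or> y = u (i + 2)"
    and "E (c (i + 3)) y \<or> E y (c (i + 3)) \<Longrightarrow> y = c (i + 2) \<or> y = c (i + 4) \<or> y = u (i + 3)"
    and "E (c (i + 4)) y \<or> E y (c (i + 4)) \<Longrightarrow> y = c (i + 3) \<or> y = c (i + 5) \<or> y = u (i + 4)"
    and "E (c (i + 5)) y \<or> E y (c (i + 5)) \<Longrightarrow> y = c (i + 4) \<or> y = c (i + 6) \<or> y = u (i + 5)"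
proof -
  have "y = c a \<or> y = c b \<or> y = u k" if "E (c k) y \<or> E y (c k)" "k = a + 1" "b = k + 1" for k a b
    using nbr_c[of k y] adj_sym that by auto
  from this[of "i + 1" i "i + 2"] this[of "i + 2" "i + 1" "i + 3"] this[of "i + 3" "i + 2" "i + 4"]
    this[of "i + 4" "i + 3" "i + 5"] this[of "i + 5" "i + 4" "i + 6"]
  show "E (c (i + 1)) y \<or> E y (c (i + 1)) \<Longrightarrow> y = c i \<or> y = c (i + 2) \<or> y = u (i + 1)"  "E (c (i + 2)) y \<or> E y (c (i + 2)) \<Longrightarrow> y = c (i + 1) \<or> y = c (i + 3) \<or> y = u (i + 2)"  "E (c (i + 3)) y \<or> E y (c (i + 3)) \<Longrightarrow> y = c (i + 2) \<or> y = c (i + 4) \<or> y = u (i + 3)"  "E (c (i + 4)) y \<or> E y (c (i + 4)) \<Longrightarrow> y = c (i + 3) \<or> y = c (i + 5) \<or> y = u (i + 4)"  "E (c (i + 5)) y \<or> E y (c (i + 5)) \<Longrightarrow> y = c (i + 4) \<or> y = c (i + 6) \<or> y = u (i + 5)"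
    by (metis add.assoc one_add_one numeral_Bit0 numeral_Bit1 numeral_One)+
qed

lemma c_adj: "k = j + 1 \<or> j = k + 1 \<Longrightarrow> E (c j) (c k)"
  using c_E by auto

lemma c_neq2: "k = j + 2 \<or> j = k + 2 \<Longrightarrow> c j \<noteq> c k"
proof -
  have "c j \<noteq> c (j + 2)" for j using c_neq(1)[of "j + 1"] by (simp add: add.assoc)
  then show "k = j + 2 \<or> j = k + 2 \<Longrightarrow> c j \<noteq> c k" by metis
qed

lemma u_adj: "E (c i) (u i)" "E (u i) (c i)"
  using u adj_sym by auto

lemma u_neq: "k = i + 1 \<or> i = k + 1 \<Longrightarrow> c k \<noteq> u i" "k = i + 1 \<or> i = k + 1 \<Longrightarrow> u i \<noteq> c k"
  using u[of i] by auto

lemmas c_facts = c_adj c_neq2 u_adj u_neq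

section \<open>Forced adjacencies off the cycle for girths 3 to 6\<close>

lemma third_neighbours_3:
  assumes "g = 3" "t = 2"
  shows "u (i + 1) = u i"
proof -
  have "chain E [u i, c i, c (i + 1)]" by (simp add: c_facts)
  then obtain ys where ys: "chain E ys" "length ys = 2" "hd ys = u i" "last ys = c (i + 1)"
    by (rule closeE) (use assms in auto)
  then have "E (c (i + 1)) (u i)" by (auto simp: numeral_2_eq_2 length_Suc_conv intro: adj_sym)
  moreover have "c (i + 2) = c (i - 1)" using assms by (intro c_wrap) simp
  then have "u i \<noteq> c (i + 2)" using u_neq[of "i - 1" i] by simp
  moreover have "u i \<noteq> c i" using u_adj irrefl by metis
  ultimately show ?thesis using nbr_c'(1)[of i "u i"] by auto
qed

lemma third_neighbours_4:
  assumes "g = 4" "t = 3"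
  shows "u (i + 2) = u i" "E (u i) (u (i + 1))"
proof -
  have "chain E [u i, c i, c (i + 1), c (i + 2)]" by (simp add: c_facts)
  then obtain ys where ys: "chain E ys" "length ys = 2" "hd ys = u i" "last ys = c (i + 2)"
    by (rule closeE) (use assms in auto)
  then have "E (c (i + 2)) (u i)" by (auto simp: numeral_2_eq_2 length_Suc_conv intro: adj_sym)
  moreover have "c (i + 3) = c (i - 1)" using assms by (intro c_wrap) simp
  then have "u i \<noteq> c (i + 3)" using u_neq[of "i - 1" i] by simp
  moreover have "u i \<noteq> c (i + 1)" by (simp add: c_facts)
  ultimately show "u (i + 2) = u i" using nbr_c'(2)[of i "u i"] by auto
  have "chain E [u i, c i, c (i + 1), u (i + 1)]" by (simp add: c_facts)
  then obtain ys where ys: "chain E ys" "length ys = 2" "hd ys = u i" "last ys = u (i + 1)"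
    by (rule closeE) (use assms in auto)
  then show "E (u i) (u (i + 1))" by (auto simp: numeral_2_eq_2 length_Suc_conv)
qed

text \<open>The pentagon \<open>c\<close> with the pentagram \<open>u\<close>. The walk closing the
  arc from \<open>u i\<close> to \<open>c (i + 2)\<close> cannot enter by the last edge of the arc,
  nor through \<open>c (i + 3)\<close>, which would create a 4-cycle. The same elimination of routes
  gives all the later adjacencies.\<close>

lemma third_neighbours_5:
  assumes "g = 5" "t = 3"
  shows "E (u i) (u (i + 2))"
proof -
  have "chain E [u i, c i, c (i + 1), c (i + 2)]" by (simp add: c_facts)
  then obtain ys where ys: "chain E ys" "length ys = 3" "hd ys = u i" "last ys = c (i + 2)" "ys ! 1 \<noteq> c (i + 1)"
    by (rule closeE) (use assms in auto)
  then obtain z where z: "E (u i) z" "E z (c (i + 2))" "z \<noteq> c (i + 1)"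
    by (auto simp: numeral_3_eq_3 length_Suc_conv)
  have "z \<noteq> c (i + 3)"
  proof
    assume "z = c (i + 3)"
    moreover have "c (i + 3) = c (i - 2)" using assms by (intro c_wrap) simp
    ultimately have "E (u i) (c (i - 2))" using z by simp
    then show False using unique[of "[u i, c (i - 2)]" "[u i, c i, c (i - 1), c (i - 2)]"] assms
      by (simp add: c_facts)
  qed
  then show ?thesis using z nbr_c'(2)[of i z] by auto
qed

lemma u_neq2:
  assumes "5 \<le> g"
  shows "u i \<noteq> u (i + 2)"
proof
  assume "u i = u (i + 2)"
  then have "E (u i) (c (i + 2))" using u_adj by simp
  then have "chain E [c i, u i, c (i + 2)]" by (simp add: c_facts)
  moreover have "chain E [c i, c (i + 1), c (i + 2)]" by (simp add: c_facts)
  ultimately have "[c i, u i, c (i + 2)] = [c i, c (i + 1), c (i + 2)]"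
    by (rule unique) (use assms in auto)
  then show False by (simp add: c_facts)
qed

lemma not_both_chains: "chain E xs \<Longrightarrow> chain E ys \<Longrightarrow> xs \<noteq> [] \<Longrightarrow> ys \<noteq> [] \<Longrightarrow> hd xs = hd ys \<Longrightarrow>
    last xs = last ys \<Longrightarrow> length xs + length ys < g + 2 \<Longrightarrow> length xs \<noteq> length ys \<Longrightarrow> False"
  using unique by blast

text \<open>Beyond its neighbours \<open>c i\<close> and \<open>u (i + 3)\<close>, the last
  neighbour of \<open>u i\<close> will depend only on the parity of \<open>i\<close>; this accounts
  for 6 + 6 + 2 = 14 vertices.\<close>

definition d6 :: "int \<Rightarrow> 'v" where
  "d6 i = third (u i) (c i) (u (i + 3))"

lemma third_neighbours_6:
  assumes g: "g = 6" "t = 4"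
  shows "E (u i) (u (i + 3))" "u (i + 3) \<noteq> c i" "E (u i) (d6 i)" "d6 i \<noteq> c i" "d6 i \<noteq> u (i + 3)" "d6 (i + 2) = d6 i"
proof -
  have uu: "E (u i) (u (i + 3))" for i
  proof -
    have "chain E [u i, c i, c (i + 1), c (i + 2), c (i + 3)]" by (simp add: c_facts)
    then obtain ys where ys: "chain E ys" "length ys = 3" "hd ys = u i" "last ys = c (i + 3)" "ys ! 1 \<noteq> c (i + 2)"
      by (rule closeE) (use g in auto)
    then obtain z where z: "E (u i) z" "E z (c (i + 3))" "z \<noteq> c (i + 2)"
      by (auto simp: numeral_3_eq_3 length_Suc_conv)
    have "z \<noteq> c (i + 4)"
    proof
      assume "z = c (i + 4)"
      moreover have "c (i + 4) = c (i - 2)" using g by (intro c_wrap) simp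
      ultimately have "E (u i) (c (i - 2))" using z by simp
      then show False
        using not_both_chains[of "[u i, c (i - 2)]" "[u i, c i, c (i - 1), c (i - 2)]"] g by (simp add: c_facts)
    qed
    then show ?thesis using z nbr_c'(3)[of i z] by auto
  qed
  have uc: "u (i + 3) \<noteq> c i" for i
  proof
    assume "u (i + 3) = c i"
    then have "E (c i) (c (i + 3))" using u_adj[of "i + 3"] by simp
    then show False
      using not_both_chains[of "[c i, c (i + 3)]" "[c i, c (i + 1), c (i + 2), c (i + 3)]"] g by (simp add: c_facts)
  qed
  note d = third[OF u_adj(2) uu uc[symmetric], folded d6_def]
  have d_adj: "E (u i) (d6 i)" "E (d6 i) (u i)" for i using d(3) adj_sym by auto
  show "E (u i) (u (i + 3))" "u (i + 3) \<noteq> c i" "E (u i) (d6 i)" "d6 i \<noteq> c i" "d6 i \<noteq> u (i + 3)"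
    using uu uc d by auto
  \<comment> \<open>The walk closing this arc must pass through \<open>u (i + 2)\<close>, so
    \<open>d6 i\<close> is one of its neighbours; girth excludes \<open>u (i + 5)\<close> and leaves
    \<open>d6 (i + 2)\<close>.\<close>
  have "chain E [d6 i, u i, c i, c (i + 1), c (i + 2)]" using d by (simp add: c_facts d_adj)
  then obtain ys where ys: "chain E ys" "length ys = 3" "hd ys = d6 i" "last ys = c (i + 2)"
      "ys ! 1 \<noteq> c (i + 1)" "ys ! 1 \<noteq> u i"
    by (rule closeE) (use g in auto)
  then obtain z where z: "E (d6 i) z" "E z (c (i + 2))" "z \<noteq> c (i + 1)" "z \<noteq> u i" "d6 i \<noteq> c (i + 2)"
    by (auto simp: numeral_3_eq_3 length_Suc_conv)
  have "z \<noteq> c (i + 3)"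
  proof
    assume "z = c (i + 3)"
    moreover have "u i \<noteq> c (i + 3)"
    proof -
      have "u (i + 6) = u i" using g by (intro u_wrap) simp
      then show ?thesis using uc[of "i + 3"] by (simp add: add.assoc)
    qed
    ultimately show False
      using not_both_chains[of "[d6 i, c (i + 3)]" "[d6 i, u i, u (i + 3), c (i + 3)]"] g d z
      by (simp add: c_facts d_adj uu)
  qed
  then have "z = u (i + 2)" using z nbr_c'(2)[of i z] by auto
  then have "E (u (i + 2)) (d6 i)" using z adj_sym by simp
  then have "d6 i = u (i + 5) \<or> d6 i = d6 (i + 2)"
    using d(4)[of "i + 2" "d6 i"] z by (auto simp: add.assoc)
  moreover have "d6 i \<noteq> u (i + 5)"
  proof
    assume "d6 i = u (i + 5)"
    moreover have "u (i + 5) = u (i - 1)" using g by (intro u_wrap) simp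
    ultimately have "E (u i) (u (i - 1))" using d_adj by metis
    then show False
      using not_both_chains[of "[u i, u (i - 1)]" "[u i, c i, c (i - 1), u (i - 1)]"] g by (simp add: c_facts)
  qed
  ultimately show "d6 (i + 2) = d6 i" by simp
qed

section \<open>Forced adjacencies off the cycle for girth 8\<close>

definition a8 :: "int \<Rightarrow> 'v" where
  "a8 i = (SOME z. E (u i) z \<and> E z (u (i + 4)))"

definition b8 :: "int \<Rightarrow> 'v" where
  "b8 i = third (u i) (c i) (a8 i)"

text \<open>In the end \<open>c\<close>, \<open>u\<close> and \<open>b8\<close> contribute 8
  vertices each, \<open>a8\<close> has period 4 and \<open>d8\<close> period 2, in all 30.\<close>

definition d8 :: "int \<Rightarrow> 'v" where
  "d8 i = third (a8 i) (u i) (u (i + 4))"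

context
  assumes g: "g = 8" "t = 5"
begin

lemma u_neq4: "u i \<noteq> u (i + 4)"
proof
  assume "u i = u (i + 4)"
  then have "E (u i) (c (i + 4))" "u i \<noteq> c (i + 3)" using u_adj[of "i + 4"] by (simp_all add: c_facts)
  then show False
    using not_both_chains[of "[c i, u i]" "[c i, c (i + 1), c (i + 2), c (i + 3), c (i + 4), u i]"] g adj_sym
    by (simp add: c_facts)
qed

text \<open>The arc from \<open>u i\<close> to the antipodal \<open>c (i + 4)\<close> closes up in
  three edges. By girth the last of them starts at \<open>u (i + 4)\<close>, so the first inner
  vertex is a common neighbour of \<open>u i\<close> and \<open>u (i + 4)\<close>.\<close>

lemma a8: "E (u i) (a8 i)" "E (a8 i) (u i)" "E (a8 i) (u (i + 4))" "E (u (i + 4)) (a8 i)"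
proof -
  have "chain E [u i, c i, c (i + 1), c (i + 2), c (i + 3), c (i + 4)]" by (simp add: c_facts)
  then obtain ys where ys: "chain E ys" "length ys = 4" "hd ys = u i" "last ys = c (i + 4)"
      "ys ! 2 \<noteq> c (i + 3)" "ys ! 1 \<noteq> c i"
    by (rule closeE) (use g in auto)
  then obtain x y where z: "E (u i) x" "E x y" "E y (c (i + 4))" "y \<noteq> c (i + 3)" "x \<noteq> c (i + 4)"
    by (auto simp: numeral_eq_Suc length_Suc_conv)
  have "y \<noteq> c (i + 5)"
  proof
    assume "y = c (i + 5)"
    moreover have "c (i + 5) = c (i - 3)" using g by (intro c_wrap) simp
    ultimately have "E x (c (i - 3))" using z by simp
    moreover have "u i \<noteq> c (i - 3)"
      using not_both_chains[of "[c i, u i]" "[c i, c (i - 1), c (i - 2), c (i - 3)]"] g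
      by (auto simp: c_facts)
    ultimately show False
      using not_both_chains[of "[u i, x, c (i - 3)]" "[u i, c i, c (i - 1), c (i - 2), c (i - 3)]"] g z
      by (simp add: c_facts)
  qed
  then have "y = u (i + 4)" using z nbr_c'(4)[of i y] by auto
  then have "\<exists>z. E (u i) z \<and> E z (u (i + 4))" using z by auto
  then have "E (u i) (a8 i) \<and> E (a8 i) (u (i + 4))" unfolding a8_def by (rule someI_ex)
  then show "E (u i) (a8 i)" "E (a8 i) (u i)" "E (a8 i) (u (i + 4))" "E (u (i + 4)) (a8 i)"
    using adj_sym by auto
qed

lemma u_wrap8: "u (i + 8) = u i" "u (i + 7) = u (i - 1)" "u (i + 6) = u (i - 2)" "u (i + 5) = u (i - 3)"
  using g by (auto intro: u_wrap)

lemma a8_wrap: "a8 (i + 4) = a8 i"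
proof -
  have "[u i, a8 (i + 4), u (i + 4)] = [u i, a8 i, u (i + 4)]"
    by (rule unique) (use a8[of "i + 4"] a8[of i] u_wrap8(1)[of i] u_neq4 g in \<open>auto simp: add.assoc\<close>)
  then show ?thesis by simp
qed

lemma a8_c: "a8 i \<noteq> c i"
proof
  assume "a8 i = c i"
  then have "E (c i) (u (i + 4))" using a8 by metis
  then show False
    using not_both_chains[of "[c i, u (i + 4)]" "[c i, c (i + 1), c (i + 2), c (i + 3), c (i + 4), u (i + 4)]"] g
    by (simp add: c_facts)
qed

lemma b8: "b8 i \<noteq> c i" "b8 i \<noteq> a8 i" "E (u i) (b8 i)" "E (b8 i) (u i)"
  and nbr_u: "E (u i) y \<Longrightarrow> y = c i \<or> y = a8 i \<or> y = b8 i"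
  using third[OF u_adj(2) a8(1) a8_c[symmetric], folded b8_def] adj_sym by auto

lemma a8_c4: "a8 i \<noteq> c (i + 4)"
  using a8_c[of "i + 4"] a8_wrap by simp

lemmas facts8 = c_facts a8 b8 a8_c a8_c4 u_neq4 a8_c[symmetric] a8_c4[symmetric] b8(1,2)[symmetric] u_neq4[symmetric]

text \<open>The walk closing the arc from \<open>b8 i\<close> to \<open>c (i + 3)\<close> has to
  come in through \<open>u (i + 3)\<close>, and reaching that from \<open>a8 (i + 3)\<close> would
  give a closed walk of six edges. Thus the \<open>b8\<close> form a star octagon with step
  3.\<close>

lemma b8_b8: "E (b8 i) (b8 (i + 3))"
proof -
  have "chain E [b8 i, u i, c i, c (i + 1), c (i + 2), c (i + 3)]" by (simp add: facts8)
  then obtain ys where ys: "chain E ys" "length ys = 4" "hd ys = b8 i" "last ys = c (i + 3)"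
      "ys ! 2 \<noteq> c (i + 2)" "ys ! 1 \<noteq> u i"
    by (rule closeE) (use g in auto)
  then obtain x y where z: "E (b8 i) x" "E x y" "E y (c (i + 3))" "y \<noteq> c (i + 2)" "x \<noteq> c (i + 3)" "b8 i \<noteq> y"
    by (auto simp: numeral_eq_Suc length_Suc_conv)
  have "y \<noteq> c (i + 4)"
  proof
    assume "y = c (i + 4)"
    then show False
      using not_both_chains[of "[b8 i, x, c (i + 4)]" "[b8 i, u i, a8 i, u (i + 4), c (i + 4)]"] g z
      by (simp add: facts8)
  qed
  then have y: "y = u (i + 3)" using z nbr_c'(3)[of i y] by auto
  have "x \<noteq> a8 (i + 3)"
  proof
    assume "x = a8 (i + 3)"
    also have "a8 (i + 3) = a8 (i - 1)" using a8_wrap[of "i - 1"] by (simp add: add.commute)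
    finally show False
      using not_both_chains[of "[b8 i, a8 (i - 1)]" "[b8 i, u i, c i, c (i - 1), u (i - 1), a8 (i - 1)]"] g z
      by (simp add: facts8)
  qed
  then have "x = b8 (i + 3)" using y z adj_sym nbr_u[of "i + 3" x] by auto
  then show ?thesis using z by simp
qed

lemma b8_neq: "b8 (i + 3) \<noteq> b8 (i - 3)" "u i \<noteq> b8 (i + 3)" "u i \<noteq> b8 (i - 3)"
proof -
  have uu: "\<not> E (u i) (u (i + 3))" for i
    using not_both_chains[of "[u i, u (i + 3)]" "[u i, c i, c (i + 1), c (i + 2), c (i + 3), u (i + 3)]"] g
    by (auto simp: facts8)
  show "u i \<noteq> b8 (i + 3)" using uu[of i] b8[of "i + 3"] by auto
  show "u i \<noteq> b8 (i - 3)" using uu[of "i - 3"] b8[of "i - 3"] by auto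
  show "b8 (i + 3) \<noteq> b8 (i - 3)"
  proof
    assume eq: "b8 (i + 3) = b8 (i - 3)"
    have "E (b8 (i - 3)) (u (i + 5))" using b8(4)[of "i - 3"] u_wrap8(4)[of i] by simp
    moreover have "u (i + 3) \<noteq> u (i + 5)" using u_neq2[of "i + 3"] g by (simp add: add.assoc)
    ultimately show False
      using not_both_chains[of "[u (i + 3), b8 (i + 3), u (i + 5)]" "[u (i + 3), c (i + 3), c (i + 4), c (i + 5), u (i + 5)]"] g eq
        b8(3)[of "i + 3"]
      by (simp add: c_facts)
  qed
qed

lemma nbr_b: "E (b8 i) y \<Longrightarrow> y = u i \<or> y = b8 (i + 3) \<or> y = b8 (i - 3)"
proof -
  have "E (b8 i) (b8 (i - 3))" using b8_b8[of "i - 3"] adj_sym by simp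
  from third(4)[OF b8_b8 this b8_neq(1), of y] third(4)[OF b8_b8 this b8_neq(1), of "u i"] b8_neq b8(4)
  show "E (b8 i) y \<Longrightarrow> y = u i \<or> y = b8 (i + 3) \<or> y = b8 (i - 3)" by metis
qed

lemma d8: "d8 i \<noteq> u i" "d8 i \<noteq> u (i + 4)" "E (a8 i) (d8 i)" "E (d8 i) (a8 i)"
  and nbr_a: "E (a8 i) y \<Longrightarrow> y = u i \<or> y = u (i + 4) \<or> y = d8 i"
  using third[OF a8(2) a8(3) u_neq4, folded d8_def] adj_sym by auto

text \<open>The walk closing the arc from \<open>a8 i\<close> to \<open>u (i + 2)\<close> must run
  through \<open>a8 (i + 2)\<close>, all other routes being too short for the girth. Its first inner
  vertex is then the third neighbour of both \<open>a8 i\<close> and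
  \<open>a8 (i + 2)\<close>.\<close>

lemma d8_wrap: "d8 (i + 2) = d8 i"
proof -
  have "chain E [a8 i, u i, c i, c (i + 1), c (i + 2), u (i + 2)]" by (simp add: facts8)
  then obtain ys where ys: "chain E ys" "length ys = 4" "hd ys = a8 i" "last ys = u (i + 2)"
      "ys ! 2 \<noteq> c (i + 2)" "ys ! 1 \<noteq> u i"
    by (rule closeE) (use g in auto)
  then obtain x y where z: "E (a8 i) x" "E x y" "E y (u (i + 2))" "y \<noteq> c (i + 2)" "x \<noteq> u (i + 2)" "a8 i \<noteq> y" "x \<noteq> u i"
    by (auto simp: numeral_eq_Suc length_Suc_conv)
  have "y \<noteq> b8 (i + 2)"
  proof
    assume y: "y = b8 (i + 2)"
    then have "x = b8 (i + 5) \<or> x = b8 (i - 1)"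
      using z nbr_b[of "i + 2" x] adj_sym by (auto simp: add.assoc)
    moreover have "x \<noteq> b8 (i + 5)"
      using not_both_chains[of "[a8 i, b8 (i + 5)]" "[a8 i, u (i + 4), c (i + 4), c (i + 5), u (i + 5), b8 (i + 5)]"] g z
      by (auto simp: facts8)
    moreover have "x \<noteq> b8 (i - 1)"
      using not_both_chains[of "[a8 i, b8 (i - 1)]" "[a8 i, u i, c i, c (i - 1), u (i - 1), b8 (i - 1)]"] g z
      by (auto simp: facts8)
    ultimately show False by blast
  qed
  then have "y = a8 (i + 2)" using z nbr_u[of "i + 2" y] adj_sym by blast
  then have "x = u (i + 6) \<or> x = d8 (i + 2)" using z nbr_a[of "i + 2" x] adj_sym by (auto simp: add.assoc)
  moreover have "x \<noteq> u (i + 6)"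
    using not_both_chains[of "[a8 i, u (i - 2)]" "[a8 i, u i, c i, c (i - 1), c (i - 2), u (i - 2)]"] g z u_wrap8(3)[of i]
    by (auto simp: facts8)
  ultimately have x: "x = d8 (i + 2)" by simp
  then have "E (a8 (i + 2)) x" using d8 by simp
  then have "x \<noteq> u (i + 4)"
    using not_both_chains[of "[a8 (i + 2), u (i + 4)]" "[a8 (i + 2), u (i + 2), c (i + 2), c (i + 3), c (i + 4), u (i + 4)]"] g
    by (auto simp: facts8)
  then show ?thesis using nbr_a[of i x] x z by auto
qed

lemma d8_d8: "E (d8 i) (d8 (i + 1))"
proof -
  have "chain E [d8 i, a8 i, u i, c i, c (i + 1), u (i + 1)]" by (simp add: facts8 d8)
  then obtain ys where ys: "chain E ys" "length ys = 4" "hd ys = d8 i" "last ys = u (i + 1)"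
      "ys ! 2 \<noteq> c (i + 1)" "ys ! 1 \<noteq> a8 i"
    by (rule closeE) (use g in auto)
  then obtain x y where z: "E (d8 i) x" "E x y" "E y (u (i + 1))" "y \<noteq> c (i + 1)" "x \<noteq> u (i + 1)" "d8 i \<noteq> y" "x \<noteq> a8 i"
    by (auto simp: numeral_eq_Suc length_Suc_conv)
  have "y \<noteq> b8 (i + 1)"
  proof
    assume y: "y = b8 (i + 1)"
    then have "x = b8 (i + 4) \<or> x = b8 (i - 2)"
      using z nbr_b[of "i + 1" x] adj_sym by (auto simp: add.assoc)
    moreover have "x \<noteq> b8 (i + 4)"
      using not_both_chains[of "[d8 i, b8 (i + 4)]" "[d8 i, a8 i, u (i + 4), b8 (i + 4)]"] g z b8(2)[of "i + 4"] a8_wrap[of i]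
      by (auto simp: facts8 d8)
    moreover have "x \<noteq> b8 (i - 2)"
      using not_both_chains[of "[d8 (i - 2), b8 (i - 2)]" "[d8 (i - 2), a8 (i - 2), u (i - 2), b8 (i - 2)]"] g z d8_wrap[of "i - 2"]
      by (auto simp: facts8 d8)
    ultimately show False by blast
  qed
  then have "y = a8 (i + 1)" using z nbr_u[of "i + 1" y] adj_sym by blast
  then have "x = u (i + 5) \<or> x = d8 (i + 1)" using z nbr_a[of "i + 1" x] adj_sym by (auto simp: add.assoc)
  moreover have "x \<noteq> u (i + 5)"
    using not_both_chains[of "[d8 i, u (i + 5)]" "[d8 i, a8 i, u (i + 4), c (i + 4), c (i + 5), u (i + 5)]"] g z
    by (auto simp: facts8 d8)
  ultimately show ?thesis using z by auto
qed

lemma a8_neq2: "a8 i \<noteq> a8 (i + 2)"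
proof
  assume "a8 i = a8 (i + 2)"
  then have "E (a8 i) (u (i + 2))" using a8 by simp
  then show False
    using not_both_chains[of "[u i, a8 i, u (i + 2)]" "[u i, c i, c (i + 1), c (i + 2), u (i + 2)]"] g u_neq2[of i]
    by (auto simp: facts8)
qed

lemma d8_a8: "d8 (i + 1) \<noteq> a8 i" "d8 (i + 1) \<noteq> a8 (i + 2)"
proof -
  have aa: "\<not> E (a8 i) (a8 (i + 1))" for i
    using not_both_chains[of "[a8 i, a8 (i + 1)]" "[a8 i, u i, c i, c (i + 1), u (i + 1), a8 (i + 1)]"] g
    by (auto simp: facts8)
  show "d8 (i + 1) \<noteq> a8 i" using aa[of i] d8[of "i + 1"] by auto
  show "d8 (i + 1) \<noteq> a8 (i + 2)" using aa[of "i + 1"] d8[of "i + 1"] by (auto simp: add.assoc)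
qed

end

end

section \<open>Templates\<close>

text \<open>Adjacency lists. Vertices are numbered in the order \<open>c\<close>, \<open>u\<close>, and then \<open>d6\<close>
  for girth 6, and \<open>b8\<close>, \<open>a8\<close>, \<open>d8\<close> for girth 8, each indexed cyclically.\<close>

definition template :: "nat \<Rightarrow> nat list list" where
  "template g =
    (if g = 3 then [[2, 1, 3], [0, 2, 3], [1, 0, 3], [0, 1, 2]]
     else if g = 4 then [[3, 1, 4], [0, 2, 5], [1, 3, 4], [2, 0, 5], [0, 2, 5], [1, 3, 4]]
     else if g = 5 then [[4, 1, 5], [0, 2, 6], [1, 3, 7], [2, 4, 8], [3, 0, 9], [0, 7, 8], [1, 8, 9], [2, 9, 5], [3, 5, 6], [4, 6, 7]]
     else if g = 6 then [[5, 1, 6], [0, 2, 7], [1, 3, 8], [2, 4, 9], [3, 5, 10], [4, 0, 11], [0, 9, 12], [1, 10, 13], [2, 11, 12], [3, 6, 13], [4, 7, 12], [5, 8, 13], [6, 8, 10], [7, 9, 11]]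
     else [[7, 1, 8], [0, 2, 9], [1, 3, 10], [2, 4, 11], [3, 5, 12], [4, 6, 13], [5, 7, 14], [6, 0, 15], [0, 24, 16], [1, 25, 17], [2, 26, 18], [3, 27, 19], [4, 24, 20], [5, 25, 21], [6, 26, 22], [7, 27, 23], [8, 19, 21], [9, 20, 22], [10, 21, 23], [11, 22, 16], [12, 23, 17], [13, 16, 18], [14, 17, 19], [15, 18, 20], [8, 12, 28], [9, 13, 29], [10, 14, 28], [11, 15, 29], [24, 26, 29], [25, 27, 28]])"

definition tadj :: "nat list list \<Rightarrow> nat \<Rightarrow> nat \<Rightarrow> bool" where
  "tadj T k l \<longleftrightarrow> k < length T \<and> l \<in> set (T ! k)"

text \<open>\<open>ends T v k\<close> lists the last arcs of the non-backtracking walks with \<open>k + 1\<close> edges from \<open>v\<close>.\<close>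

primrec ends :: "nat list list \<Rightarrow> nat \<Rightarrow> nat \<Rightarrow> (nat \<times> nat) list" where
  "ends T v 0 = map (Pair v) (T ! v)"
| "ends T v (Suc k) = concat (map (\<lambda>(p, q). map (Pair q) (filter (\<lambda>w. w \<noteq> p) (T ! q))) (ends T v k))"

text \<open>The conditions of the locale \<open>cage\<close>, localized at \<open>k\<close> and
  decidable. As \<open>ends T k j\<close> belongs to \<open>j + 1\<close> edges, the range up to
  \<open>g - 1\<close> excludes closed walks of fewer than \<open>g\<close> edges,
  \<open>t - 1\<close> and \<open>g - t - 1\<close> stand for \<open>t\<close>-arcs and their
  closing walks, and the last condition asks for a walk of at most \<open>t - 1\<close> edges from
  vertex 0.\<close>

definition check_at :: "nat list list \<Rightarrow> nat \<Rightarrow> nat \<Rightarrow> nat \<Rightarrow> bool" where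
  "check_at T t g k \<longleftrightarrow> length (T ! k) = 3 \<and> distinct (T ! k) \<and>
    list_all (\<lambda>l. l < length T \<and> l \<noteq> k \<and> k \<in> set (T ! l)) (T ! k) \<and>
    list_all (\<lambda>j. k \<notin> set (map snd (ends T k j))) [0..<g - 1] \<and>
    (let qs = map snd (ends T k (g - t - 1)) in list_all (\<lambda>(p, q). q \<in> set qs) (ends T k (t - 1))) \<and>
    (k = 0 \<or> list_ex (\<lambda>j. k \<in> set (map snd (ends T 0 j))) [0..<t - 1])"

lemma length_template:
  "length (template 3) = 4" "length (template 4) = 6" "length (template 5) = 10"
  "length (template 6) = 14" "length (template 8) = 30"
  by (simp_all add: template_def)

lemma check_template_3: "list_all (check_at (template 3) 2 3) [0..<4]"
  and check_template_4: "list_all (check_at (template 4) 3 4) [0..<6]"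
  and check_template_5: "list_all (check_at (template 5) 3 5) [0..<10]"
  by code_simp+

lemma check_template_6: "list_all (check_at (template 6) 4 6) [0..<14]"
  by code_simp

lemma check_template_8a: "list_all (check_at (template 8) 5 8) [0..<8]"
  by code_simp

lemma check_template_8b: "list_all (check_at (template 8) 5 8) [8..<16]"
  by code_simp

lemma check_template_8c: "list_all (check_at (template 8) 5 8) [16..<24]"
  by code_simp

lemma check_template_8d: "list_all (check_at (template 8) 5 8) [24..<30]"
  by code_simp

lemma check_template_8: "list_all (check_at (template 8) 5 8) [0..<30]"
proof -
  have "[0..<30] = [0..<8] @ [8..<16] @ [16..<24] @ [24..<(30::nat)]" by (simp add: upt_rec)
  then show ?thesis
    using check_template_8a check_template_8b check_template_8c check_template_8d by simp
qed

lemma ends_chain: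
  "(p, q) \<in> set (ends T v k) \<longleftrightarrow>
    (\<exists>xs. chain (\<lambda>k l. l \<in> set (T ! k)) (xs @ [p, q]) \<and> length xs = k \<and> hd (xs @ [p]) = v)"
proof (induction k arbitrary: p q)
  case 0
  then show ?case by auto
next
  case (Suc k)
  have "(p, q) \<in> set (ends T v (Suc k)) \<longleftrightarrow> (\<exists>r. (r, p) \<in> set (ends T v k) \<and> r \<noteq> q \<and> q \<in> set (T ! p))"
    by (simp add: case_prod_beta image_iff Bex_def split_paired_Ex) blast
  also have "\<dots> \<longleftrightarrow> (\<exists>r xs. chain (\<lambda>k l. l \<in> set (T ! k)) (xs @ [r, p, q]) \<and> length xs = k \<and> hd (xs @ [r]) = v)"
    unfolding Suc chain_snoc by blast
  also have "\<dots> \<longleftrightarrow> (\<exists>xs. chain (\<lambda>k l. l \<in> set (T ! k)) (xs @ [p, q]) \<and> length xs = Suc k \<and> hd (xs @ [p]) = v)"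
    (is "?L \<longleftrightarrow> ?R")
  proof
    assume ?L
    then obtain r xs where "chain (\<lambda>k l. l \<in> set (T ! k)) (xs @ [r, p, q])" "length xs = k" "hd (xs @ [r]) = v"
      by blast
    then show ?R by (intro exI[of _ "xs @ [r]"]) (auto simp: hd_append)
  next
    assume ?R
    then obtain xs where xs: "chain (\<lambda>k l. l \<in> set (T ! k)) (xs @ [p, q])" "length xs = Suc k" "hd (xs @ [p]) = v"
      by blast
    from xs(2) obtain ys r where "xs = ys @ [r]" by (metis length_Suc_conv_rev)
    with xs show ?L by (intro exI[of _ r] exI[of _ ys]) (auto simp: hd_append split: if_splits)
  qed
  finally show ?case .
qed

text \<open>From a vertex of the template, walks along the rows never leave it, so the enumeration
  \<open>ends\<close> decides the quantifiers over walks. By symmetry, reachability from vertex 0 is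
  enough for connectedness.\<close>

lemma check_imp_cage:
  assumes check: "list_all (check_at T t g) [0..<length T]" and N: "0 < length T"
    and t: "2 \<le> t" "3 \<le> g" "g + 2 = 2 * t \<or> g + 1 = 2 * t"
  shows "cage {..<length T} (tadj T) t g"
proof -
  let ?E = "\<lambda>k l. l \<in> set (T ! k)"
  have chk: "check_at T t g k" if "k < length T" for k
    using check that by (auto simp: list_all_iff)
  have T: "length (T ! k) = 3" "distinct (T ! k)" if "k < length T" for k
    using chk[OF that] by (auto simp: check_at_def)
  have adj: "l < length T" "l \<noteq> k" "k \<in> set (T ! l)" if "k < length T" "l \<in> set (T ! k)" for k l
    using chk[OF that(1)] that(2) by (auto simp: check_at_def list_all_iff)
  have chain_weaken: "chain ?E xs" if "chain (tadj T) xs" for xs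
    using that by (induction xs rule: chain_induct) (auto simp: tadj_def)
  have chain_strong: "chain (tadj T) xs" if "chain ?E xs" "hd xs < length T" for xs
    using that
  proof (induction xs rule: chain_induct)
    case (triple x y z zs)
    then have "y \<in> set (T ! x)" "x < length T" by auto
    then have "y < length T" using adj(1) by blast
    with triple show ?case by (auto simp: tadj_def)
  qed (auto simp: tadj_def)
  have in_T: "hd xs < length T" if xs: "chain (tadj T) xs" "2 \<le> length xs" for xs
  proof -
    obtain x y zs where "xs = x # y # zs" using xs(2) by (cases xs; cases "tl xs") auto
    with xs(1) chain_Cons[of "tadj T" x y zs] show ?thesis by (simp add: tadj_def)
  qed
  have endsI: "\<exists>p. (p, last xs) \<in> set (ends T (hd xs) (length xs - 2))"
    if xs: "chain (tadj T) xs" "2 \<le> length xs" for xs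
  proof -
    obtain ys p q where ys: "xs = ys @ [p, q]" using xs(2) by (rule snoc2E)
    then have "hd (ys @ [p]) = hd xs" by (auto simp: hd_append)
    then show ?thesis unfolding ends_chain using chain_weaken[OF xs(1)] ys by auto
  qed
  have endsD: "\<exists>xs. chain (tadj T) xs \<and> length xs = k + 2 \<and> hd xs = v \<and> last xs = q"
    if pq: "(p, q) \<in> set (ends T v k)" "v < length T" for p q v k
  proof -
    obtain xs where xs: "chain ?E (xs @ [p, q])" "length xs = k" "hd (xs @ [p]) = v"
      using pq(1) unfolding ends_chain by blast
    then have "hd (xs @ [p, q]) = v" by (auto simp: hd_append)
    moreover from this have "chain (tadj T) (xs @ [p, q])" using xs(1) pq(2) by (intro chain_strong) auto
    ultimately show ?thesis using xs(2) by (intro exI[of _ "xs @ [p, q]"]) simp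
  qed
  have chain_rtrancl: "(tadj T)\<^sup>*\<^sup>* (hd xs) (last xs)" if "chain (tadj T) xs" "xs \<noteq> []" for xs
    using that
  proof (induction xs rule: chain_induct)
    case (triple x y z zs)
    then have "tadj T x y" "(tadj T)\<^sup>*\<^sup>* y (last (z # zs))" by auto
    then show ?case by (auto intro: converse_rtranclp_into_rtranclp)
  qed auto
  have sym: "tadj T x y \<Longrightarrow> tadj T y x" for x y using adj(1,3)[of x y] by (simp add: tadj_def)
  show ?thesis
  proof
    show "finite {..<length T}" "{..<length T} \<noteq> {}" using N by auto
    show "tadj T x y \<Longrightarrow> x \<in> {..<length T}" for x y by (simp add: tadj_def)
    show "tadj T x y \<Longrightarrow> tadj T y x" for x y by (rule sym)
    show "\<not> tadj T x x" for x using adj(2)[of x x] by (auto simp: tadj_def)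
    show "card {y. tadj T x y} = 3" if "x \<in> {..<length T}" for x
    proof -
      have "{y. tadj T x y} = set (T ! x)" using that by (auto simp: tadj_def)
      then show ?thesis using T[of x] that by (simp add: distinct_card)
    qed
    have from0: "(tadj T)\<^sup>*\<^sup>* 0 x" if x: "x < length T" for x
    proof (cases "x = 0")
      case False
      then obtain j p where "(p, x) \<in> set (ends T 0 j)"
        using chk[OF x] by (auto simp: check_at_def list_ex_iff)
      from endsD[OF this N] show ?thesis using chain_rtrancl
        by (metis add_2_eq_Suc' length_0_conv nat.simps(3))
    qed auto
    have "symp (tadj T)" using sym by (auto simp: symp_def)
    then have "symp (tadj T)\<^sup>*\<^sup>*" by (rule symp_rtranclp)
    then show "(tadj T)\<^sup>*\<^sup>* x y" if "x \<in> {..<length T}" "y \<in> {..<length T}" for x y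
      using from0 that by (meson lessThan_iff rtranclp_trans sympD)
    show "girth_ge (tadj T) g"
      unfolding girth_ge_def
    proof (intro allI impI)
      fix xs assume xs: "chain (tadj T) xs" "2 \<le> length xs" "hd xs = last xs"
      show "g < length xs"
      proof (rule ccontr)
        assume "\<not> g < length xs"
        then have "length xs - 2 \<in> set [0..<g - 1]" using t xs(2) by auto
        then have "hd xs \<notin> snd ` set (ends T (hd xs) (length xs - 2))"
          using chk[OF in_T[OF xs(1,2)]] by (simp add: check_at_def list_all_iff)
        with endsI[OF xs(1,2)] xs(3) show False by force
      qed
    qed
    show "\<exists>ys. chain (tadj T) ys \<and> length ys = Suc (g - t) \<and> hd ys = hd xs \<and> last ys = last xs"
      if xs: "chain (tadj T) xs" "length xs = Suc t" for xs
    proof -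
      have l: "2 \<le> length xs" "length xs - 2 = t - 1" using xs(2) t by auto
      then obtain p where "(p, last xs) \<in> set (ends T (hd xs) (t - 1))" using endsI xs(1) by metis
      then have "last xs \<in> snd ` set (ends T (hd xs) (g - t - 1))"
        using chk[OF in_T[OF xs(1) l(1)]] by (auto simp: check_at_def list_all_iff Let_def)
      then obtain q where "(q, last xs) \<in> set (ends T (hd xs) (g - t - 1))" by auto
      from endsD[OF this in_T[OF xs(1) l(1)]] show ?thesis using t by auto
    qed
  qed (use t in auto)
qed

lemma template_cage:
  "cage {..<length (template 3)} (tadj (template 3)) 2 3"
  "cage {..<length (template 4)} (tadj (template 4)) 3 4"
  "cage {..<length (template 5)} (tadj (template 5)) 3 5"
  "cage {..<length (template 6)} (tadj (template 6)) 4 6"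
  "cage {..<length (template 8)} (tadj (template 8)) 5 8"
  by (rule check_imp_cage; simp add: length_template check_template_3 check_template_4 check_template_5
      check_template_6 check_template_8)+

lemma chain_hom:
  assumes "\<And>x y. E x y \<Longrightarrow> E' (f x) (f y)" "\<And>x y z. E x y \<Longrightarrow> E x z \<Longrightarrow> y \<noteq> z \<Longrightarrow> f y \<noteq> f z"
    and "\<And>x y. E x y \<Longrightarrow> E y x"
  shows "chain E xs \<Longrightarrow> chain E' (map f xs)"
proof (induction xs rule: chain_induct)
  case (triple x y z zs)
  then have "E y z" by (auto dest: chain_Cons)
  moreover have "E y x" using triple assms(3) by simp
  ultimately have "f x \<noteq> f z" using triple.prems assms(2)[of y x z] by simp
  with triple assms(1) show ?case by simp
qed (use assms in auto)

text \<open>A locally injective homomorphism between cubic graphs is a covering; it is injective as soon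
  as the diameter of the source is smaller than the girth of the target.\<close>

lemma cage_cover:
  assumes "cage V E t g" "cage V' E' t' g'" "t \<le> g'"
    and V: "\<And>x. x \<in> V \<Longrightarrow> f x \<in> V'"
    and hom: "\<And>x y. E x y \<Longrightarrow> E' (f x) (f y)" and loc: "\<And>x y z. E x y \<Longrightarrow> E x z \<Longrightarrow> y \<noteq> z \<Longrightarrow> f y \<noteq> f z"
  shows "bij_betw f V V'" "x \<in> V \<Longrightarrow> y \<in> V \<Longrightarrow> E' (f x) (f y) \<longleftrightarrow> E x y"
proof -
  interpret A: cage V E t g by fact
  interpret B: cage V' E' t' g' by fact
  have inj: "inj_on f V"
  proof
    fix x y assume xy: "x \<in> V" "y \<in> V" "f x = f y"
    show "x = y"
    proof (rule ccontr)
      assume "x \<noteq> y"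
      obtain xs where xs: "chain E xs" "xs \<noteq> []" "length xs \<le> t" "hd xs = x" "last xs = y"
        using A.ex_short_chain xy by blast
      then have "2 \<le> length xs" using \<open>x \<noteq> y\<close> by (cases xs; cases "tl xs") auto
      moreover have "chain E' (map f xs)" using chain_hom[of E E' f xs] hom loc A.adj_sym xs(1) by blast
      moreover have "hd (map f xs) = last (map f xs)" using xs xy by (simp add: hd_map last_map)
      ultimately have "g' < length xs" using B.girth unfolding girth_ge_def by (metis length_map)
      then show False using xs(3) assms(3) by simp
    qed
  qed
  have lift: "\<exists>y. E x y \<and> f y = z" if "x \<in> V" "E' (f x) z" for x z
  proof -
    have "f ` {y. E x y} = {z. E' (f x) z}"
    proof (rule card_subset_eq)
      have "card {z. E' (f x) z} = 3" using B.deg V that by blast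
      moreover from this show "finite {z. E' (f x) z}" by (intro card_ge_0_finite) simp
      moreover have "card (f ` {y. E x y}) = 3"
        using A.deg[OF that(1)] by (subst card_image) (use loc in \<open>auto simp: inj_on_def\<close>)
      ultimately show "card (f ` {y. E x y}) = card {z. E' (f x) z}" by simp
    qed (use hom in auto)
    moreover have "z \<in> {z. E' (f x) z}" using that(2) by simp
    ultimately have "z \<in> f ` {y. E x y}" by simp
    then show ?thesis by blast
  qed
  obtain x0 where x0: "x0 \<in> V" using A.ne by blast
  have "z \<in> f ` V" if "z \<in> V'" for z
    using B.conn[OF V[OF x0] that]
  proof (induction rule: rtranclp_induct)
    case base
    then show ?case using x0 by blast
  next
    case (step y z)
    then obtain x where x: "x \<in> V" "y = f x" by blast
    obtain x' where "E x x'" "f x' = z" using lift[OF x(1), of z] x(2) step.hyps(2) by blast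
    then show ?case using A.E_in2 by blast
  qed
  then show "bij_betw f V V'" using inj V by (auto simp: bij_betw_def)
  show "E' (f x) (f y) \<longleftrightarrow> E x y" if xy: "x \<in> V" "y \<in> V" for x y
  proof
    assume "E' (f x) (f y)"
    then obtain y' where "E x y'" "f y' = f y" using lift xy by blast
    then show "E x y" using inj xy A.E_in2 by (metis inj_onD)
  qed (rule hom)
qed

text \<open>Exactly a locally injective homomorphism from the template: the listed adjacencies hold,
  and the entries of each row get different labels. Global injectivity and the non-adjacencies come
  from \<open>cage_cover\<close>.\<close>

definition labelling :: "('v \<Rightarrow> 'v \<Rightarrow> bool) \<Rightarrow> 'v list \<Rightarrow> nat list list \<Rightarrow> bool" where
  "labelling E L T \<longleftrightarrow> list_all2 (\<lambda>x ns. (\<forall>n\<in>set ns. E x (L ! n)) \<and> distinct (map ((!) L) ns)) L T"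

lemma (in cage) labelling_iso:
  assumes L: "labelling E L T" and T: "cage {..<length T} (tadj T) t g"
  shows "bij_betw ((!) L) {..<length T} V"
    "\<And>x y. x < length T \<Longrightarrow> y < length T \<Longrightarrow> E (L ! x) (L ! y) \<longleftrightarrow> tadj T x y"
proof -
  have len: "length L = length T" using L by (auto simp: labelling_def dest: list_all2_lengthD)
  have E: "E (L ! x) (L ! y)" if "tadj T x y" for x y
    using L that len by (auto simp: labelling_def tadj_def list_all2_conv_all_nth)
  have loc: "L ! y \<noteq> L ! z" if "tadj T x y" "tadj T x z" "y \<noteq> z" for x y z
    using L that len by (auto simp: labelling_def tadj_def list_all2_conv_all_nth distinct_map inj_on_def)
  interpret T: cage "{..<length T}" "tadj T" t g by fact
  have V: "L ! x \<in> V" if x: "x \<in> {..<length T}" for x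
  proof -
    obtain y where "tadj T x y" using T.ex_nbr2[OF x] by metis
    then show ?thesis using E E_in by blast
  qed
  have "t \<le> g" using tg t2 g3 by auto
  from cage_cover[OF T cage_axioms this, of "(!) L"] V E loc
  show "bij_betw ((!) L) {..<length T} V"
    "\<And>x y. x < length T \<Longrightarrow> y < length T \<Longrightarrow> E (L ! x) (L ! y) \<longleftrightarrow> tadj T x y"
    by blast+
qed

context cage_with_cycle
begin

lemma nbrs_c: "E (c i) (c (i - 1)) \<and> E (c i) (c (i + 1)) \<and> E (c i) (u i) \<and> c (i - 1) \<noteq> c (i + 1) \<and> u i \<noteq> c (i - 1) \<and> u i \<noteq> c (i + 1)"
  using c_E c_neq u by auto

lemma labelling_3:
  assumes "g = 3" "t = 2"
  shows "labelling E [c 0, c 1, c 2, u 0] (template 3)"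
proof -
  have c: "c (- 1) = c 2" "c (3) = c 0" using assms by (auto intro: c_wrap c_wrap[symmetric])
  have u: "u 1 = u 0" "u 2 = u 0" using third_neighbours_3[OF assms, of 0] third_neighbours_3[OF assms, of 1] by simp_all
  have "E (u 0) (c 0)" "E (u 0) (c 1)" "E (u 0) (c 2)"
    using u_adj(2)[of 0] u_adj(2)[of 1] u_adj(2)[of 2] u by simp_all
  moreover have "E (c 0) (c 1)" "E (c 1) (c 2)" by (simp_all add: c_adj)
  then have "c 0 \<noteq> c 1" "c 1 \<noteq> c 2" using irrefl by metis+
  moreover have "c 0 \<noteq> c 2" by (simp add: c_facts)
  ultimately show ?thesis
    using nbrs_c[of 0] nbrs_c[of 1] nbrs_c[of 2]
    by (auto simp: labelling_def template_def c u)
qed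

lemma labelling_4:
  assumes "g = 4" "t = 3"
  shows "labelling E [c 0, c 1, c 2, c 3, u 0, u 1] (template 4)"
proof -
  have c: "c (- 1) = c 3" "c (4) = c 0" using assms by (auto intro: c_wrap c_wrap[symmetric])
  have u: "u 2 = u 0" "u 3 = u 1" using third_neighbours_4[OF assms, of 0] third_neighbours_4[OF assms, of 1] by simp_all
  have "c 0 \<noteq> c 2" "c 1 \<noteq> c 3" by (simp_all add: c_facts)
  moreover have "u 1 \<noteq> c 0" "u 1 \<noteq> c 2" "u 0 \<noteq> c 1" by (simp_all add: c_facts)
  moreover have "u 0 \<noteq> c 3" using u_neq(2)[of 3 2] u by simp
  moreover have "E (u 0) (c 0)" "E (u 0) (c 2)" "E (u 1) (c 1)" "E (u 1) (c 3)"
    using u_adj(2)[of 0] u_adj(2)[of 1] u_adj(2)[of 2] u_adj(2)[of 3] u by simp_all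
  moreover have "E (u 0) (u 1)" "E (u 1) (u 0)" using third_neighbours_4(2)[OF assms, of 0] adj_sym by simp_all
  ultimately show ?thesis
    using nbrs_c[of 0] nbrs_c[of 1] nbrs_c[of 2] nbrs_c[of 3]
    by (auto simp: labelling_def template_def c u)
qed

lemma labelling_5:
  assumes "g = 5" "t = 3"
  shows "labelling E [c 0, c 1, c 2, c 3, c 4, u 0, u 1, u 2, u 3, u 4] (template 5)"
proof -
  have c: "c (- 1) = c 4" "c (5) = c 0" using assms by (auto intro: c_wrap c_wrap[symmetric])
  have u: "u (- 2) = u 3" "u (- 1) = u 4" "u (5) = u 0" "u (6) = u 1" using assms by (auto intro: u_wrap u_wrap[symmetric])
  have nbrs_u: "E (u i) (c i) \<and> E (u i) (u (i + 2)) \<and> E (u i) (u (i - 2)) \<and> u (i + 2) \<noteq> u (i - 2) \<and> c i \<noteq> u (i + 2) \<and> c i \<noteq> u (i - 2)" for i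
  proof -
    have adj: "E (u j) (u (j + 2))" for j using third_neighbours_5[OF assms] .
    have uw: "u (i + 3) = u (i - 2)" using assms by (intro u_wrap) simp
    have "u (i - 2) \<noteq> u (i + 2)"
    proof
      assume "u (i - 2) = u (i + 2)"
      then have "E (c (i + 3)) (u (i + 2))" using uw u_adj[of "i + 3"] by simp
      moreover have "c (i + 2) \<noteq> u (i + 2)" using u_adj[of "i + 2"] irrefl by metis
      ultimately show False
        using not_both_chains[of "[c (i + 2), u (i + 2)]" "[c (i + 2), c (i + 3), u (i + 2)]"] assms u_neq[of "i + 3" "i + 2"]
        by (simp add: c_facts)
    qed
    moreover have "c i \<noteq> u (i + 2)"
    proof
      assume "c i = u (i + 2)"
      then have "E (c i) (c (i + 2))" using u_adj[of "i + 2"] by simp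
      then show False using not_both_chains[of "[c i, c (i + 2)]" "[c i, c (i + 1), c (i + 2)]"] assms
        by (simp add: c_facts)
    qed
    moreover have "c i \<noteq> u (i - 2)"
    proof
      assume "c i = u (i - 2)"
      then have "E (c i) (c (i - 2))" using u_adj[of "i - 2"] by simp
      then show False using not_both_chains[of "[c i, c (i - 2)]" "[c i, c (i - 1), c (i - 2)]"] assms
        by (simp add: c_facts)
    qed
    ultimately show ?thesis using adj[of i] adj[of "i - 2"] adj_sym u_adj by auto
  qed
  show ?thesis
    using nbrs_c[of 0] nbrs_c[of 1] nbrs_c[of 2] nbrs_c[of 3] nbrs_c[of 4] nbrs_u[of 0] nbrs_u[of 1] nbrs_u[of 2] nbrs_u[of 3] nbrs_u[of 4]
    by (auto simp: labelling_def template_def c u)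
qed

lemma labelling_6:
  assumes g: "g = 6" "t = 4"
  shows "labelling E [c 0, c 1, c 2, c 3, c 4, c 5, u 0, u 1, u 2, u 3, u 4, u 5, d6 0, d6 1] (template 6)"
proof -
  note cl = third_neighbours_6[OF assms]
  have c: "c (- 1) = c 5" "c (6) = c 0" using assms by (auto intro: c_wrap c_wrap[symmetric])
  have u: "u (6) = u 0" "u (7) = u 1" "u (8) = u 2" using assms by (auto intro: u_wrap u_wrap[symmetric])
  have d: "d6 2 = d6 0" "d6 3 = d6 1" "d6 4 = d6 0" "d6 5 = d6 1"
    using cl(6)[of 0] cl(6)[of 1] cl(6)[of 2] cl(6)[of 3] by simp_all
  have nbrs_u: "E (u i) (c i) \<and> E (u i) (u (i + 3)) \<and> E (u i) (d6 i) \<and> E (d6 i) (u i) \<and> u (i + 3) \<noteq> c i \<and> d6 i \<noteq> c i \<and> d6 i \<noteq> u (i + 3) \<and> u i \<noteq> u (i + 2)" for i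
    using cl[of i] u_adj adj_sym u_neq2[of i] g by auto
  show ?thesis
    using nbrs_c[of 0] nbrs_c[of 1] nbrs_c[of 2] nbrs_c[of 3] nbrs_c[of 4] nbrs_c[of 5] nbrs_u[of 0] nbrs_u[of 1] nbrs_u[of 2] nbrs_u[of 3] nbrs_u[of 4] nbrs_u[of 5]
    unfolding labelling_def template_def
    by (auto simp: c u d)
qed

lemma labelling_8:
  assumes g: "g = 8" "t = 5"
  shows "labelling E [c 0, c 1, c 2, c 3, c 4, c 5, c 6, c 7, u 0, u 1, u 2, u 3, u 4, u 5, u 6, u 7, b8 0, b8 1, b8 2, b8 3, b8 4, b8 5, b8 6, b8 7, a8 0, a8 1, a8 2, a8 3, d8 0, d8 1] (template 8)"
proof -
  have c: "c (- 1) = c 7" "c (8) = c 0" using assms by (auto intro: c_wrap c_wrap[symmetric])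
  have u: "u (8) = u 0" "u (9) = u 1" "u (10) = u 2" "u (11) = u 3" using assms by (auto intro: u_wrap u_wrap[symmetric])
  have a: "a8 4 = a8 0" "a8 5 = a8 1" "a8 6 = a8 2" "a8 7 = a8 3"
    using a8_wrap[OF g, of 0] a8_wrap[OF g, of 1] a8_wrap[OF g, of 2] a8_wrap[OF g, of 3] by simp_all
  have b8_wrap: "b8 k = b8 j" if "k = j + 8" for j k
  proof -
    have "a8 (j + 8) = a8 j" using a8_wrap[OF g, of j] a8_wrap[OF g, of "j + 4"] by (simp add: add.assoc)
    moreover have "u (j + 8) = u j" "c (j + 8) = c j" using g by (auto intro: u_wrap c_wrap)
    ultimately show ?thesis using that by (simp add: b8_def)
  qed
  have b: "b8 (- 3) = b8 5" "b8 (- 2) = b8 6" "b8 (- 1) = b8 7" "b8 (8) = b8 0" "b8 (9) = b8 1" "b8 (10) = b8 2" by (auto intro: b8_wrap b8_wrap[symmetric])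
  have d: "d8 2 = d8 0" "d8 3 = d8 1" using d8_wrap[OF g, of 0] d8_wrap[OF g, of 1] by simp_all
  have nbrs_u: "E (u i) (c i) \<and> E (u i) (a8 i) \<and> E (u i) (b8 i) \<and> a8 i \<noteq> c i \<and> b8 i \<noteq> c i \<and> b8 i \<noteq> a8 i" for i
    using u_adj a8[OF g] b8[OF g] a8_c[OF g] by auto
  have nbrs_b: "E (b8 i) (u i) \<and> E (b8 i) (b8 (i + 3)) \<and> E (b8 i) (b8 (i - 3)) \<and> b8 (i + 3) \<noteq> b8 (i - 3) \<and> u i \<noteq> b8 (i + 3) \<and> u i \<noteq> b8 (i - 3)" for i
    using b8[OF g, of i] b8_b8[OF g, of i] b8_b8[OF g, of "i - 3"] b8_neq[OF g, of i] adj_sym by auto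
  have nbrs_a: "E (a8 i) (u i) \<and> E (a8 i) (u (i + 4)) \<and> E (a8 i) (d8 i) \<and> u i \<noteq> u (i + 4) \<and> d8 i \<noteq> u i \<and> d8 i \<noteq> u (i + 4)" for i
    using a8[OF g, of i] d8[OF g, of i] u_neq4[OF g, of i] by auto
  have nbrs_d: "E (d8 i) (a8 i) \<and> E (d8 i) (a8 (i + 2)) \<and> E (d8 i) (d8 (i + 1)) \<and> a8 i \<noteq> a8 (i + 2) \<and> d8 (i + 1) \<noteq> a8 i \<and> d8 (i + 1) \<noteq> a8 (i + 2)" for i
    using d8[OF g, of i] d8[OF g, of "i + 2"] d8_wrap[OF g, of i] d8_d8[OF g, of i] a8_neq2[OF g, of i] d8_a8[OF g, of i] by auto
  define L where "L = [c 0, c 1, c 2, c 3, c 4, c 5, c 6, c 7, u 0, u 1, u 2, u 3, u 4, u 5, u 6, u 7, b8 0, b8 1, b8 2, b8 3, b8 4, b8 5, b8 6, b8 7, a8 0, a8 1, a8 2, a8 3, d8 0, d8 1]"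
  define R where "R x ns \<longleftrightarrow> (\<forall>n\<in>set ns. E x (L ! n)) \<and> distinct (map ((!) L) ns)" for x ns
  have L: "L ! 0 = c 0" "L ! Suc 0 = c 1" "L ! 2 = c 2" "L ! 3 = c 3" "L ! 4 = c 4" "L ! 5 = c 5" "L ! 6 = c 6" "L ! 7 = c 7" "L ! 8 = u 0" "L ! 9 = u 1" "L ! 10 = u 2" "L ! 11 = u 3" "L ! 12 = u 4" "L ! 13 = u 5" "L ! 14 = u 6" "L ! 15 = u 7" "L ! 16 = b8 0" "L ! 17 = b8 1" "L ! 18 = b8 2" "L ! 19 = b8 3" "L ! 20 = b8 4" "L ! 21 = b8 5" "L ! 22 = b8 6" "L ! 23 = b8 7" "L ! 24 = a8 0" "L ! 25 = a8 1" "L ! 26 = a8 2" "L ! 27 = a8 3" "L ! 28 = d8 0" "L ! 29 = d8 1"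
    by (simp_all add: L_def)
  have rows_c: "R (c 0) [7, 1, 8]" "R (c 1) [0, 2, 9]" "R (c 2) [1, 3, 10]" "R (c 3) [2, 4, 11]" "R (c 4) [3, 5, 12]" "R (c 5) [4, 6, 13]" "R (c 6) [5, 7, 14]" "R (c 7) [6, 0, 15]"
    using nbrs_c[of 0] nbrs_c[of 1] nbrs_c[of 2] nbrs_c[of 3] nbrs_c[of 4] nbrs_c[of 5] nbrs_c[of 6] nbrs_c[of 7]
    by (auto simp: R_def L c)
  have rows_u: "R (u 0) [0, 24, 16]" "R (u 1) [1, 25, 17]" "R (u 2) [2, 26, 18]" "R (u 3) [3, 27, 19]" "R (u 4) [4, 24, 20]" "R (u 5) [5, 25, 21]" "R (u 6) [6, 26, 22]" "R (u 7) [7, 27, 23]"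
    using nbrs_u[of 0] nbrs_u[of 1] nbrs_u[of 2] nbrs_u[of 3] nbrs_u[of 4] nbrs_u[of 5] nbrs_u[of 6] nbrs_u[of 7]
    by (auto simp: R_def L a)
  have rows_b: "R (b8 0) [8, 19, 21]" "R (b8 1) [9, 20, 22]" "R (b8 2) [10, 21, 23]" "R (b8 3) [11, 22, 16]" "R (b8 4) [12, 23, 17]" "R (b8 5) [13, 16, 18]" "R (b8 6) [14, 17, 19]" "R (b8 7) [15, 18, 20]"
    using nbrs_b[of 0] nbrs_b[of 1] nbrs_b[of 2] nbrs_b[of 3] nbrs_b[of 4] nbrs_b[of 5] nbrs_b[of 6] nbrs_b[of 7]
    by (auto simp: R_def L b)
  have rows_a: "R (a8 0) [8, 12, 28]" "R (a8 1) [9, 13, 29]" "R (a8 2) [10, 14, 28]" "R (a8 3) [11, 15, 29]"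
    using nbrs_a[of 0] nbrs_a[of 1] nbrs_a[of 2] nbrs_a[of 3]
    by (auto simp: R_def L u d)
  have rows_d: "R (d8 0) [24, 26, 29]" "R (d8 1) [25, 27, 28]"
    using nbrs_d[of 0] nbrs_d[of 1]
    by (auto simp: R_def L a d)

  show ?thesis
    unfolding labelling_def template_def R_def[symmetric] L_def[symmetric]
    by (simp add: L_def rows_c rows_u rows_b rows_a rows_d del: One_nat_def)
qed

end

text \<open>The template numbers the vertices of the cycle first, so a cycle through the given arc
  places the arc at the labels 0 to \<open>t\<close>.\<close>

lemma (in cage) ex_template_iso:
  assumes g: "g \<in> {3, 4, 5, 6, 8}" and xs: "chain E xs" "length xs = Suc t"
  obtains f where "bij_betw f {..<length (template g)} V"
    "\<And>x y. x < length (template g) \<Longrightarrow> y < length (template g) \<Longrightarrow> E (f x) (f y) \<longleftrightarrow> tadj (template g) x y"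
    "\<And>k. k \<le> t \<Longrightarrow> f k = xs ! k"
proof -
  obtain c where c: "cyc c" "\<And>j. j \<le> t \<Longrightarrow> c (int j) = xs ! j" using ex_cyc[OF xs] by blast
  interpret cage_with_cycle V E t g c by unfold_locales (rule c)
  have "\<exists>L. labelling E L (template g) \<and> cage {..<length (template g)} (tadj (template g)) t g \<and> (\<forall>k\<in>{..t}. L ! k = c (int k))"
  proof -
    have all_le: "{..2} = {0, 1, 2::nat}" "{..3} = {0, 1, 2, 3::nat}" "{..4} = {0, 1, 2, 3, 4::nat}"
      "{..5} = {0, 1, 2, 3, 4, 5::nat}"
      by auto
    consider "g = 3" "t = 2" | "g = 4" "t = 3" | "g = 5" "t = 3" | "g = 6" "t = 4" | "g = 8" "t = 5"
      using g tg by force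
    then show ?thesis
    proof cases
      case 1
      with labelling_3 template_cage(1) show ?thesis
        by (intro exI[of _ "[c 0, c 1, c 2, u 0]"]) (simp add: all_le)
    next
      case 2
      with labelling_4 template_cage(2) show ?thesis
        by (intro exI[of _ "[c 0, c 1, c 2, c 3, u 0, u 1]"]) (simp add: all_le)
    next
      case 3
      with labelling_5 template_cage(3) show ?thesis
        by (intro exI[of _ "[c 0, c 1, c 2, c 3, c 4, u 0, u 1, u 2, u 3, u 4]"]) (simp add: all_le)
    next
      case 4
      with labelling_6 template_cage(4) show ?thesis
        by (intro exI[of _ "[c 0, c 1, c 2, c 3, c 4, c 5, u 0, u 1, u 2, u 3, u 4, u 5, d6 0, d6 1]"])
          (simp add: all_le)
    next
      case 5
      with labelling_8 template_cage(5) show ?thesis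
        by (intro exI[of _ "[c 0, c 1, c 2, c 3, c 4, c 5, c 6, c 7, u 0, u 1, u 2, u 3, u 4, u 5, u 6, u 7,
          b8 0, b8 1, b8 2, b8 3, b8 4, b8 5, b8 6, b8 7, a8 0, a8 1, a8 2, a8 3, d8 0, d8 1]"])
          (simp add: all_le)
    qed
  qed
  then obtain L where L: "labelling E L (template g)" "cage {..<length (template g)} (tadj (template g)) t g"
    "\<And>k. k \<le> t \<Longrightarrow> L ! k = c (int k)" by blast
  show ?thesis
    using that[of "(!) L"] labelling_iso[OF L(1,2)] L(3) c(2) by simp
qed

text \<open>Two \<open>t\<close>-arcs give two isomorphisms from the same template. One composed
  with the inverse of the other carries arc to arc.\<close>

lemma (in cage) arc_transitive_cage:
  assumes g: "g \<in> {3, 4, 5, 6, 8}"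
  shows "arc_transitive_cage V E t g"
proof
  fix xs ys assume xs: "chain E xs" "length xs = Suc t" and ys: "chain E ys" "length ys = Suc t"
  let ?N = "{..<length (template g)}"
  obtain f where f: "bij_betw f ?N V" "\<And>x y. x \<in> ?N \<Longrightarrow> y \<in> ?N \<Longrightarrow> E (f x) (f y) \<longleftrightarrow> tadj (template g) x y"
    "\<And>k. k \<le> t \<Longrightarrow> f k = xs ! k" using ex_template_iso[OF g xs] by (metis lessThan_iff)
  obtain h where h: "bij_betw h ?N V" "\<And>x y. x \<in> ?N \<Longrightarrow> y \<in> ?N \<Longrightarrow> E (h x) (h y) \<longleftrightarrow> tadj (template g) x y"
    "\<And>k. k \<le> t \<Longrightarrow> h k = ys ! k" using ex_template_iso[OF g ys] by (metis lessThan_iff)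
  define i where "i = inv_into ?N f"
  have i: "i v \<in> ?N" "f (i v) = v" if "v \<in> V" for v
    using that f(1) by (auto simp: i_def bij_betw_def inv_into_into f_inv_into_f)
  have i_f: "i (f x) = x" if "x \<in> ?N" for x
    using that f(1) by (auto simp: i_def bij_betw_def)
  \<comment> \<open>Extended by the identity outside \<open>V\<close>, as \<open>auts\<close>
    demands.\<close>
  define \<phi> where "\<phi> v = (if v \<in> V then h (i v) else v)" for v
  have \<phi>V: "\<phi> v \<in> V \<longleftrightarrow> v \<in> V" for v
    using i h(1) by (auto simp: \<phi>_def bij_betw_def)
  have "bij_betw i V ?N" using f(1) by (simp add: i_def bij_betw_inv_into)
  then have "bij_betw (h \<circ> i) V V" using h(1) by (rule bij_betw_trans)
  then have 1: "bij_betw \<phi> V V" by (subst bij_betw_cong[of V \<phi> "h \<circ> i"]) (auto simp: \<phi>_def)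
  have 2: "bij_betw \<phi> (- V) (- V)"
    by (subst bij_betw_cong[of "- V" \<phi> id]) (auto simp: \<phi>_def)
  have "bij_betw \<phi> (V \<union> - V) (V \<union> - V)" using bij_betw_combine[OF 1 2] by blast
  then have bij: "bij \<phi>" by simp
  have E: "E (\<phi> x) (\<phi> y) \<longleftrightarrow> E x y" for x y
  proof (cases "x \<in> V \<and> y \<in> V")
    case True
    then have "E (\<phi> x) (\<phi> y) \<longleftrightarrow> tadj (template g) (i x) (i y)" using h(2) i by (simp add: \<phi>_def)
    also have "\<dots> \<longleftrightarrow> E x y" using f(2)[of "i x" "i y"] i True by simp
    finally show ?thesis .
  next
    case False
    then show ?thesis using E_in E_in2 \<phi>V by blast
  qed
  have "\<phi> \<in> auts" using bij E by (auto simp: auts_def \<phi>_def)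
  moreover have "map \<phi> xs = ys"
  proof (rule nth_equalityI)
    show "length (map \<phi> xs) = length ys" using xs ys by simp
    fix k assume k: "k < length (map \<phi> xs)"
    then have "k \<le> t" using xs by simp
    have "set xs \<subseteq> V" using chain_in_V xs t2 by auto
    then have "xs ! k \<in> V" using k by auto
    have "t < length (template g)"
      using g tg length_template by auto
    then have "k \<in> ?N" using \<open>k \<le> t\<close> by simp
    then show "map \<phi> xs ! k = ys ! k"
      using k f(3)[OF \<open>k \<le> t\<close>] h(3)[OF \<open>k \<le> t\<close>] \<open>xs ! k \<in> V\<close> i_f[of k] by (simp add: \<phi>_def)
  qed
  ultimately show "\<exists>f\<in>auts. map f xs = ys" by blast
qed

lemma chain_map_iff:
  assumes "inj_on f (set xs)" "\<And>x y. x \<in> set xs \<Longrightarrow> y \<in> set xs \<Longrightarrow> E' (f x) (f y) \<longleftrightarrow> E x y"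
  shows "chain E' (map f xs) \<longleftrightarrow> chain E xs"
proof -
  have "E' (map f xs ! i) (map f xs ! Suc i) \<longleftrightarrow> E (xs ! i) (xs ! Suc i)" if "Suc i < length xs" for i
    using that assms(2) by simp
  moreover have "map f xs ! i = map f xs ! Suc (Suc i) \<longleftrightarrow> xs ! i = xs ! Suc (Suc i)" if "Suc (Suc i) < length xs" for i
    using that assms(1) by (simp add: inj_on_eq_iff)
  ultimately show ?thesis unfolding chain_nth by auto
qed

lemma cage_iso:
  assumes "cage V E t g" and f: "bij_betw f V V'"
    and E': "\<And>x y. x \<in> V \<Longrightarrow> y \<in> V \<Longrightarrow> E' (f x) (f y) \<longleftrightarrow> E x y" and E'_V: "\<And>x y. E' x y \<Longrightarrow> x \<in> V' \<and> y \<in> V'"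
  shows "cage V' E' t g"
proof -
  interpret cage V E t g by fact
  define h where "h = inv_into V f"
  have h: "h y \<in> V" "f (h y) = y" if "y \<in> V'" for y
    using that f by (auto simp: h_def bij_betw_def inv_into_into f_inv_into_f)
  have hf: "h (f x) = x" if "x \<in> V" for x
    using that f by (auto simp: h_def bij_betw_def)
  have fV: "f x \<in> V'" if "x \<in> V" for x using that f by (auto simp: bij_betw_def)
  have Eh: "E (h x) (h y) \<longleftrightarrow> E' x y" if "x \<in> V'" "y \<in> V'" for x y
    using E'[of "h x" "h y"] h that by simp
  have inj_h: "inj_on h V'" using h(2) by (metis inj_onI)
  have chain_V: "set xs \<subseteq> V'" if "chain E' xs" "2 \<le> length xs" for xs
    using that
  proof (induction xs rule: chain_induct)
    case (triple x y z zs)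
    then have "E' x y" "set (y # z # zs) \<subseteq> V'" by auto
    then show ?case using E'_V by auto
  next
    case (pair x y)
    then show ?case using E'_V by auto
  qed auto
  have chain_h: "chain E (map h xs)" if "chain E' xs" "2 \<le> length xs" for xs
    using chain_V[OF that] that Eh inj_h by (subst chain_map_iff) (auto intro: inj_on_subset)
  have chain_f: "chain E' (map f xs)" if "chain E xs" "2 \<le> length xs" for xs
    using chain_in_V[OF that] that E' f by (subst chain_map_iff) (auto intro: inj_on_subset simp: bij_betw_def)
  show ?thesis
  proof
    show "finite V'" "V' \<noteq> {}" using f fin ne bij_betw_finite by (auto simp: bij_betw_def)
    show "E' x y \<Longrightarrow> x \<in> V'" for x y using E'_V by blast
    show "E' x y \<Longrightarrow> E' y x" for x y using E'_V Eh adj_sym by metis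
    show "\<not> E' x x" for x using E'_V Eh irrefl by metis
    show "card {y. E' x y} = 3" if "x \<in> V'" for x
    proof -
      have "{y. E' x y} = f ` {y. E (h x) y}"
      proof
        show "{y. E' x y} \<subseteq> f ` {y. E (h x) y}"
        proof
          fix y assume "y \<in> {y. E' x y}"
          then have "y \<in> V'" "E (h x) (h y)" using E'_V Eh by auto
          then show "y \<in> f ` {y. E (h x) y}" using h(2)[of y] by (metis image_eqI mem_Collect_eq)
        qed
        show "f ` {y. E (h x) y} \<subseteq> {y. E' x y}" using E'[of "h x"] h[OF that] E_in2 by auto
      qed
      moreover have "inj_on f {y. E (h x) y}" using f E_in2 by (auto simp: bij_betw_def intro: inj_on_subset)
      ultimately show ?thesis using deg[of "h x"] h(1)[OF that] by (simp add: card_image)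
    qed
    show "E'\<^sup>*\<^sup>* x y" if "x \<in> V'" "y \<in> V'" for x y
    proof -
      have "E'\<^sup>*\<^sup>* (f (h x)) (f z)" if "E\<^sup>*\<^sup>* (h x) z" for z
        using that
      proof (induction rule: rtranclp_induct)
        case (step y z)
        then have "E' (f y) (f z)" using E' E_in E_in2 by blast
        with step show ?case by auto
      qed auto
      from this[OF conn[OF h(1)[OF that(1)] h(1)[OF that(2)]]] show ?thesis using h(2) that by simp
    qed
    show "girth_ge E' g"
      unfolding girth_ge_def
    proof (intro allI impI)
      fix xs assume xs: "chain E' xs" "2 \<le> length xs" "hd xs = last xs"
      then have "xs \<noteq> []" by auto
      then have "hd (map h xs) = last (map h xs)" using xs by (simp add: hd_map last_map)
      then have "g < length (map h xs)" using girth chain_h[OF xs(1,2)] xs(2) unfolding girth_ge_def by (metis length_map)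
      then show "g < length xs" by simp
    qed
    show "\<exists>ys. chain E' ys \<and> length ys = Suc (g - t) \<and> hd ys = hd xs \<and> last ys = last xs"
      if xs: "chain E' xs" "length xs = Suc t" for xs
    proof -
      have l: "2 \<le> length xs" "xs \<noteq> []" using xs t2 by auto
      obtain ys where ys: "chain E ys" "length ys = Suc (g - t)" "hd ys = hd (map h xs)" "last ys = last (map h xs)"
        using closing[OF chain_h[OF xs(1) l(1)]] xs(2) by auto
      have "2 \<le> length ys" "ys \<noteq> []" using ys(2) tg t2 g3 by auto
      moreover have "hd xs \<in> V'" "last xs \<in> V'" using chain_V[OF xs(1) l(1)] l(2) by auto
      ultimately show ?thesis
        using ys l h(2) chain_f by (intro exI[of _ "map f ys"]) (auto simp: hd_map last_map)
    qed
  qed (use t2 g3 tg in auto)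
qed

section \<open>The five graphs\<close>

lemma adjacent_graph_of:
  assumes "\<And>u v. R u v \<longleftrightarrow> R v u"
  shows "adjacent (graph_of V R) u v \<longleftrightarrow> u \<in> V \<and> v \<in> V \<and> u \<noteq> v \<and> R u v"
  using assms by (auto simp: adjacent_def graph_of_def doubleton_eq_iff)

lemma gverts_graph_of: "gverts (graph_of V R) = V"
  by (simp add: graph_of_def)

fun incident :: "'a + 'a set \<Rightarrow> 'a + 'a set \<Rightarrow> bool" where
  "incident (Inl p) (Inr l) = (p \<in> l)"
| "incident (Inr l) (Inl p) = (p \<in> l)"
| "incident _ _ = False"

lemma adjacent_incidence_graph:
  "adjacent (incidence_graph P L) u v \<longleftrightarrow> u \<in> Inl ` P \<union> Inr ` L \<and> v \<in> Inl ` P \<union> Inr ` L \<and> incident u v"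
  by (cases u; cases v) (auto simp: adjacent_def incidence_graph_def doubleton_eq_iff)

lemma gverts_incidence_graph: "gverts (incidence_graph P L) = Inl ` P \<union> Inr ` L"
  by (simp add: incidence_graph_def)

text \<open>\<open>L\<close> lists the vertices in the order of the template. Separating membership
  from the relation \<open>R\<close> leaves a finite comparison of \<open>R\<close> with the rows of
  \<open>T\<close>.\<close>

lemma cage_of_list:
  assumes T: "cage {..<length T} (tadj T) t g"
    and L: "set L = V'" "distinct L" "length L = length T"
    and E': "\<And>x y. E' x y \<longleftrightarrow> x \<in> V' \<and> y \<in> V' \<and> R x y"
    and R: "list_all (\<lambda>x. list_all (\<lambda>y. R (L ! x) (L ! y) \<longleftrightarrow> y \<in> set (T ! x)) [0..<length T]) [0..<length T]"
  shows "cage V' E' t g"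
proof (rule cage_iso[OF T])
  show "bij_betw ((!) L) {..<length T} V'"
    using L bij_betw_nth[of L "{..<length T}" V'] by simp
  show "E' x y \<Longrightarrow> x \<in> V' \<and> y \<in> V'" for x y using E' by blast
  show "E' (L ! x) (L ! y) \<longleftrightarrow> tadj T x y" if "x \<in> {..<length T}" "y \<in> {..<length T}" for x y
    using that R L by (auto simp: E' tadj_def list_all_iff)
qed

lemma pairs_upto_eq: "pairs_upto n = {{a, b} | a b. a < b \<and> b < n}"
proof -
  have "\<exists>a b. p = {a, b} \<and> a < b \<and> b < n" if p: "p \<subseteq> {..<n}" "card p = 2" for p
  proof -
    obtain a b where ab: "p = {a, b}" "a \<noteq> b" using p(2) by (auto simp: card_2_iff)
    then have "a < n" "b < n" using p(1) by auto
    then show ?thesis using ab by (metis insert_commute nat_neq_iff)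
  qed
  then show ?thesis by (fastforce simp: pairs_upto_def)
qed

lemma pairs_upto_Suc: "pairs_upto (Suc n) = pairs_upto n \<union> (\<lambda>a. {a, n}) ` {..<n}"
  unfolding pairs_upto_eq by (auto simp: less_Suc_eq image_iff)

lemma pairs_upto_0: "pairs_upto 0 = {}"
  by (simp add: pairs_upto_eq)

lemma pairs_upto_5: "pairs_upto 5 = {{0, 1::nat}, {0, 2}, {0, 3}, {0, 4}, {1, 2}, {1, 3}, {1, 4}, {2, 3}, {2, 4}, {3, 4}}"
  and pairs_upto_6: "pairs_upto 6 = {{0, 1::nat}, {0, 2}, {0, 3}, {0, 4}, {0, 5}, {1, 2}, {1, 3}, {1, 4}, {1, 5}, {2, 3}, {2, 4}, {2, 5}, {3, 4}, {3, 5}, {4, 5}}"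
  by (simp_all add: eval_nat_numeral pairs_upto_Suc pairs_upto_0 lessThan_Suc insert_commute)

section \<open>Vertex orders matching the five graphs with the templates\<close>

lemma cage_K4: "cage (gverts (complete_graph 4)) (adjacent (complete_graph 4)) 2 3"
proof (rule cage_of_list[where L = "[0, 1, 2, 3]" and R = "\<lambda>x y. x \<noteq> y", OF template_cage(1)])
  show "set [0, 1, 2, 3] = gverts (complete_graph 4)"
    by (auto simp: complete_graph_def gverts_graph_of)
  show "adjacent (complete_graph 4) x y \<longleftrightarrow> x \<in> gverts (complete_graph 4) \<and>
      y \<in> gverts (complete_graph 4) \<and> x \<noteq> y" for x y
    unfolding complete_graph_def gverts_graph_of by (subst adjacent_graph_of) auto
qed (auto simp: length_template upt_rec template_def)

lemma cage_K33: "cage (gverts (complete_multipartite 2 3)) (adjacent (complete_multipartite 2 3)) 3 4"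
proof (rule cage_of_list[where L = "[(0, 0), (1, 0), (0, 1), (1, 1), (1, 2), (0, 2)]" and R = "\<lambda>x y. fst x \<noteq> fst y", OF template_cage(2)])
  show "set [(0, 0), (1, 0), (0, 1), (1, 1), (1, 2), (0, 2)] = gverts (complete_multipartite 2 3)"
    by (auto simp: complete_multipartite_def gverts_graph_of)
  show "adjacent (complete_multipartite 2 3) x y \<longleftrightarrow> x \<in> gverts (complete_multipartite 2 3) \<and>
      y \<in> gverts (complete_multipartite 2 3) \<and> fst x \<noteq> fst y" for x y
    unfolding complete_multipartite_def gverts_graph_of by (subst adjacent_graph_of) auto
qed (auto simp: length_template upt_rec template_def)

lemma cage_petersen: "cage (gverts petersen_graph) (adjacent petersen_graph) 3 5"
\<comment> \<open>Five pairs forming a pentagon, then for each of them the one remaining pair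
  disjoint from it.\<close>
proof (rule cage_of_list[where L = "[{0, 1::nat}, {2, 3}, {0, 4}, {1, 2}, {3, 4}, {2, 4}, {1, 4}, {1, 3}, {0, 3}, {0, 2}]" and R = "\<lambda>x y. x \<inter> y = {}", OF template_cage(3)])
  show "set [{0, 1::nat}, {2, 3}, {0, 4}, {1, 2}, {3, 4}, {2, 4}, {1, 4}, {1, 3}, {0, 3}, {0, 2}] = gverts petersen_graph"
    unfolding petersen_graph_def gverts_graph_of pairs_upto_5 by (simp only: list.set insert_commute)
  show "distinct [{0, 1::nat}, {2, 3}, {0, 4}, {1, 2}, {3, 4}, {2, 4}, {1, 4}, {1, 3}, {0, 3}, {0, 2}]" by code_simp
  show "adjacent petersen_graph x y \<longleftrightarrow> x \<in> gverts petersen_graph \<and> y \<in> gverts petersen_graph \<and> x \<inter> y = {}" for x y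
  proof -
    have "x \<noteq> y" if "x \<inter> y = {}" "x \<in> pairs_upto 5"
      using that by (auto simp: pairs_upto_def)
    then show ?thesis
      unfolding petersen_graph_def gverts_graph_of by (subst adjacent_graph_of) auto
  qed
  show "list_all (\<lambda>x. list_all (\<lambda>y. ([{0, 1::nat}, {2, 3}, {0, 4}, {1, 2}, {3, 4}, {2, 4}, {1, 4}, {1, 3}, {0, 3}, {0, 2}] ! x \<inter> [{0, 1::nat}, {2, 3}, {0, 4}, {1, 2}, {3, 4}, {2, 4}, {1, 4}, {1, 3}, {0, 3}, {0, 2}] ! y = {}) = (y \<in> set (template 5 ! x)))
      [0..<length (template 5)]) [0..<length (template 5)]"
    unfolding length_template by code_simp
qed (simp add: length_template)

lemma heawood_lines: "{{i, (i + 1) mod 7, (i + 3) mod 7} | i. i < (7::nat)} =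
  {{0, 1, 3}, {1, 2, 4}, {2, 3, 5}, {3, 4, 6}, {4, 5, 0}, {5, 6, 1}, {6, 0, 2}}"
proof -
  have "{{i, (i + 1) mod 7, (i + 3) mod 7} | i. i < (7::nat)} = (\<lambda>i. {i, (i + 1) mod 7, (i + 3) mod 7}) ` {..<7}"
    by blast
  also have "{..<7} = {0, 1, 2, 3, 4, 5, 6::nat}" by auto
  finally show ?thesis by (simp add: numeral_2_eq_2)
qed

lemma cage_heawood: "cage (gverts heawood_graph) (adjacent heawood_graph) 4 6"
\<comment> \<open>The hexagon is the triangle of the plane on the points 0, 1, 2; its six off-cycle
  neighbours follow, and then the remaining point and line.\<close>
proof (rule cage_of_list[where L = "[(Inl 0 :: nat + nat set), Inr {0, 1, 3}, Inl 1, Inr {1, 2, 4}, Inl 2, Inr {6, 0, 2}, Inr {4, 5, 0}, Inl 3, Inr {5, 6, 1}, Inl 4, Inr {2, 3, 5}, Inl 6, Inl 5, Inr {3, 4, 6}]" and R = incident, OF template_cage(4)])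
  have P: "{..<7} = {0, 1, 2, 3, 4, 5, 6::nat}" by auto
  show "set [(Inl 0 :: nat + nat set), Inr {0, 1, 3}, Inl 1, Inr {1, 2, 4}, Inl 2, Inr {6, 0, 2}, Inr {4, 5, 0}, Inl 3, Inr {5, 6, 1}, Inl 4, Inr {2, 3, 5}, Inl 6, Inl 5, Inr {3, 4, 6}] = gverts heawood_graph"
    unfolding heawood_graph_def gverts_incidence_graph heawood_lines P
    by (simp only: list.set image_insert image_empty Un_insert_left Un_empty_left insert_commute)
  show "distinct [(Inl 0 :: nat + nat set), Inr {0, 1, 3}, Inl 1, Inr {1, 2, 4}, Inl 2, Inr {6, 0, 2}, Inr {4, 5, 0}, Inl 3, Inr {5, 6, 1}, Inl 4, Inr {2, 3, 5}, Inl 6, Inl 5, Inr {3, 4, 6}]" by code_simp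
  show "adjacent heawood_graph x y \<longleftrightarrow> x \<in> gverts heawood_graph \<and> y \<in> gverts heawood_graph \<and> incident x y" for x y
    unfolding heawood_graph_def gverts_incidence_graph by (rule adjacent_incidence_graph)
  show "list_all (\<lambda>x. list_all (\<lambda>y. incident ([(Inl 0 :: nat + nat set), Inr {0, 1, 3}, Inl 1, Inr {1, 2, 4}, Inl 2, Inr {6, 0, 2}, Inr {4, 5, 0}, Inl 3, Inr {5, 6, 1}, Inl 4, Inr {2, 3, 5}, Inl 6, Inl 5, Inr {3, 4, 6}] ! x) ([(Inl 0 :: nat + nat set), Inr {0, 1, 3}, Inl 1, Inr {1, 2, 4}, Inl 2, Inr {6, 0, 2}, Inr {4, 5, 0}, Inl 3, Inr {5, 6, 1}, Inl 4, Inr {2, 3, 5}, Inl 6, Inl 5, Inr {3, 4, 6}] ! y) = (y \<in> set (template 6 ! x)))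
      [0..<length (template 6)]) [0..<length (template 6)]"
    unfolding length_template by code_simp
qed (simp add: length_template)

text \<open>Take the duad through 0 and a second member. Counting points, these two are disjoint and
  the third is their complement, so a finite check over pairs of duads remains.\<close>

lemma synthemes: "{M. M \<subseteq> pairs_upto 6 \<and> card M = 3 \<and> \<Union> M = {..<6}} = {{{0, 1::nat}, {2, 3}, {4, 5}}, {{0, 1}, {2, 4}, {3, 5}}, {{0, 1}, {2, 5}, {3, 4}}, {{0, 2}, {1, 3}, {4, 5}}, {{0, 2}, {1, 4}, {3, 5}}, {{0, 2}, {1, 5}, {3, 4}}, {{0, 3}, {1, 2}, {4, 5}}, {{0, 3}, {1, 4}, {2, 5}}, {{0, 3}, {1, 5}, {2, 4}}, {{0, 4}, {1, 2}, {3, 5}}, {{0, 4}, {1, 3}, {2, 5}}, {{0, 4}, {1, 5}, {2, 3}}, {{0, 5}, {1, 2}, {3, 4}}, {{0, 5}, {1, 3}, {2, 4}}, {{0, 5}, {1, 4}, {2, 3}}}" (is "?L = ?R")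
proof
  have P: "{..<6} = {0, 1, 2, 3, 4, 5::nat}" by auto
  show "?R \<subseteq> ?L"
    unfolding pairs_upto_6 P by (auto simp: doubleton_eq_iff)
  show "?L \<subseteq> ?R"
  proof
    fix M assume "M \<in> ?L"
    then have M: "M \<subseteq> pairs_upto 6" "card M = 3" "\<Union> M = {..<6}" by auto
    have "0 \<in> \<Union> M" using M(3) by simp
    then obtain p where p: "p \<in> M" "0 \<in> p" by blast
    have "card (M - {p}) = 2" using M(2) p(1) by simp
    then obtain q r where "M - {p} = {q, r}" by (auto simp: card_2_iff)
    then have Meq: "M = {p, q, r}" using p(1) by auto
    have p2: "s \<in> M \<Longrightarrow> s \<subseteq> {..<6} \<and> card s = 2" for s using M(1) by (auto simp: pairs_upto_def)
    have fin: "finite p" "finite q" "finite r" using p2[of p] p2[of q] p2[of r] Meq finite_subset[OF _ finite_lessThan] by auto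
    have sub: "p \<union> q \<subseteq> {..<6}" using p2[of p] p2[of q] Meq by auto
    have "card (p \<union> q) + card (p \<inter> q) = 4" using card_Un_Int[OF fin(1,2)] p2 Meq by simp
    moreover have "card ({..<6} - (p \<union> q)) = 6 - card (p \<union> q)"
      using sub fin by (subst card_Diff_subset) auto
    moreover have r: "{..<6} - (p \<union> q) \<subseteq> r" using M(3) Meq by auto
    then have "card ({..<6} - (p \<union> q)) \<le> 2" using card_mono[OF fin(3) r] p2 Meq by simp
    ultimately have "card ({..<6} - (p \<union> q)) = 2" "card (p \<inter> q) = 0" by linarith+
    then have req: "{..<6} - (p \<union> q) = r" and disj: "p \<inter> q = {}"
      using card_subset_eq[OF fin(3) r] p2 Meq fin by auto
    have "p \<in> {{0, 1::nat}, {0, 2}, {0, 3}, {0, 4}, {0, 5}, {1, 2}, {1, 3}, {1, 4}, {1, 5}, {2, 3}, {2, 4}, {2, 5}, {3, 4}, {3, 5}, {4, 5}}" using subsetD[OF M(1) p(1)] unfolding pairs_upto_6 .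
    with p(2) have p5: "p \<in> {{0, 1}, {0, 2}, {0, 3}, {0, 4}, {0, 5}}"
      by (simp only: insert_iff empty_iff) (elim disjE; simp)
    have "q \<in> M" using Meq by simp
    from subsetD[OF M(1) this] have q: "q \<in> {{0, 1::nat}, {0, 2}, {0, 3}, {0, 4}, {0, 5}, {1, 2}, {1, 3}, {1, 4}, {1, 5}, {2, 3}, {2, 4}, {2, 5}, {3, 4}, {3, 5}, {4, 5}}" unfolding pairs_upto_6 .
    have "\<forall>p\<in>{{0, 1}, {0, 2}, {0, 3}, {0, 4}, {0, 5}}. \<forall>q\<in>{{0, 1::nat}, {0, 2}, {0, 3}, {0, 4}, {0, 5}, {1, 2}, {1, 3}, {1, 4}, {1, 5}, {2, 3}, {2, 4}, {2, 5}, {3, 4}, {3, 5}, {4, 5}}.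
        p \<inter> q = {} \<longrightarrow> {p, q, {0, 1, 2, 3, 4, 5} - (p \<union> q)} \<in> {{{0, 1::nat}, {2, 3}, {4, 5}}, {{0, 1}, {2, 4}, {3, 5}}, {{0, 1}, {2, 5}, {3, 4}}, {{0, 2}, {1, 3}, {4, 5}}, {{0, 2}, {1, 4}, {3, 5}}, {{0, 2}, {1, 5}, {3, 4}}, {{0, 3}, {1, 2}, {4, 5}}, {{0, 3}, {1, 4}, {2, 5}}, {{0, 3}, {1, 5}, {2, 4}}, {{0, 4}, {1, 2}, {3, 5}}, {{0, 4}, {1, 3}, {2, 5}}, {{0, 4}, {1, 5}, {2, 3}}, {{0, 5}, {1, 2}, {3, 4}}, {{0, 5}, {1, 3}, {2, 4}}, {{0, 5}, {1, 4}, {2, 3}}}"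
      by code_simp
    from this[rule_format, OF p5 q disj] show "M \<in> ?R" unfolding Meq req[symmetric] P .
  qed
qed

lemma cage_tutte: "cage (gverts tutte_8_cage) (adjacent tutte_8_cage) 5 8"
proof (rule cage_of_list[where L = "[(Inl {0, 1} :: nat set + nat set set), Inr {{0, 1}, {2, 3}, {4, 5}}, Inl {2, 3}, Inr {{0, 4}, {1, 5}, {2, 3}}, Inl {0, 4}, Inr {{0, 4}, {1, 2}, {3, 5}}, Inl {3, 5}, Inr {{0, 1}, {2, 4}, {3, 5}}, Inr {{0, 1}, {2, 5}, {3, 4}}, Inl {4, 5}, Inr {{0, 5}, {1, 4}, {2, 3}}, Inl {1, 5}, Inr {{0, 4}, {1, 3}, {2, 5}}, Inl {1, 2}, Inr {{0, 2}, {1, 4}, {3, 5}}, Inl {2, 4}, Inl {3, 4}, Inr {{0, 2}, {1, 3}, {4, 5}}, Inl {0, 5}, Inr {{0, 2}, {1, 5}, {3, 4}}, Inl {1, 3}, Inr {{0, 5}, {1, 2}, {3, 4}}, Inl {0, 2}, Inr {{0, 5}, {1, 3}, {2, 4}}, Inl {2, 5}, Inr {{0, 3}, {1, 2}, {4, 5}}, Inl {1, 4}, Inr {{0, 3}, {1, 5}, {2, 4}}, Inr {{0, 3}, {1, 4}, {2, 5}}, Inl {0, 3}]" and R = incident, OF template_cage(5)])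
  show "set [(Inl {0, 1} :: nat set + nat set set), Inr {{0, 1}, {2, 3}, {4, 5}}, Inl {2, 3}, Inr {{0, 4}, {1, 5}, {2, 3}}, Inl {0, 4}, Inr {{0, 4}, {1, 2}, {3, 5}}, Inl {3, 5}, Inr {{0, 1}, {2, 4}, {3, 5}}, Inr {{0, 1}, {2, 5}, {3, 4}}, Inl {4, 5}, Inr {{0, 5}, {1, 4}, {2, 3}}, Inl {1, 5}, Inr {{0, 4}, {1, 3}, {2, 5}}, Inl {1, 2}, Inr {{0, 2}, {1, 4}, {3, 5}}, Inl {2, 4}, Inl {3, 4}, Inr {{0, 2}, {1, 3}, {4, 5}}, Inl {0, 5}, Inr {{0, 2}, {1, 5}, {3, 4}}, Inl {1, 3}, Inr {{0, 5}, {1, 2}, {3, 4}}, Inl {0, 2}, Inr {{0, 5}, {1, 3}, {2, 4}}, Inl {2, 5}, Inr {{0, 3}, {1, 2}, {4, 5}}, Inl {1, 4}, Inr {{0, 3}, {1, 5}, {2, 4}}, Inr {{0, 3}, {1, 4}, {2, 5}}, Inl {0, 3}] = gverts tutte_8_cage"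
    unfolding tutte_8_cage_def gverts_incidence_graph synthemes unfolding pairs_upto_6
    by (simp only: list.set image_insert image_empty Un_insert_left Un_empty_left insert_commute)
  show "distinct [(Inl {0, 1} :: nat set + nat set set), Inr {{0, 1}, {2, 3}, {4, 5}}, Inl {2, 3}, Inr {{0, 4}, {1, 5}, {2, 3}}, Inl {0, 4}, Inr {{0, 4}, {1, 2}, {3, 5}}, Inl {3, 5}, Inr {{0, 1}, {2, 4}, {3, 5}}, Inr {{0, 1}, {2, 5}, {3, 4}}, Inl {4, 5}, Inr {{0, 5}, {1, 4}, {2, 3}}, Inl {1, 5}, Inr {{0, 4}, {1, 3}, {2, 5}}, Inl {1, 2}, Inr {{0, 2}, {1, 4}, {3, 5}}, Inl {2, 4}, Inl {3, 4}, Inr {{0, 2}, {1, 3}, {4, 5}}, Inl {0, 5}, Inr {{0, 2}, {1, 5}, {3, 4}}, Inl {1, 3}, Inr {{0, 5}, {1, 2}, {3, 4}}, Inl {0, 2}, Inr {{0, 5}, {1, 3}, {2, 4}}, Inl {2, 5}, Inr {{0, 3}, {1, 2}, {4, 5}}, Inl {1, 4}, Inr {{0, 3}, {1, 5}, {2, 4}}, Inr {{0, 3}, {1, 4}, {2, 5}}, Inl {0, 3}]" by code_simp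
  show "adjacent tutte_8_cage x y \<longleftrightarrow> x \<in> gverts tutte_8_cage \<and> y \<in> gverts tutte_8_cage \<and> incident x y" for x y
    unfolding tutte_8_cage_def gverts_incidence_graph by (rule adjacent_incidence_graph)
  show "list_all (\<lambda>x. list_all (\<lambda>y. incident ([(Inl {0, 1} :: nat set + nat set set), Inr {{0, 1}, {2, 3}, {4, 5}}, Inl {2, 3}, Inr {{0, 4}, {1, 5}, {2, 3}}, Inl {0, 4}, Inr {{0, 4}, {1, 2}, {3, 5}}, Inl {3, 5}, Inr {{0, 1}, {2, 4}, {3, 5}}, Inr {{0, 1}, {2, 5}, {3, 4}}, Inl {4, 5}, Inr {{0, 5}, {1, 4}, {2, 3}}, Inl {1, 5}, Inr {{0, 4}, {1, 3}, {2, 5}}, Inl {1, 2}, Inr {{0, 2}, {1, 4}, {3, 5}}, Inl {2, 4}, Inl {3, 4}, Inr {{0, 2}, {1, 3}, {4, 5}}, Inl {0, 5}, Inr {{0, 2}, {1, 5}, {3, 4}}, Inl {1, 3}, Inr {{0, 5}, {1, 2}, {3, 4}}, Inl {0, 2}, Inr {{0, 5}, {1, 3}, {2, 4}}, Inl {2, 5}, Inr {{0, 3}, {1, 2}, {4, 5}}, Inl {1, 4}, Inr {{0, 3}, {1, 5}, {2, 4}}, Inr {{0, 3}, {1, 4}, {2, 5}}, Inl {0, 3}] ! x) ([(Inl {0, 1} :: nat set + nat set set), Inr {{0, 1}, {2, 3}, {4, 5}}, Inl {2, 3}, Inr {{0, 4}, {1, 5}, {2, 3}}, Inl {0, 4},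 Inr {{0, 4}, {1, 2}, {3, 5}}, Inl {3, 5}, Inr {{0, 1}, {2, 4}, {3, 5}}, Inr {{0, 1}, {2, 5}, {3, 4}}, Inl {4, 5}, Inr {{0, 5}, {1, 4}, {2, 3}}, Inl {1, 5}, Inr {{0, 4}, {1, 3}, {2, 5}}, Inl {1, 2}, Inr {{0, 2}, {1, 4}, {3, 5}}, Inl {2, 4}, Inl {3, 4}, Inr {{0, 2}, {1, 3}, {4, 5}}, Inl {0, 5}, Inr {{0, 2}, {1, 5}, {3, 4}}, Inl {1, 3}, Inr {{0, 5}, {1, 2}, {3, 4}}, Inl {0, 2}, Inr {{0, 5}, {1, 3}, {2, 4}}, Inl {2, 5}, Inr {{0, 3}, {1, 2}, {4, 5}}, Inl {1, 4}, Inr {{0, 3}, {1, 5}, {2, 4}}, Inr {{0, 3}, {1, 4}, {2, 5}}, Inl {0, 3}] ! y) = (y \<in> set (template 8 ! x)))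
      [0..<length (template 8)]) [0..<length (template 8)]"
    unfolding length_template by code_simp
qed (simp add: length_template)

section \<open>Walks, distances and isomorphisms\<close>

lemma adjacent_sym: "adjacent G u v \<longleftrightarrow> adjacent G v u"
  by (simp add: adjacent_def insert_commute)

lemma simple_graph_adjacent:
  assumes "simple_graph G" "adjacent G u v"
  shows "u \<in> gverts G" "v \<in> gverts G" "u \<noteq> v"
  using assms by (auto simp: simple_graph_def adjacent_def card_2_iff doubleton_eq_iff)

lemma walks_iff: "xs \<in> walks G s \<longleftrightarrow> length xs = Suc s \<and> set xs \<subseteq> gverts G \<and> successively (adjacent G) xs"
  by (auto simp: walks_def successively_conv_nth)

lemma arcs_iff: "xs \<in> arcs G s \<longleftrightarrow> length xs = Suc s \<and> set xs \<subseteq> gverts G \<and> chain (adjacent G) xs"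
proof -
  have "(\<forall>j. 1 \<le> j \<and> j < s \<longrightarrow> xs ! (j - 1) \<noteq> xs ! (j + 1)) \<longleftrightarrow> (\<forall>j. Suc j < s \<longrightarrow> xs ! j \<noteq> xs ! Suc (Suc j))"
    by (metis One_nat_def Suc_eq_plus1 Suc_le_eq diff_Suc_1 gr0_conv_Suc zero_less_Suc)
  then show ?thesis by (auto simp: arcs_def walks_def chain_nth)
qed

lemma chain_successively: "chain E xs \<Longrightarrow> successively E xs"
  by (induction xs rule: chain_induct) auto

lemma gdist_le: "xs \<in> walks G s \<Longrightarrow> hd xs = u \<Longrightarrow> last xs = v \<Longrightarrow> gdist G u v \<le> enat s"
  unfolding gdist_def by (rule Inf_lower) blast

lemma gdist_walk:
  assumes "gdist G u v = enat s"
  obtains xs where "xs \<in> walks G s" "hd xs = u" "last xs = v"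
proof -
  let ?A = "{enat s | s. \<exists>xs\<in>walks G s. hd xs = u \<and> last xs = v}"
  have "?A \<noteq> {}" using assms by (auto simp: gdist_def Inf_enat_def split: if_splits)
  then have "Inf ?A \<in> ?A" by (meson ex_in_conv wellorder_InfI)
  with assms that show ?thesis by (auto simp: gdist_def)
qed

lemma gdist_eqI:
  assumes "xs \<in> walks G s" "hd xs = u" "last xs = v"
    and "\<And>ys k. ys \<in> walks G k \<Longrightarrow> hd ys = u \<Longrightarrow> last ys = v \<Longrightarrow> s \<le> k"
  shows "gdist G u v = enat s"
  unfolding gdist_def by (rule Inf_eqI) (use assms in auto)

text \<open>Minimality among walks with the same ends replaces the infimum in \<open>gdist\<close>,
  which keeps extended natural numbers out of the arguments on geodesics.\<close>

lemma geodesics_iff: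
  "xs \<in> geodesics G s \<longleftrightarrow> xs \<in> walks G s \<and> (\<forall>ys k. ys \<in> walks G k \<longrightarrow> hd ys = hd xs \<longrightarrow> last ys = last xs \<longrightarrow> s \<le> k)"
proof
  assume "xs \<in> geodesics G s"
  then have "xs \<in> walks G s" "gdist G (hd xs) (last xs) = enat s" by (auto simp: geodesics_def)
  then show "xs \<in> walks G s \<and> (\<forall>ys k. ys \<in> walks G k \<longrightarrow> hd ys = hd xs \<longrightarrow> last ys = last xs \<longrightarrow> s \<le> k)"
    using gdist_le by (metis enat_ord_simps(1))
next
  assume "xs \<in> walks G s \<and> (\<forall>ys k. ys \<in> walks G k \<longrightarrow> hd ys = hd xs \<longrightarrow> last ys = last xs \<longrightarrow> s \<le> k)"
  then show "xs \<in> geodesics G s"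
    unfolding geodesics_def using gdist_eqI[of xs G s "hd xs" "last xs"] by blast
qed

lemma walks_snoc: "xs \<noteq> [] \<Longrightarrow> xs @ [x] \<in> walks G (Suc s) \<longleftrightarrow> xs \<in> walks G s \<and> x \<in> gverts G \<and> adjacent G (last xs) x"
  by (auto simp: walks_iff successively_append_iff)

lemma geodesics_prefix:
  assumes "xs @ [x] \<in> geodesics G (Suc s)" "xs \<noteq> []"
  shows "xs \<in> geodesics G s"
  unfolding geodesics_iff
proof (intro conjI allI impI)
  have w: "xs @ [x] \<in> walks G (Suc s)"
    and m: "\<And>ys k. ys \<in> walks G k \<Longrightarrow> hd ys = hd xs \<Longrightarrow> last ys = x \<Longrightarrow> Suc s \<le> k"
    using assms by (auto simp: geodesics_iff)
  show "xs \<in> walks G s" using w walks_snoc[OF assms(2)] by simp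
  fix ys k assume ys: "ys \<in> walks G k" "hd ys = hd xs" "last ys = last xs"
  then have "ys \<noteq> []" by (auto simp: walks_iff)
  then have "ys @ [x] \<in> walks G (Suc k)" using w ys by (simp add: walks_snoc assms(2))
  from m[OF this] ys \<open>ys \<noteq> []\<close> show "s \<le> k" by simp
qed

lemma geodesic_no_shortcut:
  assumes "xs @ [p, q, r] \<in> geodesics G s"
  shows "p \<noteq> r" "\<not> adjacent G p r"
proof -
  have w: "xs @ [p, q, r] \<in> walks G s" and len: "s = length xs + 2"
    and m: "\<And>ys k. ys \<in> walks G k \<Longrightarrow> hd ys = hd (xs @ [p]) \<Longrightarrow> last ys = r \<Longrightarrow> s \<le> k"
    using assms by (auto simp: geodesics_iff walks_iff hd_append)
  have p: "xs @ [p] \<in> walks G (length xs)" using w by (auto simp: walks_iff successively_append_iff)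
  show "p \<noteq> r" using m[OF p] len by auto
  show "\<not> adjacent G p r"
  proof
    assume "adjacent G p r"
    then have "(xs @ [p]) @ [r] \<in> walks G (Suc (length xs))"
      using p w by (subst walks_snoc) (auto simp: walks_iff)
    from m[OF this] len show False by (cases "xs = []") simp_all
  qed
qed

lemma geodesic_chain:
  assumes "xs \<in> geodesics G s"
  shows "chain (adjacent G) xs"
  using assms
proof (induction xs arbitrary: s rule: rev_induct)
  case (snoc r xs)
  show ?case
  proof (cases "2 \<le> length xs")
    case True
    then obtain ys p q where xs: "xs = ys @ [p, q]" by (rule snoc2E)
    have s: "s = Suc (length (ys @ [p]))" using snoc.prems xs by (auto simp: geodesics_iff walks_iff)
    have "chain (adjacent G) xs"
      using snoc.IH geodesics_prefix[of xs r G] snoc.prems s True by fastforce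
    moreover have "p \<noteq> r" using geodesic_no_shortcut(1)[of ys p q r G s] snoc.prems xs by simp
    moreover have "adjacent G q r" using snoc.prems xs by (auto simp: geodesics_iff walks_iff successively_append_iff)
    ultimately show ?thesis using xs by (simp add: chain_snoc)
  next
    case False
    then show ?thesis using snoc.prems
      by (cases xs; cases "tl xs") (auto simp: geodesics_iff walks_iff)
  qed
qed simp

lemma geodesics_1:
  assumes "simple_graph G"
  shows "[x, y] \<in> geodesics G 1 \<longleftrightarrow> adjacent G x y"
proof
  assume xy: "adjacent G x y"
  have "1 \<le> k" if "ys \<in> walks G k" "hd ys = x" "last ys = y" for ys k
    using that simple_graph_adjacent[OF assms xy] by (cases k) (auto simp: walks_iff length_Suc_conv)
  then show "[x, y] \<in> geodesics G 1"
    using xy simple_graph_adjacent[OF assms xy] by (auto simp: geodesics_iff walks_iff)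
qed (auto simp: geodesics_iff walks_iff)

lemma geodesics_2:
  assumes "simple_graph G"
  shows "[x, y, z] \<in> geodesics G 2 \<longleftrightarrow> adjacent G x y \<and> adjacent G y z \<and> x \<noteq> z \<and> \<not> adjacent G x z"
proof
  assume xyz: "[x, y, z] \<in> geodesics G 2"
  then have "[] @ [x, y, z] \<in> geodesics G 2" by simp
  note short = geodesic_no_shortcut[OF this]
  have "[x, y, z] \<in> walks G 2" using xyz by (simp add: geodesics_iff)
  with short show "adjacent G x y \<and> adjacent G y z \<and> x \<noteq> z \<and> \<not> adjacent G x z"
    by (simp add: walks_iff)
next
  assume xyz: "adjacent G x y \<and> adjacent G y z \<and> x \<noteq> z \<and> \<not> adjacent G x z"
  have "2 \<le> k" if "ys \<in> walks G k" "hd ys = x" "last ys = z" for ys k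
  proof (rule ccontr)
    assume "\<not> 2 \<le> k"
    then have "k = 0 \<or> k = 1" by auto
    then show False using that xyz by (auto simp: walks_iff length_Suc_conv)
  qed
  then show "[x, y, z] \<in> geodesics G 2"
    using xyz simple_graph_adjacent[OF assms] by (auto simp: geodesics_iff walks_iff)
qed

lemma graph_iso_id: "graph_iso id G G"
  by (simp add: graph_iso_def)

lemma graph_iso_comp: "graph_iso f G H \<Longrightarrow> graph_iso h H K \<Longrightarrow> graph_iso (h \<circ> f) G K"
  unfolding graph_iso_def by (auto intro: bij_betw_trans simp: bij_betwE)

lemma graph_iso_inv:
  assumes "graph_iso f G H"
  shows "graph_iso (inv_into (gverts G) f) H G"
proof -
  have f: "bij_betw f (gverts G) (gverts H)" using assms by (simp add: graph_iso_def)
  have "inv_into (gverts G) f v \<in> gverts G" "f (inv_into (gverts G) f v) = v" if "v \<in> gverts H" for v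
    using that f by (auto simp: bij_betw_def inv_into_into f_inv_into_f)
  then show ?thesis
    using assms f by (auto simp: graph_iso_def bij_betw_inv_into)
qed

lemma graph_isomorphic_sym: "graph_isomorphic G H \<Longrightarrow> graph_isomorphic H G"
  unfolding graph_isomorphic_def using graph_iso_inv by blast

lemma graph_isomorphic_trans: "graph_isomorphic G H \<Longrightarrow> graph_isomorphic H K \<Longrightarrow> graph_isomorphic G K"
  unfolding graph_isomorphic_def using graph_iso_comp by blast

lemma walks_map:
  assumes "graph_iso f G H" "xs \<in> walks G s"
  shows "map f xs \<in> walks H s"
proof -
  have "xs ! i \<in> gverts G" if "i \<le> s" for i
    using assms(2) that nth_mem[of i xs] by (auto simp: walks_def)
  then show ?thesis
    using assms by (auto simp: graph_iso_def walks_def bij_betwE)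
qed

lemma geodesics_map:
  assumes f: "graph_iso f G H" and xs: "xs \<in> geodesics G s"
  shows "map f xs \<in> geodesics H s"
  unfolding geodesics_iff
proof (intro conjI allI impI)
  have w: "xs \<in> walks G s" and m: "\<And>ys k. ys \<in> walks G k \<Longrightarrow> hd ys = hd xs \<Longrightarrow> last ys = last xs \<Longrightarrow> s \<le> k"
    using xs by (auto simp: geodesics_iff)
  show "map f xs \<in> walks H s" using w f walks_map by blast
  fix ys k assume ys: "ys \<in> walks H k" "hd ys = hd (map f xs)" "last ys = last (map f xs)"
  let ?h = "inv_into (gverts G) f"
  have "xs \<noteq> []" "ys \<noteq> []" "set xs \<subseteq> gverts G" using w ys(1) by (auto simp: walks_iff)
  then have ne: "xs \<noteq> []" "ys \<noteq> []" "hd xs \<in> gverts G" "last xs \<in> gverts G" by auto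
  have "inj_on f (gverts G)" using f by (simp add: graph_iso_def bij_betw_def)
  then have "?h (hd ys) = hd xs" "?h (last ys) = last xs" using ys ne by (simp_all add: hd_map last_map)
  then show "s \<le> k" using m[OF walks_map[OF graph_iso_inv[OF f] ys(1)]] ne by (simp add: hd_map last_map)
qed

lemma geodesics_subset: "xs \<in> geodesics G s \<Longrightarrow> set xs \<subseteq> gverts G"
  by (simp add: geodesics_iff walks_iff)

lemma aut_transitive_geodesics_iso:
  assumes f: "graph_iso f G H" and "aut_transitive_on G (geodesics G s)"
  shows "aut_transitive_on H (geodesics H s)"
  unfolding aut_transitive_on_def
proof (intro ballI)
  fix xs ys assume xs: "xs \<in> geodesics H s" and ys: "ys \<in> geodesics H s"
  let ?h = "inv_into (gverts G) f"
  note h = graph_iso_inv[OF f]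
  obtain k where k: "graph_iso k G G" "map k (map ?h xs) = map ?h ys"
    using assms(2) geodesics_map[OF h xs] geodesics_map[OF h ys]
    unfolding aut_transitive_on_def graph_auts_def by blast
  have "map f (map ?h ys) = ys"
  proof -
    have "f (?h y) = y" if "y \<in> set ys" for y
      using that f geodesics_subset[OF ys] by (auto simp: graph_iso_def bij_betw_def f_inv_into_f)
    then show ?thesis by (simp add: map_idI)
  qed
  then have "map (f \<circ> k \<circ> ?h) xs = ys" using k(2) by (metis map_map)
  moreover have "f \<circ> k \<circ> ?h \<in> graph_auts H"
    using graph_iso_comp[OF h graph_iso_comp[OF k(1) f]] by (simp add: graph_auts_def comp_assoc)
  ultimately show "\<exists>f\<in>graph_auts H. map f xs = ys" by blast
qed

lemma connected_gdist_finite: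
  assumes "connected_graph G" "u \<in> gverts G" "v \<in> gverts G"
  obtains s where "gdist G u v = enat s"
proof -
  obtain s xs where "xs \<in> walks G s" "hd xs = u" "last xs = v"
    using assms unfolding connected_graph_def by blast
  then have "gdist G u v \<le> enat s" by (rule gdist_le)
  with that show ?thesis by (metis enat_ile)
qed

lemma connected_gdiam_finite:
  assumes "simple_graph G" "connected_graph G"
  obtains d where "gdiam G = enat d"
proof -
  let ?A = "{gdist G u v | u v. u \<in> gverts G \<and> v \<in> gverts G}"
  have fin: "finite (gverts G)" using assms by (simp add: simple_graph_def)
  have eq: "?A = (\<lambda>(u, v). gdist G u v) ` (gverts G \<times> gverts G)" by auto
  have "finite ?A" unfolding eq using fin by simp
  moreover have "?A \<noteq> {}" using assms(2) unfolding eq by (simp add: connected_graph_def)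
  ultimately have "gdiam G = Max ?A" "Max ?A \<in> ?A" unfolding gdiam_def
    by (rule cSup_eq_Max, rule Max_in)
  then obtain u v where "gdiam G = gdist G u v" "u \<in> gverts G" "v \<in> gverts G" by auto
  with assms(2) that show ?thesis by (metis connected_gdist_finite)
qed

lemma gdist_le_gdiam: "u \<in> gverts G \<Longrightarrow> v \<in> gverts G \<Longrightarrow> gdist G u v \<le> gdiam G"
  unfolding gdiam_def by (rule Sup_upper) blast

lemma gdiam_ge_2:
  assumes "simple_graph G" "connected_graph G" "\<not> is_complete G"
  shows "2 \<le> gdiam G"
proof -
  obtain u v where uv: "u \<in> gverts G" "v \<in> gverts G" "u \<noteq> v" "\<not> adjacent G u v"
    using assms(3) by (auto simp: is_complete_def)
  obtain s where s: "gdist G u v = enat s" using connected_gdist_finite[OF assms(2) uv(1,2)] .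
  obtain xs where xs: "xs \<in> walks G s" "hd xs = u" "last xs = v" using gdist_walk[OF s] .
  have "2 \<le> s"
  proof (rule ccontr)
    assume "\<not> 2 \<le> s"
    then have "s = 0 \<or> s = 1" by auto
    then show False using xs uv by (auto simp: walks_iff length_Suc_conv)
  qed
  then have "2 \<le> gdist G u v" by (simp add: s numeral_eq_enat)
  with gdist_le_gdiam[OF uv(1,2)] show ?thesis by (rule order_trans[rotated])
qed

section \<open>Line graphs\<close>

lemma gverts_line_graph: "gverts (line_graph G) = gedges G"
  by (simp add: line_graph_def graph_of_def)

lemma adjacent_line_graph:
  "adjacent (line_graph G) e f \<longleftrightarrow> e \<in> gedges G \<and> f \<in> gedges G \<and> e \<noteq> f \<and> e \<inter> f \<noteq> {}"
  unfolding line_graph_def by (subst adjacent_graph_of) auto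

lemma simple_line_graph:
  assumes "simple_graph G"
  shows "simple_graph (line_graph G)"
proof -
  have "gedges G \<subseteq> Pow (gverts G)" using assms by (auto simp: simple_graph_def)
  then have "finite (gedges G)" using assms by (auto simp: simple_graph_def intro: finite_subset)
  moreover have "e \<subseteq> gedges G \<and> card e = 2" if e: "e \<in> gedges (line_graph G)" for e
  proof -
    obtain u v where "e = {u, v}" "u \<in> gedges G" "v \<in> gedges G" "u \<noteq> v"
      using e unfolding line_graph_def graph_of_def by auto
    then show ?thesis by simp
  qed
  ultimately show ?thesis by (simp add: simple_graph_def gverts_line_graph)
qed

fun edges_of :: "'a list \<Rightarrow> 'a set list" where
  "edges_of (x # y # zs) = {x, y} # edges_of (y # zs)"
| "edges_of _ = []"

lemma edges_of_snoc: "edges_of (xs @ [p, q]) = edges_of (xs @ [p]) @ [{p, q}]"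
  by (induction xs rule: edges_of.induct) auto

lemma length_edges_of: "length (edges_of xs) = length xs - 1"
  by (induction xs rule: edges_of.induct) auto

lemma map_edges_of: "map ((`) f) (edges_of xs) = edges_of (map f xs)"
  by (induction xs rule: edges_of.induct) auto

lemma hd_edges_of_append: "2 \<le> length xs \<Longrightarrow> hd (edges_of (xs @ ys)) = hd (edges_of xs)"
  by (cases xs rule: edges_of.cases) auto

lemma edge_cases:
  assumes "simple_graph G" "e \<in> gedges G" "p \<in> e"
  obtains r where "e = {p, r}" "p \<noteq> r" "adjacent G p r"
proof -
  have "card e = 2" using assms by (simp add: simple_graph_def)
  then obtain a b where ab: "e = {a, b}" "a \<noteq> b" by (auto simp: card_2_iff)
  define r where "r = (if p = a then b else a)"
  have "e = {p, r}" "p \<noteq> r" using ab assms(3) by (auto simp: r_def)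
  with that assms(2) show ?thesis by (auto simp: adjacent_def)
qed

text \<open>A walk in the line graph may turn about a vertex, which a walk in \<open>G\<close> can
  shortcut. A new edge at the far end of the last one extends the walk. At the near end it replaces
  the last step, or drops that step if it is the edge before.\<close>

lemma walk_line_graph_chain:
  assumes G: "simple_graph G"
  shows "es \<in> walks (line_graph G) k \<Longrightarrow> \<exists>zs. chain (adjacent G) zs \<and> 2 \<le> length zs \<and> length zs \<le> k + 2 \<and>
    hd (edges_of zs) = hd es \<and> last (edges_of zs) = last es"
proof (induction k arbitrary: es)
  case 0
  then obtain e where e: "es = [e]" "e \<in> gedges G"
    by (auto simp: walks_iff gverts_line_graph length_Suc_conv)
  then have "card e = 2" using G by (simp add: simple_graph_def)
  then obtain a b where "e = {a, b}" by (auto simp: card_2_iff)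
  with e show ?case by (intro exI[of _ "[a, b]"]) (simp add: adjacent_def)
next
  case (Suc k)
  then obtain es' e where es: "es = es' @ [e]" "es' \<noteq> []"
    by (auto simp: walks_iff length_Suc_conv_rev)
  with Suc.prems have es': "es' \<in> walks (line_graph G) k" "adjacent (line_graph G) (last es') e"
    by (simp_all add: walks_snoc)
  from Suc.IH[OF es'(1)] obtain zs where zs: "chain (adjacent G) zs" "2 \<le> length zs" "length zs \<le> k + 2"
    "hd (edges_of zs) = hd es'" "last (edges_of zs) = last es'" by blast
  obtain ys p q where ys: "zs = ys @ [p, q]" using zs(2) by (rule snoc2E)
  have hd: "hd es' = hd es" using es by simp
  have last: "last es' = {p, q}" using zs(5) ys by (simp add: edges_of_snoc)
  have e: "e \<in> gedges G" "e \<noteq> {p, q}" "e \<inter> {p, q} \<noteq> {}" using es'(2) last by (auto simp: adjacent_line_graph)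
  show ?case
  proof (cases "q \<in> e")
    case True
    obtain r where r: "e = {q, r}" "adjacent G q r" using edge_cases[OF G e(1) True] by metis
    then have "chain (adjacent G) (ys @ [p, q, r])" using zs(1) ys e(2) by (auto simp: chain_snoc)
    moreover have "hd (edges_of (ys @ [p, q, r])) = hd es"
      using hd_edges_of_append[OF zs(2), of "[r]"] ys zs(4) hd by simp
    moreover have "last (edges_of (ys @ [p, q, r])) = e"
      using edges_of_snoc[of "ys @ [p]" q r] r by simp
    ultimately show ?thesis using zs(3) ys es by (intro exI[of _ "ys @ [p, q, r]"]) auto
  next
    case False
    then have "p \<in> e" using e by auto
    obtain r where r: "e = {p, r}" "adjacent G p r" using edge_cases[OF G e(1) \<open>p \<in> e\<close>] by metis
    have "r \<noteq> q" using False r by auto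
    have pq: "adjacent G p q" using zs(1) ys by (metis chain.simps(3) chain_append)
    show ?thesis
    proof (cases "ys = []")
      case True
      \<comment> \<open>A walk of one edge has no direction yet, so it is reversed before being
        extended.\<close>
      then have "hd es = {q, p}" using zs(4) hd ys by auto
      moreover have "chain (adjacent G) [q, p, r]" using r pq \<open>r \<noteq> q\<close> adjacent_sym[of G p q] by simp
      moreover have "last es = {p, r}" using es r by simp
      ultimately show ?thesis by (intro exI[of _ "[q, p, r]"]) simp
    next
      case False
      then obtain xs o' where xs: "ys = xs @ [o']" by (metis append_butlast_last_id)
      have c: "chain (adjacent G) (xs @ [o', p])" using chain_butlast[OF zs(1)] ys xs by (simp add: butlast_append)
      have h: "hd (edges_of (xs @ [o', p])) = hd es"
        using hd_edges_of_append[of "xs @ [o', p]" "[q]"] xs ys zs(4) hd by simp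
      show ?thesis
      proof (cases "r = o'")
        case True
        then have "last (edges_of (xs @ [o', p])) = last es" using es r by (auto simp: edges_of_snoc)
        then show ?thesis using c h zs(3) ys xs
          by (intro exI[of _ "xs @ [o', p]"]) simp
      next
        case False
        then have "chain (adjacent G) (xs @ [o', p, r])" using c r by (simp add: chain_snoc)
        moreover have "hd (edges_of (xs @ [o', p, r])) = hd es"
          using hd_edges_of_append[of "xs @ [o', p]" "[r]"] h by simp
        moreover have "last (edges_of (xs @ [o', p, r])) = e"
          using edges_of_snoc[of "xs @ [o']" p r] r by simp
        ultimately show ?thesis using zs(3) ys xs es by (intro exI[of _ "xs @ [o', p, r]"]) auto
      qed
    qed
  qed
qed

lemma chain_walk_line_graph:
  assumes G: "simple_graph G"
  shows "chain (adjacent G) zs \<Longrightarrow> length zs = k + 2 \<Longrightarrow> edges_of zs \<in> walks (line_graph G) k"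
proof (induction zs arbitrary: k rule: chain_induct)
  case (pair x y)
  then show ?case by (simp add: walks_iff gverts_line_graph adjacent_def)
next
  case (triple x y z zs)
  then obtain k' where k: "k = Suc k'" "length (y # z # zs) = k' + 2" by (cases k) auto
  have "edges_of (y # z # zs) \<in> walks (line_graph G) k'" using triple k by simp
  moreover have "adjacent G x y" "adjacent G y z"
    using triple.prems(1) chain_Cons[of "adjacent G" y z zs] by simp_all
  then have "{x, y} \<in> gedges G" "{y, z} \<in> gedges G" by (simp_all add: adjacent_def)
  moreover have "{x, y} \<noteq> {y, z}"
    using triple.prems(1) simple_graph_adjacent(3)[OF G] by (auto simp: doubleton_eq_iff)
  ultimately show ?case
    using k by (auto simp: walks_iff gverts_line_graph adjacent_line_graph successively_Cons)
qed auto

text \<open>Three successive edges of a geodesic cannot share a vertex, since the first and third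
  would be equal or adjacent. So a geodesic never turns about a vertex and runs along a walk of
  \<open>G\<close> without shortcuts.\<close>

lemma geodesic_line_graph_chain:
  assumes G: "simple_graph G"
  shows "es \<in> geodesics (line_graph G) k \<Longrightarrow> \<exists>zs. chain (adjacent G) zs \<and> length zs = k + 2 \<and> edges_of zs = es"
proof (induction k arbitrary: es)
  case 0
  then obtain e where e: "es = [e]" "e \<in> gedges G"
    by (auto simp: geodesics_iff walks_iff gverts_line_graph length_Suc_conv)
  then have "card e = 2" using G by (simp add: simple_graph_def)
  then obtain a b where "e = {a, b}" by (auto simp: card_2_iff)
  with e show ?case by (intro exI[of _ "[a, b]"]) (simp add: adjacent_def)
next
  case (Suc k)
  then obtain es' e where es: "es = es' @ [e]" "es' \<noteq> []"
    by (auto simp: geodesics_iff walks_iff length_Suc_conv_rev)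
  have es': "es' \<in> geodesics (line_graph G) k" using Suc.prems es geodesics_prefix[of es' e _ k] by simp
  from Suc.IH[OF this] obtain zs where zs: "chain (adjacent G) zs" "length zs = k + 2" "edges_of zs = es'" by blast
  have "2 \<le> length zs" using zs by simp
  then obtain ys p q where ys: "zs = ys @ [p, q]" by (rule snoc2E)
  have last: "last es' = {p, q}" using zs(3) ys by (auto simp: edges_of_snoc)
  have "adjacent (line_graph G) (last es') e"
  proof -
    have "es' @ [e] \<in> walks (line_graph G) (Suc k)" using Suc.prems es by (simp add: geodesics_iff)
    then show ?thesis using es by (simp add: walks_snoc)
  qed
  then have e: "e \<in> gedges G" "e \<noteq> {p, q}" "e \<inter> {p, q} \<noteq> {}" "{p, q} \<in> gedges G"
    using last by (auto simp: adjacent_line_graph)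
  show ?case
  proof (cases "q \<in> e")
    case True
    obtain r where r: "e = {q, r}" "adjacent G q r" using edge_cases[OF G e(1) True] by metis
    then have "chain (adjacent G) (ys @ [p, q, r])" using zs(1) ys e(2) by (auto simp: chain_snoc)
    moreover have "edges_of (ys @ [p, q, r]) = es"
      using edges_of_snoc[of "ys @ [p]" q r] r zs(3) ys es by simp
    ultimately show ?thesis using zs(2) ys es by (intro exI[of _ "ys @ [p, q, r]"]) auto
  next
    case False
    then have "p \<in> e" using e by auto
    obtain r where r: "e = {p, r}" "adjacent G p r" using edge_cases[OF G e(1) \<open>p \<in> e\<close>] by metis
    have "r \<noteq> q" using False r by auto
    show ?thesis
    proof (cases "ys = []")
      case True
      then have "es' = [{q, p}]" "k = 0" using zs ys by auto
      moreover have "chain (adjacent G) [q, p, r]" using r e(4) \<open>r \<noteq> q\<close> by (auto simp: adjacent_def insert_commute)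
      ultimately show ?thesis using es r by (intro exI[of _ "[q, p, r]"]) simp
    next
      case False
      then obtain xs o' where xs: "ys = xs @ [o']" by (metis append_butlast_last_id)
      have es_eq: "es = edges_of (xs @ [o']) @ [{o', p}, {p, q}, e]"
        using es zs(3) ys xs edges_of_snoc[of "xs @ [o']" p q] by (simp add: edges_of_snoc)
      have "{o', p} \<noteq> e" "\<not> adjacent (line_graph G) {o', p} e"
        using geodesic_no_shortcut[OF Suc.prems[unfolded es_eq]] by simp_all
      moreover have "{o', p} \<in> gedges G"
        using geodesics_subset[OF Suc.prems[unfolded es_eq]] by (simp add: gverts_line_graph)
      ultimately show ?thesis using \<open>p \<in> e\<close> e(1) by (auto simp: adjacent_line_graph)
    qed
  qed
qed

lemma line_graph_iso:
  assumes G: "simple_graph G" "simple_graph H" and f: "graph_iso f G H"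
  shows "graph_iso ((`) f) (line_graph G) (line_graph H)"
proof -
  have bij: "bij_betw f (gverts G) (gverts H)"
    and adj: "\<And>u v. u \<in> gverts G \<Longrightarrow> v \<in> gverts G \<Longrightarrow> adjacent G u v \<longleftrightarrow> adjacent H (f u) (f v)"
    using f by (auto simp: graph_iso_def)
  have inj: "inj_on f (gverts G)" using bij by (simp add: bij_betw_def)
  have sub: "e \<subseteq> gverts G" if "e \<in> gedges G" for e using that G by (simp add: simple_graph_def)
  have img: "f ` e \<in> gedges H" if e: "e \<in> gedges G" for e
  proof -
    have "card e = 2" using e G by (simp add: simple_graph_def)
    then obtain a b where ab: "e = {a, b}" by (auto simp: card_2_iff)
    then have "adjacent G a b" using e by (simp add: adjacent_def)
    then have "adjacent H (f a) (f b)" using adj simple_graph_adjacent[OF G(1)] by blast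
    then show ?thesis using ab by (simp add: adjacent_def)
  qed
  have inj': "inj_on ((`) f) (gedges G)"
    by (rule inj_onI) (metis inj sub inj_on_image_eq_iff)
  have surj: "e \<in> (`) f ` gedges G" if e: "e \<in> gedges H" for e
  proof -
    have "card e = 2" using e G by (simp add: simple_graph_def)
    then obtain a b where ab: "e = {a, b}" by (auto simp: card_2_iff)
    then have H: "adjacent H a b" using e by (simp add: adjacent_def)
    then have "a \<in> f ` gverts G" "b \<in> f ` gverts G"
      using simple_graph_adjacent[OF G(2) H] bij by (auto simp: bij_betw_def)
    then obtain a' b' where "a = f a'" "b = f b'" "a' \<in> gverts G" "b' \<in> gverts G" by blast
    then show ?thesis using H adj ab by (intro image_eqI[of _ _ "{a', b'}"]) (auto simp: adjacent_def)
  qed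
  have "f ` e \<inter> f ` e' = f ` (e \<inter> e')" if "e \<in> gedges G" "e' \<in> gedges G" for e e'
    using inj sub that by (metis inj_on_image_Int)
  then show ?thesis
    using img inj' surj inj_on_eq_iff[OF inj']
    by (auto simp: graph_iso_def gverts_line_graph bij_betw_def adjacent_line_graph)
qed

section \<open>Geodesics in the line graph of a cage\<close>

lemma (in cubic_graph) auts_bij_V: "f \<in> auts \<Longrightarrow> bij_betw f V V"
proof -
  assume f: "f \<in> auts"
  have "f x \<in> V \<longleftrightarrow> x \<in> V" for x
  proof
    assume "x \<in> V"
    then obtain y where "E x y" using ex_nbr2 by metis
    then show "f x \<in> V" using f auts_E E_in by blast
  next
    assume "f x \<in> V"
    show "x \<in> V"
    proof (rule ccontr)
      assume "x \<notin> V"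
      then show False using f \<open>f x \<in> V\<close> by (auto simp: auts_def)
    qed
  qed
  moreover have "inj f" "surj f" using f by (auto simp: auts_def bij_def)
  ultimately show ?thesis unfolding bij_betw_def by (auto intro: inj_on_subset) (metis imageI surjD)
qed

lemma auts_graph_iso:
  assumes "cubic_graph (gverts G) (adjacent G)" "f \<in> cubic_graph.auts (gverts G) (adjacent G)"
  shows "graph_iso f G G"
proof -
  interpret cubic_graph "gverts G" "adjacent G" by fact
  show ?thesis using assms(2) auts_bij_V auts_E by (simp add: graph_iso_def)
qed

lemma geodesics_append:
  assumes "xs @ ys \<in> geodesics G s" "xs \<noteq> []" "length xs = Suc k"
  shows "xs \<in> geodesics G k"
  using assms(1)
proof (induction ys arbitrary: s rule: rev_induct)
  case Nil
  then show ?case using assms(3) by (simp add: geodesics_iff walks_iff)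
next
  case (snoc y ys)
  then have "s = Suc (s - 1)" using assms(2) by (cases s) (auto simp: geodesics_iff walks_iff)
  then have "xs @ ys \<in> geodesics G (s - 1)"
    using snoc.prems geodesics_prefix[of "xs @ ys" y G "s - 1"] assms(2) by simp
  then show ?case by (rule snoc.IH)
qed

text \<open>If \<open>z = p\<close>, the target edge is already the last edge of the walk, which
  saves one step.\<close>

lemma last_edge_walk:
  assumes G: "simple_graph G" and W: "chain (adjacent G) (ws @ [p, x])" and z: "adjacent G x z"
  obtains es where "es \<in> walks (line_graph G) (if z = p then length ws else Suc (length ws))"
    "hd es = hd (edges_of (ws @ [p, x]))" "last es = {x, z}"
proof (cases "z = p")
  case True
  then show ?thesis
    using that chain_walk_line_graph[OF G W, of "length ws"] by (auto simp: edges_of_snoc insert_commute)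
next
  case False
  then have "chain (adjacent G) (ws @ [p, x, z])" using W z by (simp add: chain_snoc)
  then show ?thesis
    using that[of "edges_of (ws @ [p, x, z])"] False chain_walk_line_graph[OF G, of "ws @ [p, x, z]" "Suc (length ws)"]
      hd_edges_of_append[of "ws @ [p, x]" "[z]"] edges_of_snoc[of "ws @ [p]" x z]
    by simp
qed

locale transitive_cage_graph =
  fixes G :: "'a ugraph" and t g :: nat
  assumes simple: "simple_graph G"
    and atc: "arc_transitive_cage (gverts G) (adjacent G) t g"
begin

sublocale arc_transitive_cage "gverts G" "adjacent G" t g by (rule atc)

text \<open>The geodesic competes with the other way round the \<open>g\<close>-cycle: from
  \<open>b\<close> back to \<open>a\<close>, along the closing walk to \<open>v\<close>, then to
  \<open>z\<close>. This takes \<open>g - t + 1\<close> steps in the line graph, or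
  \<open>g - t\<close> if \<open>z\<close> is the vertex before \<open>v\<close> on the closing
  walk. Only odd \<open>g\<close> and the first alternative leave room for \<open>t\<close>
  steps.\<close>

lemma edges_tail:
  assumes "chain (adjacent G) (xs @ [v, z])" "edges_of (xs @ [v, z]) \<in> geodesics (line_graph G) t"
    "length xs = t" and ys: "chain (adjacent G) ys" "length ys = Suc (g - t)" "hd ys = hd (xs @ [v])" "last ys = v"
  shows "g + 1 = 2 * t" "z \<noteq> ys ! (g - t - 1)"
proof -
  let ?xs = "xs @ [v]"
  have gt: "g - t \<ge> 1" "t < g" using tg t2 g3 by auto
  have xs: "chain (adjacent G) ?xs" "length ?xs = Suc t" using chain_butlast[OF assms(1)] assms(3) by (auto simp: butlast_append)
  have "last ys = last ?xs" using ys by simp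
  note ends = closing_ends[OF xs ys(1-3) this]
  obtain a b us where ab: "?xs = a # b # us" using xs(2) t2 by (cases ?xs; cases "tl ?xs") auto
  obtain b' ys' where b': "ys = a # b' # ys'" using ys(2,3) ab gt by (cases ys; cases "tl ys") auto
  have "adjacent G a b" using xs(1) unfolding ab by (metis chain_Cons)
  moreover have "b \<noteq> b'" using ends(2) unfolding ab b' by simp
  ultimately have W: "chain (adjacent G) (b # ys)" using ys(1) b' adj_sym by simp
  have "2 \<le> length ys" using ys(2) gt by simp
  then obtain vs p v' where vs: "ys = vs @ [p, v']" by (rule snoc2E)
  have v': "v' = v" using ys(4) vs by simp
  have p: "ys ! (g - t - 1) = p" and lvs: "length vs = g - t - 1" using vs ys(2) by (auto simp: nth_append)
  have "adjacent G v z" using assms(1) by (metis chain.simps(3) chain_append append.assoc append_Cons append_Nil)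
  with W vs v' obtain es where es: "es \<in> walks (line_graph G) (if z = p then length (b # vs) else Suc (length (b # vs)))"
    "hd es = hd (edges_of (b # ys))" "last es = {v, z}"
    using last_edge_walk[OF simple, of "b # vs" p v z] by auto
  have "hd (edges_of (xs @ [v, z])) = {a, b}"
  proof -
    have "xs @ [v, z] = a # b # us @ [z]" using ab by (metis append.assoc append_Cons append_Nil)
    then show ?thesis by (simp only: edges_of.simps list.sel)
  qed
  moreover have "hd (edges_of (b # ys)) = {a, b}" using b' by (simp add: insert_commute)
  ultimately have "t \<le> (if z = p then length (b # vs) else Suc (length (b # vs)))"
    using assms(2) es edges_of_snoc[of xs v z] unfolding geodesics_iff by simp
  then have le: "t \<le> (if z = p then g - t else g - t + 1)" using lvs gt by (auto split: if_splits)
  with tg t2 gt have "g + 1 = 2 * t \<and> z \<noteq> p" by (auto split: if_splits)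
  then show "g + 1 = 2 * t" "z \<noteq> ys ! (g - t - 1)" using p by auto
qed

text \<open>Among \<open>t + 2\<close> successive edges the inner \<open>t\<close> form an arc that
  closes to a \<open>g\<close>-cycle. Going round this cycle the other way joins the first and last
  edge in at most \<open>g - t + 1\<close> steps, which is at most \<open>t\<close>.\<close>

lemma geodesic_short:
  assumes zs: "chain (adjacent G) zs" "length zs = k + 2" "edges_of zs \<in> geodesics (line_graph G) k"
  shows "k \<le> t"
proof (rule ccontr)
  assume "\<not> k \<le> t"
  have split: "edges_of zs = edges_of (take n zs) @ drop (n - 1) (edges_of zs)" if "2 \<le> n" "n \<le> length zs" for n
  proof -
    have "edges_of (take n zs) = take (n - 1) (edges_of zs)" for n
    proof (induction zs arbitrary: n rule: edges_of.induct)
      case (1 x y zs)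
      show ?case
      proof (cases "n \<le> 1")
        case False
        then obtain m where m: "n = Suc (Suc m)" by (metis One_nat_def Suc_le_D not_less_eq_eq)
        show ?thesis using 1[of "Suc m"] by (simp add: m)
      next
        case True
        then show ?thesis by (cases n) auto
      qed
    qed (auto simp: take_Cons split: nat.splits)
    then show ?thesis by (metis append_take_drop_id)
  qed
  \<comment> \<open>\<open>t + 3\<close> vertices: a \<open>t\<close>-arc with one further edge at
    either end.\<close>
  define ws where "ws = take (t + 3) zs"
  have len: "length ws = t + 3" using zs(2) \<open>\<not> k \<le> t\<close> by (simp add: ws_def)
  have "zs = ws @ drop (t + 3) zs" by (simp add: ws_def)
  have ws: "chain (adjacent G) ws" using zs(1) unfolding ws_def chain_nth by auto
  have eq: "edges_of zs = edges_of ws @ drop (t + 2) (edges_of zs)"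
    using split[of "t + 3"] zs(2) \<open>\<not> k \<le> t\<close> by (simp add: ws_def)
  have "edges_of ws @ drop (t + 2) (edges_of zs) \<in> geodesics (line_graph G) k"
    using zs(3) by (simp only: eq[symmetric])
  moreover have "length (edges_of ws) = Suc (t + 1)" by (simp add: length_edges_of len)
  moreover from this have "edges_of ws \<noteq> []" by auto
  ultimately have "edges_of ws \<in> geodesics (line_graph G) (t + 1)"
    using geodesics_append by blast
  then have m: "\<And>ys k. ys \<in> walks (line_graph G) k \<Longrightarrow> hd ys = hd (edges_of ws) \<Longrightarrow> last ys = last (edges_of ws) \<Longrightarrow> t + 1 \<le> k"
    by (auto simp: geodesics_iff)
  obtain v0 us where us: "ws = v0 # us" "length us = t + 2" using len by (cases ws) auto
  obtain xs v z where xs: "us = xs @ [v, z]" using us(2) by (metis snoc2E le_add2)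
  have cus: "chain (adjacent G) us" using chain_tl[OF ws] us by simp
  then have cx: "chain (adjacent G) (xs @ [v])" using chain_butlast[of "adjacent G" us] xs by (simp add: butlast_append)
  have lx: "length (xs @ [v]) = Suc t" using us xs by simp
  obtain ys where ys: "chain (adjacent G) ys" "length ys = Suc (g - t)" "hd ys = hd (xs @ [v])" "last ys = last (xs @ [v])"
    using closing[OF cx lx] by blast
  have gt: "g - t \<ge> 1" "t < g" "g - t < t" using tg t2 g3 by auto
  obtain v1 xs' where v1: "xs @ [v] = v1 # xs'" using lx by (cases "xs @ [v]") auto
  have e01: "adjacent G v0 v1" using ws us xs v1 by (metis append.assoc append_Cons append_Nil chain_Cons)
  have hde: "hd (edges_of ws) = {v0, v1}" using us xs v1
    by (metis append.assoc append_Cons append_Nil edges_of.simps(1) list.sel(1))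
  have lde: "last (edges_of ws) = {v, z}" using us xs edges_of_snoc[of "v0 # xs" v z] by simp
  have "adjacent G v z" using cus xs by (metis chain.simps(3) chain_append)
  have "2 \<le> length ys" using ys(2) gt by simp
  then obtain vs p v' where vs: "ys = vs @ [p, v']" by (rule snoc2E)
  have v': "v' = v" using ys(4) vs by simp
  obtain b' ys' where b': "ys = v1 # b' # ys'" using ys(2,3) v1 gt by (cases ys; cases "tl ys") auto
  show False
  proof (cases "b' = v0")
    case True
    obtain es where "es \<in> walks (line_graph G) (if z = p then length vs else Suc (length vs))"
      "hd es = hd (edges_of ys)" "last es = {v, z}"
      using last_edge_walk[OF simple, of vs p v z] ys(1) vs v' \<open>adjacent G v z\<close> by auto
    moreover have "hd (edges_of ys) = {v0, v1}" using b' True by (simp add: insert_commute)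
    ultimately have "t + 1 \<le> (if z = p then length vs else Suc (length vs))" using m hde lde by metis
    then show False using vs ys(2) gt by (auto split: if_splits)
  next
    case False
    then have "chain (adjacent G) ((v0 # vs) @ [p, v])" using ys(1) b' e01 vs v' by auto
    then obtain es where "es \<in> walks (line_graph G) (if z = p then length (v0 # vs) else Suc (length (v0 # vs)))"
      "hd es = hd (edges_of ((v0 # vs) @ [p, v]))" "last es = {v, z}"
      using last_edge_walk[OF simple, of "v0 # vs" p v z] \<open>adjacent G v z\<close> by metis
    moreover have "hd (edges_of ((v0 # vs) @ [p, v])) = {v0, v1}" using b' vs v'
      by (metis append_Cons edges_of.simps(1) list.sel(1))
    ultimately have "t + 1 \<le> (if z = p then length (v0 # vs) else Suc (length (v0 # vs)))" using m hde lde by metis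
    then show False using vs ys(2) gt by (auto split: if_splits)
  qed
qed

text \<open>Below length \<open>t\<close> the underlying walk extends to a \<open>t\<close>-arc. At
  length \<open>t\<close> it is a \<open>t\<close>-arc with one more vertex, which by
  \<open>edges_tail\<close> avoids the closing walk as well as the arc. It is thus the remaining
  neighbour, and the automorphism moving the arc carries it along.\<close>

lemma line_graph_geodesics_transitive:
  assumes "1 \<le> k"
  shows "aut_transitive_on (line_graph G) (geodesics (line_graph G) k)"
  unfolding aut_transitive_on_def
proof (intro ballI)
  fix es es' assume es: "es \<in> geodesics (line_graph G) k" and es': "es' \<in> geodesics (line_graph G) k"
  obtain zs where zs: "chain (adjacent G) zs" "length zs = k + 2" "edges_of zs = es"
    using geodesic_line_graph_chain[OF simple es] by blast
  obtain zs' where zs': "chain (adjacent G) zs'" "length zs' = k + 2" "edges_of zs' = es'"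
    using geodesic_line_graph_chain[OF simple es'] by blast
  have "\<exists>f\<in>auts. map f zs = zs'"
  proof (cases "k = t")
    case False
    then have "k + 2 \<le> Suc t" using geodesic_short[OF zs(1,2)] zs(3) es by simp
    then obtain us us' where us: "chain (adjacent G) (zs @ us)" "length (zs @ us) = Suc t"
      and us': "chain (adjacent G) (zs' @ us')" "length (zs' @ us') = Suc t"
      using chain_extend_to[of zs "Suc t"] chain_extend_to[of zs' "Suc t"] zs zs' by auto
    obtain f where "f \<in> auts" "map f (zs @ us) = zs' @ us'" using arc_trans[OF us(1) us'(1) us(2) us'(2)] by blast
    then show ?thesis using zs(2) zs'(2) by auto
  next
    case True
    have "2 \<le> length zs" "2 \<le> length zs'" using zs zs' by auto
    then obtain xs v z xs' v' z' where xs: "zs = xs @ [v, z]" "zs' = xs' @ [v', z']" by (metis snoc2E)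
    have l: "length xs = t" "length xs' = t" using xs zs zs' True by auto
    have c: "chain (adjacent G) (xs @ [v])" "chain (adjacent G) (xs' @ [v'])"
      using chain_butlast[OF zs(1)] chain_butlast[OF zs'(1)] xs by (auto simp: butlast_append)
    obtain f where f: "f \<in> auts" "map f (xs @ [v]) = xs' @ [v']"
      using arc_trans[OF c] l by auto
    have gt: "g - t \<ge> 1" "t < g" using tg t2 g3 by auto
    obtain ys where ys: "chain (adjacent G) ys" "length ys = Suc (g - t)" "hd ys = hd (xs @ [v])" "last ys = v"
      using closing[OF c(1)] l by auto
    have fy: "chain (adjacent G) (map f ys)" "length (map f ys) = Suc (g - t)" "hd (map f ys) = hd (xs' @ [v'])" "last (map f ys) = v'"
    proof -
      have "ys \<noteq> []" using ys by auto
      show "chain (adjacent G) (map f ys)" using auts_chain f ys by blast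
      have "f (hd (xs @ [v])) = hd (map f (xs @ [v]))" by (rule hd_map[symmetric]) simp
      then show "hd (map f ys) = hd (xs' @ [v'])" using ys(3) \<open>ys \<noteq> []\<close> f by (simp add: hd_map)
      show "last (map f ys) = v'" using ys(4) \<open>ys \<noteq> []\<close> f by (simp add: last_map)
    qed (use ys in simp)
    have z: "z \<noteq> ys ! (g - t - 1)" "z' \<noteq> map f ys ! (g - t - 1)"
      using edges_tail(2)[of xs v z ys] edges_tail(2)[of xs' v' z' "map f ys"] zs zs' xs l es es' ys fy True by auto
    have ends: "ys ! (g - t - 1) \<noteq> (xs @ [v]) ! (t - 1)"
      by (rule closing_ends[OF c(1)]) (use l ys in auto)
    obtain xs1 p where p: "xs = xs1 @ [p]" using l t2 by (metis append_butlast_last_id length_0_conv not_numeral_le_zero)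
    obtain xs1' p' where p': "xs' = xs1' @ [p']" using l t2 by (metis append_butlast_last_id length_0_conv not_numeral_le_zero)
    have pp: "f p = p'" "f v = v'" using f(2) p p' by auto
    have nth: "(xs @ [v]) ! (t - 1) = p" using l p by (auto simp: nth_append)
    let ?q = "ys ! (g - t - 1)"
    have "2 \<le> length ys" using ys(2) gt by simp
    then obtain vs q v'' where vs: "ys = vs @ [q, v'']" by (rule snoc2E)
    have q: "?q = q" "v'' = v" using vs ys by (auto simp: nth_append)
    have vq: "adjacent G v q" using ys(1) vs q adj_sym by (metis chain.simps(3) chain_append)
    have vp: "adjacent G v p" and vz: "adjacent G v z" "z \<noteq> p"
      using zs(1) xs p adj_sym by (auto simp: chain_snoc) (metis chain.simps(3) chain_append)
    have vp': "adjacent G v' p'" and vz': "adjacent G v' z'" "z' \<noteq> p'"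
      using zs'(1) xs p' adj_sym by (auto simp: chain_snoc) (metis chain.simps(3) chain_append)
    have "z = third v p q" using vp vq vz z ends nth q by (intro third_unique) auto
    then have "f z = third v' p' (f q)" using auts_third[OF f(1) vp vq] ends nth q pp by simp
    moreover have "z' = third v' p' (f q)"
    proof (rule third_unique)
      show "adjacent G v' (f q)" using vq f pp auts_E by metis
      show "p' \<noteq> f q" using ends nth q pp auts_eq[OF f(1)] by metis
      show "z' \<noteq> f q" using z(2) q(1) ys(2) by simp
    qed (use vp' vz' in auto)
    ultimately have "map f zs = zs'" using f(2) xs by simp
    with f(1) show ?thesis by blast
  qed
  then obtain f where f: "f \<in> auts" "map f zs = zs'" by blast
  then have "graph_iso ((`) f) (line_graph G) (line_graph G)"
    using line_graph_iso[OF simple simple] auts_graph_iso cubic_graph_axioms by blast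
  then show "\<exists>f\<in>graph_auts (line_graph G). map f es = es'"
    using f zs(3) zs'(3) map_edges_of[of f zs] unfolding graph_auts_def by blast
qed

lemma cubic_G: "cubic G"
proof -
  have "{u \<in> gverts G. adjacent G v u} = {u. adjacent G v u}" for v using E_in2 by blast
  then show ?thesis using deg by (simp add: regular_graph_def valency_def)
qed

text \<open>Distances are less than \<open>t\<close>, so a shortest path extends to a
  \<open>t\<close>-arc and occupies the same positions in it for all pairs at that distance.\<close>

lemma distance_transitive_G: "distance_transitive G"
  unfolding distance_transitive_def aut_transitive_on_def
proof (intro allI impI ballI)
  fix k xs ys
  have chain: "\<exists>zs. chain (adjacent G) zs \<and> length zs = Suc t \<and> zs ! 0 = u \<and> zs ! k = v \<and> k < t"
    if uv: "u \<in> gverts G" "v \<in> gverts G" "gdist G u v = enat k" for u v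
  proof -
    obtain ws where ws: "ws \<in> walks G k" "hd ws = u" "last ws = v" using gdist_walk[OF uv(3)] .
    have "ws \<in> geodesics G k" using ws uv(3) by (simp add: geodesics_def)
    then have cw: "chain (adjacent G) ws" by (rule geodesic_chain)
    have len: "length ws = Suc k" using ws by (simp add: walks_iff)
    obtain us where us: "chain (adjacent G) us" "us \<noteq> []" "length us \<le> t" "hd us = u" "last us = v"
      using ex_short_chain \<open>u \<in> gverts G\<close> \<open>v \<in> gverts G\<close> by blast
    have "us \<in> walks G (length us - 1)"
    proof -
      have "set us \<subseteq> gverts G"
      proof (cases "2 \<le> length us")
        case True
        then show ?thesis using chain_in_V us by blast
      next
        case False
        then show ?thesis using us \<open>u \<in> gverts G\<close> by (cases us; cases "tl us") auto
      qed
      then show ?thesis using us chain_successively by (auto simp: walks_iff)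
    qed
    then have "k \<le> length us - 1" using gdist_le us \<open>gdist G u v = enat k\<close> by (metis enat_ord_simps(1))
    then have "k < t" using us t2 by simp
    have nth: "ws ! 0 = u" "ws ! k = v" using ws len by (auto simp: hd_conv_nth last_conv_nth simp flip: length_greater_0_conv)
    show ?thesis
    proof (cases "k = 0")
      case True
      obtain w where "adjacent G u w" using ex_nbr2[OF \<open>u \<in> gverts G\<close>] by metis
      then have "chain (adjacent G) [u, w]" by simp
      then obtain zs where "chain (adjacent G) ([u, w] @ zs)" "length ([u, w] @ zs) = Suc t"
        using chain_extend_to[of "[u, w]" "Suc t"] t2 by auto
      then show ?thesis using \<open>k < t\<close> nth True by (intro exI[of _ "[u, w] @ zs"]) auto
    next
      case False
      then obtain zs where "chain (adjacent G) (ws @ zs)" "length (ws @ zs) = Suc t"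
        using chain_extend_to[OF cw, of "Suc t"] len \<open>k < t\<close> by auto
      then show ?thesis using \<open>k < t\<close> nth len by (intro exI[of _ "ws @ zs"]) (auto simp: nth_append)
    qed
  qed
  assume "xs \<in> {[u, v] |u v. u \<in> gverts G \<and> v \<in> gverts G \<and> gdist G u v = enat k}"
  then obtain u v where uv: "xs = [u, v]" "u \<in> gverts G" "v \<in> gverts G" "gdist G u v = enat k" by blast
  assume "ys \<in> {[u, v] |u v. u \<in> gverts G \<and> v \<in> gverts G \<and> gdist G u v = enat k}"
  then obtain u' v' where uv': "ys = [u', v']" "u' \<in> gverts G" "v' \<in> gverts G" "gdist G u' v' = enat k" by blast
  obtain zs where zs: "chain (adjacent G) zs" "length zs = Suc t" "zs ! 0 = u" "zs ! k = v" and "k < t" using chain[OF uv(2-)] by blast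
  obtain zs' where zs': "chain (adjacent G) zs'" "length zs' = Suc t" "zs' ! 0 = u'" "zs' ! k = v'" using chain[OF uv'(2-)] by blast
  obtain f where f: "f \<in> auts" "map f zs = zs'" using arc_trans[OF zs(1) zs'(1) zs(2) zs'(2)] by blast
  then have "f u = u'" "f v = v'" using zs zs' \<open>k < t\<close> by (metis less_SucI nth_map zero_less_Suc)+
  moreover have "f \<in> graph_auts G" using auts_graph_iso[OF cubic_graph_axioms f(1)] by (simp add: graph_auts_def)
  ultimately show "\<exists>f\<in>graph_auts G. map f xs = ys" using uv(1) uv'(1) by auto
qed

end

section \<open>Automorphisms of the line graph of a triangle-free cubic graph\<close>

lemma chain_appendD: "chain E (xs @ ys) \<Longrightarrow> chain E xs \<and> chain E ys"
proof
  assume c: "chain E (xs @ ys)"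
  show "chain E xs" using c unfolding chain_nth
    by (metis Suc_lessD add_lessD1 length_append nth_append trans_less_add1)
  show "chain E ys" using c
    by (induction xs) (auto dest: chain_tl)
qed

text \<open>Two edges fix the direction of travel, the first vertex being the one not shared. A
  single edge does not, hence at least three vertices.\<close>

lemma edges_of_inj:
  assumes irr: "\<And>x. \<not> E x x"
  shows "chain E xs \<Longrightarrow> chain E ys \<Longrightarrow> 3 \<le> length xs \<Longrightarrow> edges_of xs = edges_of ys \<Longrightarrow> xs = ys"
proof (induction xs arbitrary: ys rule: chain_induct)
  case (triple x y z zs)
  have "length ys = length (x # y # z # zs)"
    using arg_cong[OF triple.prems(4), of length] by (simp add: length_edges_of)
  then obtain x' y' z' zs' where ys: "ys = x' # y' # z' # zs'" "length zs' = length zs"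
    by (auto simp: length_Suc_conv)
  have e: "{x, y} = {x', y'}" "{y, z} = {y', z'}" "edges_of (y # z # zs) = edges_of (y' # z' # zs')"
    using triple.prems(4) ys by auto
  have "x \<noteq> z" "x' \<noteq> z'" "E x y" "chain E (y # z # zs)" "chain E (y' # z' # zs')"
    using triple.prems ys by auto
  moreover have "x \<noteq> y" using \<open>E x y\<close> irr by blast
  moreover have "y \<noteq> z" using \<open>chain E (y # z # zs)\<close> chain_Cons irr by metis
  ultimately have xyz: "x = x'" "y = y'" "z = z'" using e by (auto simp: doubleton_eq_iff)
  show ?case
  proof (cases zs)
    case Nil
    then show ?thesis using ys xyz by simp
  next
    case (Cons w ws)
    then have "y # z # zs = y' # z' # zs'"
      using triple.IH[of "y' # z' # zs'"] e(3) \<open>chain E (y # z # zs)\<close> \<open>chain E (y' # z' # zs')\<close> by simp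
    then show ?thesis using ys xyz by simp
  qed
qed auto

locale triangle_free_cubic =
  fixes G :: "'a ugraph"
  assumes simple: "simple_graph G" and cubic: "cubic_graph (gverts G) (adjacent G)"
    and triangle_free: "adjacent G a b \<Longrightarrow> adjacent G b c \<Longrightarrow> \<not> adjacent G a c"
begin

sublocale cubic_graph "gverts G" "adjacent G" by (rule cubic)

definition star :: "'a \<Rightarrow> 'a set set" where
  "star v = {e \<in> gedges G. v \<in> e}"

lemma star_eq: "star v = (\<lambda>w. {v, w}) ` {w. adjacent G v w}"
proof
  show "star v \<subseteq> (\<lambda>w. {v, w}) ` {w. adjacent G v w}"
  proof
    fix e assume "e \<in> star v"
    then show "e \<in> (\<lambda>w. {v, w}) ` {w. adjacent G v w}"
      using edge_cases[OF simple, of e v] by (auto simp: star_def)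
  qed
qed (auto simp: star_def adjacent_def)

lemma card_star: "v \<in> gverts G \<Longrightarrow> card (star v) = 3"
proof -
  assume v: "v \<in> gverts G"
  have "inj_on (\<lambda>w. {v, w}) {w. adjacent G v w}" by (auto simp: inj_on_def doubleton_eq_iff)
  then show ?thesis using deg[OF v] by (simp add: star_eq card_image)
qed

text \<open>Three edges meeting pairwise but not in one vertex would form a triangle.\<close>

lemma common_vertex:
  assumes "e1 \<in> gedges G" "e2 \<in> gedges G" "e3 \<in> gedges G" "e1 \<noteq> e2" "e1 \<noteq> e3" "e2 \<noteq> e3"
    and "e1 \<inter> e2 \<noteq> {}" "e1 \<inter> e3 \<noteq> {}" "e2 \<inter> e3 \<noteq> {}"
  shows "\<exists>v. v \<in> e1 \<and> v \<in> e2 \<and> v \<in> e3"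
proof -
  obtain a where a: "a \<in> e1" "a \<in> e2" using assms by blast
  obtain b where b: "e1 = {a, b}" "adjacent G a b" using edge_cases[OF simple assms(1) a(1)] by metis
  obtain c where c: "e2 = {a, c}" "adjacent G a c" using edge_cases[OF simple assms(2) a(2)] by metis
  show ?thesis
  proof (rule ccontr)
    assume no: "\<not> ?thesis"
    then have "a \<notin> e3" using a by blast
    then have "b \<in> e3" "c \<in> e3" using assms b c by auto
    moreover have "b \<noteq> c" using assms(4) b c by auto
    ultimately have "e3 = {b, c}" using edge_cases[OF simple assms(3) \<open>b \<in> e3\<close>] by (metis insert_iff singletonD)
    then have "adjacent G b c" using assms(3) by (simp add: adjacent_def)
    then show False using triangle_free[OF b(2)] c(2) by blast
  qed
qed

text \<open>Without triangles in \<open>G\<close>, the triangles of the line graph are exactly the stars, so its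
  automorphisms act on the vertices of \<open>G\<close>.\<close>

lemma whitney:
  assumes \<phi>: "\<phi> \<in> graph_auts (line_graph G)"
  obtains f where "f \<in> auts" "\<And>u v. adjacent G u v \<Longrightarrow> \<phi> {u, v} = {f u, f v}"
proof -
  have bij: "bij_betw \<phi> (gedges G) (gedges G)"
    and adj: "\<And>e e'. e \<in> gedges G \<Longrightarrow> e' \<in> gedges G \<Longrightarrow> adjacent (line_graph G) e e' \<longleftrightarrow> adjacent (line_graph G) (\<phi> e) (\<phi> e')"
    using \<phi> by (auto simp: graph_auts_def graph_iso_def gverts_line_graph)
  have inj: "\<phi> e = \<phi> e' \<longleftrightarrow> e = e'" if "e \<in> gedges G" "e' \<in> gedges G" for e e'
    using bij that by (meson bij_betw_imp_inj_on inj_on_eq_iff)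
  have im: "\<phi> e \<in> gedges G" if "e \<in> gedges G" for e using bij that by (auto simp: bij_betw_def)
  have star_im: "\<exists>v'. v' \<in> gverts G \<and> \<phi> ` star v = star v'" if v: "v \<in> gverts G" for v
  proof -
    obtain e1 e2 e3 where e: "star v = {e1, e2, e3}" "e1 \<noteq> e2" "e1 \<noteq> e3" "e2 \<noteq> e3"
      using card_star[OF v] by (auto simp: card_3_iff)
    then have E: "e1 \<in> gedges G" "e2 \<in> gedges G" "e3 \<in> gedges G" "v \<in> e1" "v \<in> e2" "v \<in> e3"
      unfolding star_def by blast+
    have meet: "\<phi> e \<inter> \<phi> e' \<noteq> {}" if "e \<in> gedges G" "e' \<in> gedges G" "v \<in> e" "v \<in> e'" "e \<noteq> e'" for e e'
      using adj[OF that(1,2)] that by (auto simp: adjacent_line_graph)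
    obtain v' where v': "v' \<in> \<phi> e1" "v' \<in> \<phi> e2" "v' \<in> \<phi> e3"
      using common_vertex[of "\<phi> e1" "\<phi> e2" "\<phi> e3"] E e meet im inj by metis
    have "v' \<in> gverts G" using v'(1) im[OF E(1)] simple by (auto simp: simple_graph_def)
    have "\<phi> ` star v = star v'"
    proof (rule card_subset_eq)
      show "finite (star v')" using card_star[OF \<open>v' \<in> gverts G\<close>] by (intro card_ge_0_finite) simp
      show "\<phi> ` star v \<subseteq> star v'" using e v' E im by (auto simp: star_def)
      have "inj_on \<phi> (star v)" using bij by (auto simp: bij_betw_def star_def intro: inj_on_subset)
      then show "card (\<phi> ` star v) = card (star v')"
        using card_star[OF v] card_star[OF \<open>v' \<in> gverts G\<close>] by (simp add: card_image)
    qed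
    with \<open>v' \<in> gverts G\<close> show ?thesis by blast
  qed
  define f where "f v = (if v \<in> gverts G then SOME v'. v' \<in> gverts G \<and> \<phi> ` star v = star v' else v)" for v
  have f: "f v \<in> gverts G" "\<phi> ` star v = star (f v)" if "v \<in> gverts G" for v
    using someI_ex[OF star_im[OF that]] that by (simp_all add: f_def)
  have star_inj: "u = v" if "u \<in> gverts G" "v \<in> gverts G" "star u = star v" for u v
  proof (rule ccontr)
    assume "u \<noteq> v"
    have "e = {u, v}" if "e \<in> star u" for e
    proof -
      have "e \<in> gedges G" "u \<in> e" "v \<in> e" using that \<open>star u = star v\<close> unfolding star_def by blast+
      then show ?thesis using edge_cases[OF simple, of e u] \<open>u \<noteq> v\<close> by (metis insert_iff singletonD)
    qed
    then have "star u \<subseteq> {{u, v}}" by blast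
    then have "card (star u) \<le> 1" by (metis card.empty card_insert_disjoint card_mono empty_iff finite.emptyI finite.insertI One_nat_def)
    then show False using card_star that by simp
  qed
  have f_inj: "u = v" if "u \<in> gverts G" "v \<in> gverts G" "f u = f v" for u v
  proof -
    have "\<phi> ` star u = \<phi> ` star v" using f that by simp
    moreover have "star u \<subseteq> gedges G" "star v \<subseteq> gedges G" by (auto simp: star_def)
    ultimately have "star u = star v" using bij by (metis bij_betw_imp_inj_on inj_on_image_eq_iff)
    then show ?thesis using star_inj that by blast
  qed
  have edge: "\<phi> {u, v} = {f u, f v}" if uv: "adjacent G u v" for u v
  proof -
    have V: "u \<in> gverts G" "v \<in> gverts G" "u \<noteq> v" using simple_graph_adjacent[OF simple uv] by auto
    have "{u, v} \<in> star u" "{u, v} \<in> star v" using uv by (auto simp: star_def adjacent_def)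
    then have "\<phi> {u, v} \<in> star (f u)" "\<phi> {u, v} \<in> star (f v)" using f V by blast+
    then have "f u \<in> \<phi> {u, v}" "f v \<in> \<phi> {u, v}" "\<phi> {u, v} \<in> gedges G" by (auto simp: star_def)
    moreover have "f u \<noteq> f v" using f_inj V by blast
    ultimately show ?thesis using edge_cases[OF simple, of "\<phi> {u, v}" "f u"] by (metis insert_iff singletonD)
  qed
  have E1: "adjacent G (f u) (f v)" if "adjacent G u v" for u v
  proof -
    have "\<phi> {u, v} \<in> gedges G" using im that by (simp add: adjacent_def)
    then show ?thesis using edge[OF that] by (simp add: adjacent_def)
  qed
  have inj_f: "inj_on f (gverts G)" using f_inj by (rule inj_onI)
  have E2: "adjacent G u v" if "u \<in> gverts G" "v \<in> gverts G" "adjacent G (f u) (f v)" for u v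
  proof -
    \<comment> \<open>\<open>f\<close> maps three neighbours injectively into three neighbours,
      hence onto them, so adjacency is reflected.\<close>
    have "f ` {w. adjacent G u w} = {w. adjacent G (f u) w}"
    proof (rule card_subset_eq)
      show "finite {w. adjacent G (f u) w}" using deg[OF f(1)[OF that(1)]] by (intro card_ge_0_finite) simp
      show "f ` {w. adjacent G u w} \<subseteq> {w. adjacent G (f u) w}" using E1 by blast
      have "inj_on f {w. adjacent G u w}" by (rule inj_on_subset[OF inj_f]) (use E_in2 in blast)
      then show "card (f ` {w. adjacent G u w}) = card {w. adjacent G (f u) w}"
        using deg[OF f(1)[OF that(1)]] deg[OF that(1)] by (simp add: card_image)
    qed
    then have "f v \<in> f ` {w. adjacent G u w}" using that(3) by simp
    then obtain w where "adjacent G u w" "f v = f w" by blast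
    then show ?thesis using f_inj[OF that(2), of w] E_in2 by blast
  qed
  have f_out: "f v = v" if "v \<notin> gverts G" for v using that by (simp add: f_def)
  have fV: "f v \<in> gverts G \<longleftrightarrow> v \<in> gverts G" for v using f(1)[of v] f_out[of v] by metis
  have "f ` gverts G = gverts G" using inj_f f(1) fin by (intro endo_inj_surj) auto
  then have 1: "bij_betw f (gverts G) (gverts G)" using inj_f by (simp add: bij_betw_def)
  have 2: "bij_betw f (- gverts G) (- gverts G)"
    by (subst bij_betw_cong[of "- gverts G" f id]) (simp_all add: f_out)
  have "bij_betw f (gverts G \<union> - gverts G) (gverts G \<union> - gverts G)" using bij_betw_combine[OF 1 2] by blast
  then have "bij f" by simp
  moreover have "adjacent G (f u) (f v) \<longleftrightarrow> adjacent G u v" for u v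
    using E1 E2 fV E_in E_in2 by metis
  ultimately have "f \<in> auts" by (simp add: auts_def f_out)
  with edge that show ?thesis by blast
qed

text \<open>\<open>whitney\<close> replaces the automorphism of the line graph by one of
  \<open>G\<close>, and \<open>edges_of_inj\<close> recovers vertices from edges;
  \<open>1 \<le> k\<close> provides the two edges this needs.\<close>

lemma arcs_transitive_of_geodesics:
  assumes "aut_transitive_on (line_graph G) (geodesics (line_graph G) k)" "1 \<le> k"
    and xs: "chain (adjacent G) xs" "length xs = k + 2" "edges_of xs \<in> geodesics (line_graph G) k"
    and ys: "chain (adjacent G) ys" "length ys = k + 2" "edges_of ys \<in> geodesics (line_graph G) k"
  shows "\<exists>f\<in>auts. map f xs = ys"
proof -
  obtain \<phi> where \<phi>: "\<phi> \<in> graph_auts (line_graph G)" "map \<phi> (edges_of xs) = edges_of ys"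
    using assms unfolding aut_transitive_on_def by blast
  obtain f where f: "f \<in> auts" "\<And>u v. adjacent G u v \<Longrightarrow> \<phi> {u, v} = {f u, f v}" using whitney[OF \<phi>(1)] by blast
  have "map \<phi> (edges_of zs) = edges_of (map f zs)" if "chain (adjacent G) zs" for zs
    using that
  proof (induction zs rule: chain_induct)
    case (triple x y z zs)
    then show ?case using f(2)[of x y] by simp
  qed (use f(2) in auto)
  then have "edges_of (map f xs) = edges_of ys" using xs(1) \<phi>(2) by simp
  moreover have "chain (adjacent G) (map f xs)" using auts_chain f(1) xs(1) by blast
  ultimately have "map f xs = ys"
    using edges_of_inj[of "adjacent G" "map f xs" ys] irrefl xs ys assms(2) by simp
  with f(1) show ?thesis by blast
qed

end

section \<open>Shortest closed walks, and arcs short enough to give geodesics\<close>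

lemma (in cubic_graph) ex_closed_chain: "\<exists>xs. chain E xs \<and> 2 \<le> length xs \<and> hd xs = last xs"
proof -
  obtain x y where xy: "E x y" using ne ex_nbr2 by (metis ex_in_conv)
  obtain ys where ys: "chain E ([x, y] @ ys)" "length ([x, y] @ ys) = card V + 2"
    using chain_extend_to[of "[x, y]" "card V + 2"] xy by auto
  let ?zs = "[x, y] @ ys"
  have "card (set ?zs) \<le> card V" using chain_in_V[OF ys(1)] fin by (intro card_mono) auto
  then have "\<not> distinct ?zs" using ys(2) distinct_card[of ?zs] by linarith
  then obtain as bs cs a where "?zs = as @ [a] @ bs @ [a] @ cs" using not_distinct_decomp by metis
  then have "chain E (as @ (a # bs @ [a]) @ cs)" using ys(1) by simp
  then have "chain E (a # bs @ [a])" using chain_appendD by metis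
  then show ?thesis by (intro exI[of _ "a # bs @ [a]"]) auto
qed

lemma (in cubic_graph) girth_chain:
  obtains g cs where "3 \<le> g" "girth_ge E g" "chain E cs" "length cs = Suc g" "hd cs = last cs"
proof -
  define P where "P n \<longleftrightarrow> (\<exists>xs. chain E xs \<and> 2 \<le> length xs \<and> hd xs = last xs \<and> length xs = n)" for n
  have "P (LEAST n. P n)" using ex_closed_chain by (metis LeastI P_def)
  then obtain cs where cs: "chain E cs" "2 \<le> length cs" "hd cs = last cs" "length cs = (LEAST n. P n)"
    unfolding P_def by blast
  have least: "length cs \<le> length xs" if "chain E xs" "2 \<le> length xs" "hd xs = last xs" for xs
    unfolding cs(4) by (rule Least_le) (use that P_def in blast)
  have "4 \<le> length cs"
  proof (rule ccontr)
    assume "\<not> 4 \<le> length cs"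
    then have "length cs = 2 \<or> length cs = 3" using cs(2) by auto
    then show False using cs irrefl by (auto simp: numeral_2_eq_2 numeral_3_eq_3 length_Suc_conv)
  qed
  then show ?thesis
    using that[of "length cs - 1" cs] cs least by (fastforce simp: girth_ge_def)
qed

text \<open>A shorter route would give a walk in \<open>G\<close> with at most \<open>t\<close>
  vertices and the same end edges, possibly traversed the other way. Trimming the ends to match
  yields two walks with common ends and fewer than \<open>g\<close> edges together, equal by
  uniqueness but of different lengths.\<close>

lemma (in triangle_free_cubic) geodesic_of_short_chain:
  assumes g: "girth_ge (adjacent G) g" "3 \<le> g" and t: "2 \<le> t" "2 * t \<le> g + 2" and xs: "chain (adjacent G) xs" "length xs = Suc t"
  shows "edges_of xs \<in> geodesics (line_graph G) (t - 1)"
  unfolding geodesics_iff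
proof (intro conjI allI impI)
  have uniq: "xs = ys" if "chain (adjacent G) xs" "chain (adjacent G) ys" "xs \<noteq> []" "ys \<noteq> []" "hd xs = hd ys" "last xs = last ys"
    "length xs + length ys < g + 2" for xs ys
    using chain_unique[OF adj_sym g(1)] that by blast
  show "edges_of xs \<in> walks (line_graph G) (t - 1)" using chain_walk_line_graph[OF simple xs(1)] xs(2) t by simp
  fix es k assume es: "es \<in> walks (line_graph G) k" "hd es = hd (edges_of xs)" "last es = last (edges_of xs)"
  show "t - 1 \<le> k"
  proof (rule ccontr)
    assume "\<not> t - 1 \<le> k"
    from walk_line_graph_chain[OF simple es(1)] obtain zs where zs: "chain (adjacent G) zs" "2 \<le> length zs" "length zs \<le> k + 2"
      "hd (edges_of zs) = hd es" "last (edges_of zs) = last es" by blast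
    have lz: "length zs \<le> t" using zs(3) \<open>\<not> t - 1 \<le> k\<close> by simp
    have lx: "2 \<le> length xs" using xs t by simp
    obtain ys p q where p: "xs = ys @ [p, q]" using lx by (rule snoc2E)
    obtain ys' p' q' where p': "zs = ys' @ [p', q']" using zs(2) by (rule snoc2E)
    obtain a b us where a: "xs = a # b # us" using lx by (cases xs; cases "tl xs") auto
    obtain a' b' us' where a': "zs = a' # b' # us'" using zs(2) by (cases zs; cases "tl zs") auto
    have ab: "{a, b} = {a', b'}" using es(2) zs(4) a a' by simp
    have pq: "{p, q} = {p', q'}" using es(3) zs(5) p p' by (simp add: edges_of_snoc)
    have tg: "t + 1 \<le> g" using t g(2) by linarith
    have len_ys: "length ys = t - 1" using p xs(2) by simp
    show False
    proof (cases "length zs = 2")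
      case True
      \<comment> \<open>First and last edge coincide, so the arc, perhaps without its last vertex,
        is closed and too short for the girth.\<close>
      then have "p' = a'" "q' = b'" using p' a' by (auto simp: numeral_2_eq_2 length_Suc_conv)
      then have "a = p \<or> a = q" using ab pq by blast
      then show False
      proof
        assume "a = p"
        moreover have c: "chain (adjacent G) (ys @ [p])" using chain_butlast[OF xs(1)] p by (simp add: butlast_append)
        moreover have "hd (ys @ [p]) = a" using p a len_ys t by (cases ys) auto
        ultimately have "g < length (ys @ [p])" using g(1) len_ys t unfolding girth_ge_def by fastforce
        then show False using len_ys tg by simp
      next
        assume "a = q"
        then have "hd xs = last xs" using p a by (metis last_snoc append.assoc append_Cons append_Nil list.sel(1))
        then have "g < length xs" using g(1) xs(1) lx unfolding girth_ge_def by blast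
        then show False using xs(2) tg by simp
      qed
    next
      case False
      \<comment> \<open>\<open>S'\<close> loses both end vertices of \<open>zs\<close>. The arc
        loses an end vertex in \<open>T\<close> or \<open>S\<close> exactly where both walks
        traverse the end edge in the same direction.\<close>
      define S' where "S' = tl (butlast zs)"
      define T where "T = (if p' = p then butlast xs else xs)"
      define S where "S = (if b' = b then tl T else T)"
      have "zs \<noteq> []" "3 \<le> length zs" using False zs(2) by auto
      have cS': "chain (adjacent G) S'" using zs(1) chain_butlast chain_tl by (auto simp: S'_def)
      have cS: "chain (adjacent G) S" using xs(1) chain_butlast chain_tl by (auto simp: S_def T_def)
      have lS': "length S' \<le> t - 2" "S' \<noteq> []" using lz \<open>3 \<le> length zs\<close> by (auto simp: S'_def simp flip: length_greater_0_conv)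
      have lT: "t \<le> length T" "length T \<le> t + 1" using xs(2) by (auto simp: T_def)
      have lS: "t - 1 \<le> length S" "length S \<le> t + 1" using lT by (auto simp: S_def)
      have "S \<noteq> []" using lS t by auto
      have hT: "hd T = a" "hd (tl T) = b" if "3 \<le> length xs"
        using a that by (auto simp: T_def)
      have "3 \<le> length xs" using xs(2) t by simp
      have bb: "b' = b \<or> b' = a" using ab by blast
      have pp: "p' = p \<or> p' = q" using pq by blast
      have "hd S = b'" using hT[OF \<open>3 \<le> length xs\<close>] bb by (auto simp: S_def)
      moreover have "hd S' = b'" using a' \<open>3 \<le> length zs\<close> by (cases us') (auto simp: S'_def)
      moreover have "last T = p'" using p pp by (auto simp: T_def butlast_append)
      then have "last S = p'" using lT t by (cases T) (auto simp: S_def)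
      moreover have "last S' = p'"
      proof -
        have "butlast zs = ys' @ [p']" using p' by (simp add: butlast_append)
        moreover have "ys' \<noteq> []" using p' \<open>3 \<le> length zs\<close> by auto
        ultimately show ?thesis by (cases ys') (auto simp: S'_def)
      qed
      moreover have "length S + length S' < g + 2" using lS lS' t by linarith
      ultimately have "S = S'" using cS cS' \<open>S \<noteq> []\<close> lS'(2) by (intro uniq) auto
      then show False using lS lS' t by simp
    qed
  qed
qed

text \<open>Asking for a geodesic \<open>es\<close> of length \<open>k\<close> restricts the
  hypothesis to lengths up to the diameter.\<close>

lemma (in triangle_free_cubic) geodesic_transitive_cage:
  assumes trans: "\<And>k es. 1 \<le> k \<Longrightarrow> es \<in> geodesics (line_graph G) k \<Longrightarrow>
    aut_transitive_on (line_graph G) (geodesics (line_graph G) k)"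
  obtains t g where "arc_transitive_cage (gverts G) (adjacent G) t g"
proof -
  obtain g cs where g: "3 \<le> g" "girth_ge (adjacent G) g" and cs: "chain (adjacent G) cs" "length cs = Suc g" "hd cs = last cs"
    by (rule girth_chain)
  define t where "t = g div 2 + 1"
  have t: "2 \<le> t" "2 * t \<le> g + 2" "g + 2 = 2 * t \<or> g + 1 = 2 * t" "t \<le> g" using g(1) by (auto simp: t_def)
  have geo: "edges_of xs \<in> geodesics (line_graph G) (t - 1)" if "chain (adjacent G) xs" "length xs = Suc t" for xs
    using geodesic_of_short_chain[OF g(2,1) t(1,2) that] .
  have arc: "\<exists>f\<in>auts. map f xs = ys"
    if xs: "chain (adjacent G) xs" "length xs = Suc t" and ys: "chain (adjacent G) ys" "length ys = Suc t" for xs ys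
  proof -
    have "1 \<le> t - 1" using t by simp
    then show ?thesis
      using arcs_transitive_of_geodesics[OF trans, of "t - 1" "edges_of xs" xs ys] geo[OF xs] geo[OF ys] xs ys t by auto
  qed
  have closing: "\<exists>ys. chain (adjacent G) ys \<and> length ys = Suc (g - t) \<and> hd ys = hd xs \<and> last ys = last xs"
    if xs: "chain (adjacent G) xs" "length xs = Suc t" for xs
  proof -
    \<comment> \<open>The shortest closed walk is cut at position \<open>t\<close>: its first part
      is a \<open>t\<close>-arc, and the rest read backwards closes that arc.\<close>
    define as where "as = take (Suc t) cs"
    define bs where "bs = rev (drop t cs)"
    have "chain (adjacent G) as" using cs(1) chain_appendD[of _ "take (Suc t) cs" "drop (Suc t) cs"] by (simp add: as_def)
    moreover have la: "length as = Suc t" using cs(2) t by (simp add: as_def)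
    ultimately obtain f where f: "f \<in> auts" "map f as = xs" using arc xs by blast
    have cb: "chain (adjacent G) bs" using cs(1) chain_appendD[of _ "take t cs" "drop t cs"] chain_rev' by (simp add: bs_def)
    have lb: "length bs = Suc (g - t)" using cs(2) t by (simp add: bs_def)
    have "hd bs = hd as"
      using cs t by (simp add: bs_def as_def hd_rev last_drop hd_take)
    moreover have "last bs = last as"
    proof -
      have "as \<noteq> []" using la by auto
      then have "last as = as ! t" using la by (simp add: last_conv_nth)
      then have "last as = cs ! t" by (simp add: as_def)
      moreover have "last bs = cs ! t" using cs(2) t by (simp add: bs_def last_rev hd_drop_conv_nth)
      ultimately show ?thesis by simp
    qed
    moreover have "as \<noteq> []" "bs \<noteq> []" using la lb by auto
    ultimately have "hd (map f bs) = hd xs" "last (map f bs) = last xs" using f(2) by (auto simp: hd_map last_map)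
    moreover have "chain (adjacent G) (map f bs)" using auts_chain f(1) cb by blast
    ultimately show ?thesis using lb by (intro exI[of _ "map f bs"]) auto
  qed
  have "arc_transitive_cage (gverts G) (adjacent G) t g"
    by unfold_locales (use t g arc closing in auto)
  with that show ?thesis by blast
qed

section \<open>Connectedness and cubic graphs in the vocabulary of the statement\<close>

lemma walks_rtranclp: "xs \<in> walks G s \<Longrightarrow> (adjacent G)\<^sup>*\<^sup>* (hd xs) (last xs)"
proof (induction s arbitrary: xs)
  case 0
  then show ?case by (auto simp: walks_iff length_Suc_conv)
next
  case (Suc s)
  then obtain ys y where ys: "xs = ys @ [y]" "ys \<noteq> []"
    by (auto simp: walks_iff length_Suc_conv_rev)
  with Suc.prems have "ys \<in> walks G s" "adjacent G (last ys) y" by (simp_all add: walks_snoc)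
  with Suc.IH ys show ?case by (auto intro: rtranclp.rtrancl_into_rtrancl)
qed

lemma connected_graph_iff:
  assumes "simple_graph G"
  shows "connected_graph G \<longleftrightarrow> gverts G \<noteq> {} \<and> (\<forall>u\<in>gverts G. \<forall>v\<in>gverts G. (adjacent G)\<^sup>*\<^sup>* u v)"
proof -
  have "\<exists>s. \<exists>xs\<in>walks G s. hd xs = u \<and> last xs = v" if "u \<in> gverts G" "(adjacent G)\<^sup>*\<^sup>* u v" for u v
    using that(2)
  proof (induction rule: rtranclp_induct)
    case base
    then show ?case using that(1) by (intro exI[of _ 0] bexI[of _ "[u]"]) (auto simp: walks_iff)
  next
    case (step v w)
    then obtain s xs where xs: "xs \<in> walks G s" "hd xs = u" "last xs = v" by blast
    then have "xs \<noteq> []" by (auto simp: walks_iff)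
    then have "xs @ [w] \<in> walks G (Suc s)"
      using xs step.hyps(2) simple_graph_adjacent[OF assms step.hyps(2)] by (simp add: walks_snoc)
    then show ?case using xs \<open>xs \<noteq> []\<close> by (intro exI[of _ "Suc s"] bexI[of _ "xs @ [w]"]) auto
  qed
  moreover have "(adjacent G)\<^sup>*\<^sup>* u v" if "\<exists>s. \<exists>xs\<in>walks G s. hd xs = u \<and> last xs = v" for u v
    using that walks_rtranclp by blast
  ultimately show ?thesis unfolding connected_graph_def by blast
qed

lemma neighbours_in:
  assumes "simple_graph G"
  shows "{u \<in> gverts G. adjacent G v u} = {u. adjacent G v u}"
  using simple_graph_adjacent(2)[OF assms] by blast

lemma cubic_graphI:
  assumes "simple_graph G" "connected_graph G" "cubic G"
  shows "cubic_graph (gverts G) (adjacent G)"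
proof
  show "finite (gverts G)" using assms(1) by (simp add: simple_graph_def)
  show "gverts G \<noteq> {}" using assms(2) by (simp add: connected_graph_def)
  show "adjacent G x y \<Longrightarrow> x \<in> gverts G" for x y using simple_graph_adjacent[OF assms(1)] by blast
  show "adjacent G x y \<Longrightarrow> adjacent G y x" for x y by (simp add: adjacent_sym)
  show "\<not> adjacent G x x" for x using simple_graph_adjacent(3)[OF assms(1)] by blast
  show "card {y. adjacent G x y} = 3" if "x \<in> gverts G" for x
    using assms(3) that neighbours_in[OF assms(1)] by (simp add: regular_graph_def valency_def)
  show "(adjacent G)\<^sup>*\<^sup>* x y" if "x \<in> gverts G" "y \<in> gverts G" for x y
    using assms(2) that connected_graph_iff[OF assms(1)] by blast
qed

section \<open>Correspondence between the five named graphs and arc-transitive cages\<close>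

lemma geodesic_root_imp_cage:
  assumes S: "simple_graph S" "geodesic_root S"
  obtains t g where "transitive_cage_graph S t g"
proof -
  have iso: "cage (gverts S) (adjacent S) t g"
    if C: "graph_isomorphic S C" "cage (gverts C) (adjacent C) t g" for C :: "'c ugraph" and t g
  proof -
    obtain f where "graph_iso f C S" using graph_isomorphic_sym[OF C(1)] by (auto simp: graph_isomorphic_def)
    then show ?thesis
      using simple_graph_adjacent[OF S(1)]
      by (intro cage_iso[OF C(2), of f]) (auto simp: graph_iso_def)
  qed
  have "\<exists>t g. cage (gverts S) (adjacent S) t g \<and> g \<in> {3, 4, 5, 6, 8}"
    using S(2) iso[OF _ cage_K4] iso[OF _ cage_K33] iso[OF _ cage_petersen] iso[OF _ cage_heawood] iso[OF _ cage_tutte]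
    unfolding geodesic_root_def by blast
  then obtain t g where c: "cage (gverts S) (adjacent S) t g" "g \<in> {3, 4, 5, 6, 8}" by blast
  have "arc_transitive_cage (gverts S) (adjacent S) t g" by (rule cage.arc_transitive_cage[OF c])
  then show ?thesis using that S(1) by (simp add: transitive_cage_graph_def)
qed

lemma (in cage) ex_t_arc: "\<exists>xs. chain E xs \<and> length xs = Suc t"
proof -
  obtain x y where "E x y" using ne ex_nbr2 by (metis ex_in_conv)
  then have "chain E [x, y]" by simp
  then show ?thesis using chain_extend_to[of "[x, y]" "Suc t"] t2 by auto
qed

lemma cages_isomorphic:
  assumes G: "cage (gverts G) (adjacent G) t g" and H: "cage (gverts H) (adjacent H) t g" and g: "g \<in> {3, 4, 5, 6, 8}"
  shows "graph_isomorphic G H"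
proof -
  let ?N = "{..<length (template g)}"
  obtain f where f: "bij_betw f ?N (gverts G)"
    "\<And>x y. x \<in> ?N \<Longrightarrow> y \<in> ?N \<Longrightarrow> adjacent G (f x) (f y) \<longleftrightarrow> tadj (template g) x y"
    using cage.ex_t_arc[OF G] cage.ex_template_iso[OF G g] by (metis lessThan_iff)
  obtain h where h: "bij_betw h ?N (gverts H)"
    "\<And>x y. x \<in> ?N \<Longrightarrow> y \<in> ?N \<Longrightarrow> adjacent H (h x) (h y) \<longleftrightarrow> tadj (template g) x y"
    using cage.ex_t_arc[OF H] cage.ex_template_iso[OF H g] by (metis lessThan_iff)
  let ?i = "inv_into ?N f"
  have i: "bij_betw ?i (gverts G) ?N" using f(1) by (rule bij_betw_inv_into)
  have "adjacent G u v \<longleftrightarrow> adjacent H (h (?i u)) (h (?i v))" if "u \<in> gverts G" "v \<in> gverts G" for u v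
  proof -
    have "f (?i u) = u" "f (?i v) = v" using f(1) that by (auto simp: bij_betw_def f_inv_into_f)
    moreover have "?i u \<in> ?N" "?i v \<in> ?N" using i that by (auto simp: bij_betw_def)
    ultimately show ?thesis using f(2)[of "?i u" "?i v"] h(2)[of "?i u" "?i v"] by simp
  qed
  moreover have "bij_betw (h \<circ> ?i) (gverts G) (gverts H)" using i h(1) by (rule bij_betw_trans)
  ultimately show ?thesis unfolding graph_isomorphic_def graph_iso_def by (intro exI[of _ "h \<circ> ?i"]) simp
qed

text \<open>Each \<open>t\<close> from 2 to 5 admits one even and one odd \<open>g\<close>. Girth 2
  does not occur, and \<open>exceptional\<close> removes 7 and 9, which leaves five pairs, one per
  named graph.\<close>

lemma arc_transitive_cage_root:
  assumes "arc_transitive_cage (gverts S) (adjacent S) t g"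
  shows "geodesic_root S"
proof -
  interpret arc_transitive_cage "gverts S" "adjacent S" t g by fact
  have "t = 2 \<or> t = 3 \<or> t = 4 \<or> t = 5" using arc_transitivity_le_5 t2 by auto
  then have "t = 2 \<and> g = 3 \<or> t = 3 \<and> g = 4 \<or> t = 3 \<and> g = 5 \<or> t = 4 \<and> g = 6 \<or> t = 5 \<and> g = 8"
    using tg g3 exceptional by auto
  then show ?thesis
    using cages_isomorphic[OF cage_axioms, of "complete_graph 4"] cage_K4
      cages_isomorphic[OF cage_axioms, of "complete_multipartite 2 3"] cage_K33
      cages_isomorphic[OF cage_axioms, of petersen_graph] cage_petersen
      cages_isomorphic[OF cage_axioms, of heawood_graph] cage_heawood
      cages_isomorphic[OF cage_axioms, of tutte_8_cage] cage_tutte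
    unfolding geodesic_root_def by auto
qed

section \<open>The octahedron as the line graph of the complete graph on four vertices\<close>

lemma iso_of_lists:
  assumes L: "set L = gverts G" "distinct L" and M: "set M = gverts H" "distinct M" and len: "length L = length M"
    and adj: "\<And>i j. i < length L \<Longrightarrow> j < length L \<Longrightarrow> adjacent G (L ! i) (L ! j) \<longleftrightarrow> adjacent H (M ! i) (M ! j)"
  shows "graph_isomorphic G H"
proof -
  let ?N = "{..<length L}"
  have f: "bij_betw ((!) L) ?N (gverts G)" using L bij_betw_nth[of L ?N] by simp
  have h: "bij_betw ((!) M) ?N (gverts H)" using M len bij_betw_nth[of M ?N] by simp
  let ?i = "inv_into ?N ((!) L)"
  have i: "bij_betw ?i (gverts G) ?N" using f by (rule bij_betw_inv_into)
  have "adjacent G u v \<longleftrightarrow> adjacent H (M ! ?i u) (M ! ?i v)" if "u \<in> gverts G" "v \<in> gverts G" for u v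
  proof -
    have "L ! ?i u = u" "L ! ?i v = v" using f that by (auto simp: bij_betw_def f_inv_into_f)
    moreover have "?i u \<in> ?N" "?i v \<in> ?N" using i that by (auto simp: bij_betw_def)
    ultimately show ?thesis using adj[of "?i u" "?i v"] by simp
  qed
  moreover have "bij_betw ((!) M \<circ> ?i) (gverts G) (gverts H)" using i h by (rule bij_betw_trans)
  ultimately show ?thesis unfolding graph_isomorphic_def graph_iso_def by (intro exI[of _ "(!) M \<circ> ?i"]) simp
qed

abbreviation octahedron_labels :: "(nat \<times> nat) list" where
  "octahedron_labels \<equiv> [(0, 0), (0, 1), (1, 0), (1, 1), (2, 0), (2, 1)]"

lemma octahedron_verts: "set octahedron_labels = gverts (complete_multipartite 3 2)"
  by (auto simp: complete_multipartite_def gverts_graph_of)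

lemma octahedron_adjacent: "adjacent (complete_multipartite 3 2) x y \<longleftrightarrow>
    x \<in> gverts (complete_multipartite 3 2) \<and> y \<in> gverts (complete_multipartite 3 2) \<and> fst x \<noteq> fst y"
  unfolding complete_multipartite_def gverts_graph_of by (subst adjacent_graph_of) auto

text \<open>Antipodal vertices stand next to each other in the list, so \<open>i div 2\<close> is
  the part containing entry \<open>i\<close>.\<close>

lemma octahedronI:
  assumes "set [v, v', p, p', q, q'] = gverts G" "distinct [v, v', p, p', q, q']"
    and "\<And>i j. i < 6 \<Longrightarrow> j < 6 \<Longrightarrow> adjacent G ([v, v', p, p', q, q'] ! i) ([v, v', p, p', q, q'] ! j) \<longleftrightarrow> i div 2 \<noteq> j div 2"
  shows "graph_isomorphic G (complete_multipartite 3 2)"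
proof (rule iso_of_lists[OF assms(1,2) octahedron_verts])
  fix i j assume ij: "i < length [v, v', p, p', q, q']" "j < length [v, v', p, p', q, q']"
  have "octahedron_labels ! k \<in> gverts (complete_multipartite 3 2) \<and> fst (octahedron_labels ! k) = k div 2" if "k < 6" for k
  proof -
    have "k \<in> {0, 1, 2, 3, 4, 5}" using that by auto
    then have "fst (octahedron_labels ! k) = k div 2" by auto
    moreover have "octahedron_labels ! k \<in> set octahedron_labels" using that by (intro nth_mem) simp
    ultimately show ?thesis unfolding octahedron_verts by simp
  qed
  then have "adjacent (complete_multipartite 3 2) (octahedron_labels ! i) (octahedron_labels ! j) \<longleftrightarrow> i div 2 \<noteq> j div 2"
    using ij by (simp add: octahedron_adjacent)
  then show "adjacent G ([v, v', p, p', q, q'] ! i) ([v, v', p, p', q, q'] ! j) \<longleftrightarrow>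
      adjacent (complete_multipartite 3 2) (octahedron_labels ! i) (octahedron_labels ! j)"
    using assms(3) ij by simp
qed (auto)

lemma gedges_K4: "gedges (complete_graph 4) = {{0, 1}, {2, 3}, {0, 2}, {1, 3}, {0, 3}, {1, 2}}"
proof -
  have "gedges (complete_graph 4) = pairs_upto 4"
  proof
    show "gedges (complete_graph 4) \<subseteq> pairs_upto 4"
      by (auto simp: complete_graph_def graph_of_def pairs_upto_def)
    show "pairs_upto 4 \<subseteq> gedges (complete_graph 4)"
    proof
      fix p assume "p \<in> pairs_upto 4"
      then obtain a b where p: "p = {a, b}" "a < b" "b < 4" by (auto simp: pairs_upto_eq)
      then have "a \<in> {..<4}" "b \<in> {..<4}" "a \<noteq> b" by auto
      then show "p \<in> gedges (complete_graph 4)"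
        unfolding complete_graph_def graph_of_def p(1) ugraph.simps by blast
    qed
  qed
  also have "\<dots> = {{0, 1}, {2, 3}, {0, 2}, {1, 3}, {0, 3}, {1, 2}}"
    by (auto simp: eval_nat_numeral pairs_upto_Suc pairs_upto_0 lessThan_Suc)
  finally show ?thesis .
qed

lemma line_graph_K4: "graph_isomorphic (line_graph (complete_graph 4)) (complete_multipartite 3 2)"
proof (rule octahedronI)
  \<comment> \<open>Disjoint edges are paired as antipodes.\<close>
  show "set [{0, 1}, {2, 3}, {0, 2}, {1, 3}, {0, 3}, {1, 2}] = gverts (line_graph (complete_graph 4))"
    by (simp add: gverts_line_graph gedges_K4)
  show "distinct [{0, 1::nat}, {2, 3}, {0, 2}, {1, 3}, {0, 3}, {1, 2}]" by code_simp
  fix i j :: nat assume ij: "i < 6" "j < 6"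
  let ?L = "[{0, 1::nat}, {2, 3}, {0, 2}, {1, 3}, {0, 3}, {1, 2}]"
  have "list_all (\<lambda>i. list_all (\<lambda>j. (?L ! i \<noteq> ?L ! j \<and> ?L ! i \<inter> ?L ! j \<noteq> {}) = (i div 2 \<noteq> j div 2)) [0..<6]) [0..<6]"
    by code_simp
  then have "(?L ! i \<noteq> ?L ! j \<and> ?L ! i \<inter> ?L ! j \<noteq> {}) = (i div 2 \<noteq> j div 2)"
    unfolding list_all_iff using ij by auto
  moreover have "set ?L = gedges (complete_graph 4)" by (simp add: gedges_K4)
  then have "?L ! i \<in> gedges (complete_graph 4)" "?L ! j \<in> gedges (complete_graph 4)"
    using ij nth_mem[of i ?L] nth_mem[of j ?L] by auto
  ultimately show "adjacent (line_graph (complete_graph 4)) (?L ! i) (?L ! j) \<longleftrightarrow> i div 2 \<noteq> j div 2"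
    unfolding adjacent_line_graph by blast
qed

lemma simple_K4: "simple_graph (complete_graph 4)"
  by (auto simp: simple_graph_def complete_graph_def graph_of_def)

lemma geodesic_root_K4: "geodesic_root (complete_graph 4)"
  using graph_iso_id by (auto simp: geodesic_root_def graph_isomorphic_def)

lemma aut_transitive_geodesics_isomorphic:
  "graph_isomorphic G H \<Longrightarrow> aut_transitive_on G (geodesics G k) \<Longrightarrow> aut_transitive_on H (geodesics H k)"
  using aut_transitive_geodesics_iso unfolding graph_isomorphic_def by blast

section \<open>3-arcs of a cubic graph and geodesics of length 2 in its line graph\<close>

lemma arc_transitive_3_geodesics:
  assumes G: "simple_graph G" "connected_graph G" "cubic G" "arc_transitive 3 G" and k: "1 \<le> k" "k \<le> 2"
  shows "aut_transitive_on (line_graph G) (geodesics (line_graph G) k)"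
  unfolding aut_transitive_on_def
proof (intro ballI)
  interpret cubic_graph "gverts G" "adjacent G" by (rule cubic_graphI) (use G in auto)
  fix es es' assume es: "es \<in> geodesics (line_graph G) k" and es': "es' \<in> geodesics (line_graph G) k"
  have arc: "\<exists>zs\<in>arcs G (Suc k). edges_of zs = es" if es: "es \<in> geodesics (line_graph G) k" for es
  proof -
    obtain zs where zs: "chain (adjacent G) zs" "length zs = k + 2" "edges_of zs = es"
      using geodesic_line_graph_chain[OF G(1) es] by blast
    then show ?thesis using chain_in_V[OF zs(1)] by (intro bexI[of _ zs]) (auto simp: arcs_iff)
  qed
  obtain zs zs' where zs: "zs \<in> arcs G (Suc k)" "edges_of zs = es" "zs' \<in> arcs G (Suc k)" "edges_of zs' = es'"
    using arc[OF es] arc[OF es'] by blast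
  have "aut_transitive_on G (arcs G (Suc k))" using G(4) k by (simp add: arc_transitive_def)
  then obtain f where f: "f \<in> graph_auts G" "map f zs = zs'" using zs unfolding aut_transitive_on_def by blast
  then have "(`) f \<in> graph_auts (line_graph G)" using line_graph_iso[OF G(1,1)] by (simp add: graph_auts_def)
  moreover have "map ((`) f) es = es'" using map_edges_of[of f zs] zs f by simp
  ultimately show "\<exists>f\<in>graph_auts (line_graph G). map f es = es'" by blast
qed

text \<open>Without triangles the end edges of a 3-arc are disjoint, so every 3-arc gives a geodesic
  of length 2. Shorter arcs extend to 3-arcs.\<close>

lemma (in triangle_free_cubic) arc_transitive_3:
  assumes "\<And>k. 1 \<le> k \<Longrightarrow> k \<le> 2 \<Longrightarrow> aut_transitive_on (line_graph G) (geodesics (line_graph G) k)"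
  shows "arc_transitive 3 G"
proof -
  have geo: "edges_of xs \<in> geodesics (line_graph G) 2" if xs: "chain (adjacent G) xs" "length xs = 4" for xs
  proof -
    obtain a b c d where abcd: "xs = [a, b, c, d]" using xs(2) by (auto simp: eval_nat_numeral length_Suc_conv)
    have E: "adjacent G a b" "adjacent G b c" "adjacent G c d" "a \<noteq> c" "b \<noteq> d" using xs(1) abcd by auto
    have "adjacent G b a" "adjacent G c b" "adjacent G d c" using E adj_sym by auto
    have "a \<noteq> d" using triangle_free[of b c a] E \<open>adjacent G b a\<close> by auto
    have "edges_of xs \<in> walks (line_graph G) 2" using chain_walk_line_graph[OF simple xs(1)] xs(2) by simp
    then have "adjacent (line_graph G) {a, b} {b, c}" "adjacent (line_graph G) {b, c} {c, d}"
      using abcd by (auto simp: walks_iff)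
    moreover have "{a, b} \<inter> {c, d} = {}" using E irrefl \<open>a \<noteq> d\<close> by auto
    then have "{a, b} \<noteq> {c, d}" "\<not> adjacent (line_graph G) {a, b} {c, d}" by (auto simp: adjacent_line_graph)
    ultimately have "[{a, b}, {b, c}, {c, d}] \<in> geodesics (line_graph G) 2"
      using geodesics_2[OF simple_line_graph[OF simple]] by blast
    then show ?thesis using abcd by simp
  qed
  have main: "\<exists>f\<in>auts. map f xs = ys" if "chain (adjacent G) xs" "length xs = 4" "chain (adjacent G) ys" "length ys = 4" for xs ys
    using arcs_transitive_of_geodesics[of 2 xs ys] assms[of 2] geo that by simp
  have ext: "\<exists>us. chain (adjacent G) (xs @ us) \<and> length (xs @ us) = 4" if xs: "xs \<in> arcs G s" "s \<le> 3" for xs s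
  proof (cases "s = 0")
    case True
    then obtain x where x: "xs = [x]" "x \<in> gverts G" using xs by (auto simp: arcs_iff length_Suc_conv)
    obtain y where "adjacent G x y" using ex_nbr2[OF x(2)] by metis
    then obtain us where "chain (adjacent G) ([x, y] @ us)" "length ([x, y] @ us) = 4"
      using chain_extend_to[of "[x, y]" 4] by auto
    then show ?thesis using x by (intro exI[of _ "y # us"]) auto
  next
    case False
    then show ?thesis using chain_extend_to[of xs 4] xs by (auto simp: arcs_iff)
  qed
  show ?thesis
    unfolding arc_transitive_def aut_transitive_on_def
  proof (intro allI impI ballI)
    fix s xs ys assume s: "s \<le> 3" and xs: "xs \<in> arcs G s" and ys: "ys \<in> arcs G s"
    obtain us where us: "chain (adjacent G) (xs @ us)" "length (xs @ us) = 4" using ext[OF xs s] by blast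
    obtain vs where vs: "chain (adjacent G) (ys @ vs)" "length (ys @ vs) = 4" using ext[OF ys s] by blast
    obtain f where f: "f \<in> auts" "map f (xs @ us) = ys @ vs" using main[OF us vs] by blast
    moreover have "length xs = length ys" using xs ys by (simp add: arcs_iff)
    ultimately have "map f xs = ys" by simp
    moreover have "f \<in> graph_auts G" using auts_graph_iso[OF cubic f(1)] by (simp add: graph_auts_def)
    ultimately show "\<exists>f\<in>graph_auts G. map f xs = ys" by blast
  qed
qed

section \<open>Arc-transitive tetravalent graphs of girth three\<close>

lemma geodesic_le_gdiam:
  assumes "xs \<in> geodesics G k" "gdiam G = enat d"
  shows "k \<le> d"
proof -
  have "gdist G (hd xs) (last xs) = enat k" "xs \<noteq> []" "set xs \<subseteq> gverts G"
    using assms(1) by (auto simp: geodesics_def walks_iff)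
  moreover from this have "hd xs \<in> gverts G" "last xs \<in> gverts G" by auto
  ultimately have "enat k \<le> enat d" using gdist_le_gdiam assms(2) by metis
  then show ?thesis by simp
qed

locale tetravalent =
  fixes G :: "'a ugraph"
  assumes simple: "simple_graph G" and conn: "connected_graph G" and not_complete: "\<not> is_complete G"
    and girth3: "girth G = 3" and regular4: "regular_graph G 4"
    and arc_trans: "aut_transitive_on G (geodesics G 1)"
begin

abbreviation A :: "'a \<Rightarrow> 'a \<Rightarrow> bool" where "A \<equiv> adjacent G"

lemma A_in: "A x y \<Longrightarrow> x \<in> gverts G" "A x y \<Longrightarrow> y \<in> gverts G" "\<not> A x x" "A x y \<Longrightarrow> A y x"
  using simple_graph_adjacent[OF simple, of x y] simple_graph_adjacent(3)[OF simple, of x x] adjacent_sym[of G x y]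
  by blast+

lemma A_neq: "A x y \<Longrightarrow> x \<noteq> y"
  using A_in(3) by blast

lemma card_nbrs: "x \<in> gverts G \<Longrightarrow> card {y. A x y} = 4"
  using regular4 neighbours_in[OF simple] by (simp add: regular_graph_def valency_def)

lemma finite_nbrs: "finite {y. A x y}"
proof -
  have "finite (gverts G)" using simple by (simp add: simple_graph_def)
  then show ?thesis by (rule rev_finite_subset) (use A_in in blast)
qed

lemma reachable: "x \<in> gverts G \<Longrightarrow> y \<in> gverts G \<Longrightarrow> A\<^sup>*\<^sup>* x y"
  using conn connected_graph_iff[OF simple] by blast

lemma closed_set:
  assumes "x \<in> W" "x \<in> gverts G" "\<And>u v. u \<in> W \<Longrightarrow> A u v \<Longrightarrow> v \<in> W"
  shows "gverts G \<subseteq> W"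
proof
  fix y assume "y \<in> gverts G"
  from reachable[OF assms(2) this] show "y \<in> W"
    by (induction rule: rtranclp_induct) (use assms in blast)+
qed

definition common :: "'a \<Rightarrow> 'a \<Rightarrow> 'a set" where
  "common x y = {z. A x z \<and> A y z}"

lemma card_common_eq:
  assumes "A x y" "A x' y'"
  shows "card (common x y) = card (common x' y')"
proof -
  have "[x, y] \<in> geodesics G 1" "[x', y'] \<in> geodesics G 1"
    using assms geodesics_1[OF simple] by auto
  then obtain f where f: "f \<in> graph_auts G" "map f [x, y] = [x', y']"
    using arc_trans unfolding aut_transitive_on_def by blast
  have bij: "bij_betw f (gverts G) (gverts G)"
    and iff: "\<And>u v. u \<in> gverts G \<Longrightarrow> v \<in> gverts G \<Longrightarrow> A u v \<longleftrightarrow> A (f u) (f v)"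
    using f(1) by (auto simp: graph_auts_def graph_iso_def)
  have V: "x \<in> gverts G" "y \<in> gverts G" "f x = x'" "f y = y'" using assms A_in f(2) by auto
  have "f ` common x y = common x' y'"
  proof
    show "f ` common x y \<subseteq> common x' y'"
      using iff V A_in(2) unfolding common_def by blast
    show "common x' y' \<subseteq> f ` common x y"
    proof
      fix z assume z: "z \<in> common x' y'"
      then have "z \<in> gverts G" using A_in(2) by (auto simp: common_def)
      then obtain w where "w \<in> gverts G" "z = f w" using bij by (auto simp: bij_betw_def)
      then show "z \<in> f ` common x y" using z iff V by (auto simp: common_def)
    qed
  qed
  moreover have "inj_on f (common x y)"
    using bij A_in(2) by (auto simp: bij_betw_def common_def intro: inj_on_subset)
  ultimately show ?thesis by (metis card_image)
qed

lemma ex_triangle: "\<exists>x y z. A x y \<and> A y z \<and> A x z"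
proof -
  have "{enat n | n. cycles G n \<noteq> {}} \<noteq> {}"
    using girth3 unfolding girth_def by (auto simp: Inf_enat_def split: if_splits)
  then have "Inf {enat n | n. cycles G n \<noteq> {}} \<in> {enat n | n. cycles G n \<noteq> {}}"
    by (meson ex_in_conv wellorder_InfI)
  then have "cycles G 3 \<noteq> {}" using girth3 unfolding girth_def by (auto simp: numeral_eq_enat)
  then obtain xs where xs: "length xs = 3" "\<forall>i<3. A (xs ! i) (xs ! (Suc i mod 3))" by (auto simp: cycles_def)
  then have "A (xs ! 0) (xs ! (Suc 0 mod 3))" "A (xs ! 1) (xs ! (Suc 1 mod 3))" "A (xs ! 2) (xs ! (Suc 2 mod 3))"
    by (metis zero_less_numeral, metis one_less_numeral_iff semiring_norm(77), metis lessI numeral_2_eq_2 numeral_3_eq_3)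
  moreover have "Suc 0 mod 3 = (1::nat)" "Suc 1 mod 3 = (2::nat)" "Suc 2 mod 3 = (0::nat)" by simp_all
  ultimately have "A (xs ! 0) (xs ! 1)" "A (xs ! 1) (xs ! 2)" "A (xs ! 2) (xs ! 0)" by metis+
  then show ?thesis using A_in(4) by blast
qed

lemma common_subset: "A x y \<Longrightarrow> common x y \<subseteq> {z. A x z} - {y}" "finite (common x y)"
  using A_in(3) finite_subset[OF _ finite_nbrs[of x]] by (auto simp: common_def)

lemma ex_induced_path: "\<exists>x y z. A x y \<and> A y z \<and> x \<noteq> z \<and> \<not> A x z"
proof (rule ccontr)
  assume no: "\<not> ?thesis"
  have "u = v \<or> A u v" if "A\<^sup>*\<^sup>* u v" for u v
    using that by (induction rule: rtranclp_induct) (use no in blast)+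
  then show False using not_complete reachable unfolding is_complete_def by blast
qed

text \<open>The common value is positive, as there is a triangle, and at most 3. The value 3 would
  make all neighbourhoods cliques, whereas a connected graph that is not complete has an induced
  path on three vertices.\<close>

lemma card_common_cases: "(\<forall>x y. A x y \<longrightarrow> card (common x y) = 1) \<or> (\<forall>x y. A x y \<longrightarrow> card (common x y) = 2)"
proof -
  obtain x y z where xyz: "A x y" "A y z" "A x z" using ex_triangle by blast
  define a where "a = card (common x y)"
  have a: "card (common u v) = a" if "A u v" for u v using card_common_eq[OF that xyz(1)] a_def by simp
  have "common x y \<noteq> {}" using xyz by (auto simp: common_def)
  then have "a \<ge> 1" using common_subset(2) by (simp add: a_def card_gt_0_iff Suc_le_eq)
  have N: "card ({z. A u z} - {v}) = 3" if "A u v" for u v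
    using card_nbrs[OF A_in(1)[OF that]] that finite_nbrs by simp
  have "a \<le> 3" unfolding a_def N[OF xyz(1), symmetric]
    using common_subset(1)[OF xyz(1)] finite_nbrs by (intro card_mono) auto
  moreover have "a \<noteq> 3"
  proof
    assume "a = 3"
    obtain p q r where pqr: "A p q" "A q r" "p \<noteq> r" "\<not> A p r" using ex_induced_path by blast
    have "A q p" using A_in(4) pqr by blast
    then have "common q p = {z. A q z} - {p}"
      using common_subset[of q p] N[of q p] a[of q p] \<open>a = 3\<close> finite_nbrs by (intro card_subset_eq) auto
    then have "r \<in> common q p" using pqr by auto
    then show False using pqr by (simp add: common_def)
  qed
  ultimately have "a = 1 \<or> a = 2" using \<open>a \<ge> 1\<close> by auto
  then show ?thesis using a by blast
qed

text \<open>If every edge lies in two triangles, the neighbourhood of a vertex is a 4-cycle and the graph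
  is the octahedron.\<close>

lemma octahedron:
  assumes two: "\<And>x y. A x y \<Longrightarrow> card (common x y) = 2"
  shows "graph_isomorphic G (complete_multipartite 3 2)"
proof -
  obtain v p0 where v: "A v p0" using ex_triangle by blast
  have vV: "v \<in> gverts G" using v A_in by blast
  obtain p1 p3 where c0: "common v p0 = {p1, p3}" "p1 \<noteq> p3" using two[OF v] by (auto simp: card_2_iff)
  have p13: "A v p1" "A v p3" "A p0 p1" "A p0 p3" using c0 unfolding common_def by blast+
  have neq: "v \<noteq> p0" "v \<noteq> p1" "v \<noteq> p3" "p0 \<noteq> p1" "p0 \<noteq> p3" using v p13 A_neq by blast+
  have "card ({y. A v y} - {p0, p1, p3}) = 1"
  proof -
    have "{p0, p1, p3} \<subseteq> {y. A v y}" "card {p0, p1, p3} = 3" using v p13 c0(2) neq by auto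
    then show ?thesis using card_nbrs[OF vV] finite_nbrs by (simp add: card_Diff_subset)
  qed
  \<comment> \<open>\<open>p2\<close> is the fourth neighbour of \<open>v\<close> and will be the
    antipode of \<open>p0\<close>.\<close>
  then obtain p2 where "{y. A v y} - {p0, p1, p3} = {p2}" by (auto simp: card_1_singleton_iff)
  then have Nv: "\<And>y. A v y \<longleftrightarrow> y = p0 \<or> y = p1 \<or> y = p2 \<or> y = p3" and d2: "p2 \<noteq> p0" "p2 \<noteq> p1" "p2 \<noteq> p3"
    using v p13 by blast+
  have vp2: "A v p2" using Nv by blast
  have n02: "\<not> A p0 p2" using c0 vp2 d2 by (auto simp: common_def)
  have c2: "common v p2 = {p1, p3}"
  proof (rule card_subset_eq)
    show "common v p2 \<subseteq> {p1, p3}" using Nv n02 A_in(3,4) by (auto simp: common_def)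
  qed (use two[OF vp2] c0(2) in auto)
  then have p2: "A p2 p1" "A p2 p3" by (auto simp: common_def)
  have n13: "\<not> A p1 p3"
  proof
    assume "A p1 p3"
    then have "{p0, p2, p3} \<subseteq> common v p1" using p13 p2 Nv A_in(4) by (auto simp: common_def)
    moreover have "card {p0, p2, p3} = 3" using d2 neq by auto
    ultimately show False using two[OF p13(1)] card_mono[OF common_subset(2)] by (metis numeral_le_iff semiring_norm(69) numeral_2_eq_2 numeral_3_eq_3 Suc_n_not_le_n)
  qed
  have four: "\<And>y. A a y \<longleftrightarrow> y = b1 \<or> y = b2 \<or> y = b3 \<or> y = b4"
    if b: "A a b1" "A a b2" "A a b3" "A a b4" "distinct [b1, b2, b3, b4]" for a b1 b2 b3 b4
  proof -
    have "{b1, b2, b3, b4} = {y. A a y}"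
      by (rule card_subset_eq[OF finite_nbrs]) (use b card_nbrs[OF A_in(1)[OF b(1)]] in auto)
    then show "A a y \<longleftrightarrow> y = b1 \<or> y = b2 \<or> y = b3 \<or> y = b4" for y by blast
  qed
  have p0v: "A p0 v" using v A_in(4) by blast
  have "card ({y. A p0 y} - {v, p1, p3}) = 1"
  proof -
    have "{v, p1, p3} \<subseteq> {y. A p0 y}" "card {v, p1, p3} = 3" using p0v p13 c0(2) neq by auto
    then show ?thesis using card_nbrs[OF A_in(1)[OF p0v]] finite_nbrs by (simp add: card_Diff_subset)
  qed
  \<comment> \<open>\<open>x\<close> is the fourth neighbour of \<open>p0\<close> and will be the
    antipode of \<open>v\<close>.\<close>
  then obtain x where "{y. A p0 y} - {v, p1, p3} = {x}" by (auto simp: card_1_singleton_iff)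
  then have N0: "\<And>y. A p0 y \<longleftrightarrow> y = v \<or> y = p1 \<or> y = p3 \<or> y = x" and dx: "x \<noteq> v" "x \<noteq> p1" "x \<noteq> p3"
    using p0v p13 by blast+
  have x0: "A p0 x" "x \<noteq> p0" "x \<noteq> p2" using N0 A_in(3) n02 by blast+
  have neq2: "v \<noteq> p2" "p0 \<noteq> x" using vp2 x0 A_neq by blast+
  \<comment> \<open>An edge has a common neighbour besides any prescribed vertex. With
    \<open>v\<close> prescribed, this forces \<open>x\<close> to be adjacent to \<open>p1\<close>,
    \<open>p3\<close> and \<open>p2\<close>.\<close>
  have second: "\<exists>w. w \<noteq> z \<and> A a w \<and> A b w" if ab: "A a b" for a b z
  proof -
    obtain s t where st: "common a b = {s, t}" "s \<noteq> t" using two[OF ab] by (auto simp: card_2_iff)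
    then have "s \<in> common a b" "t \<in> common a b" by auto
    then show ?thesis using st(2) unfolding common_def by (cases "s = z") auto
  qed
  have x1: "A p1 x"
  proof -
    obtain w where "w \<noteq> v" "A p0 w" "A p1 w" using second[OF p13(3), of v] by blast
    then show ?thesis using N0 n13 A_in(3) by blast
  qed
  have x3: "A p3 x"
  proof -
    obtain w where "w \<noteq> v" "A p0 w" "A p3 w" using second[OF p13(4), of v] by blast
    then show ?thesis using N0 n13 A_in(3,4) by blast
  qed
  have N1: "\<And>y. A p1 y \<longleftrightarrow> y = v \<or> y = p0 \<or> y = p2 \<or> y = x"
  proof (rule four)
    show "distinct [v, p0, p2, x]" using neq neq2 d2 dx x0 by auto
  qed (use p13 p2 x1 A_in(4) in blast)+
  have x2: "A p2 x"
  proof -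
    obtain w where "w \<noteq> v" "A p1 w" "A p2 w" using second[of p1 p2 v] p2 A_in(4) by blast
    then show ?thesis using N1 n02 A_in(3,4) by blast
  qed
  have N2: "\<And>y. A p2 y \<longleftrightarrow> y = v \<or> y = p1 \<or> y = p3 \<or> y = x"
  proof (rule four)
    show "distinct [v, p1, p3, x]" using neq c0(2) dx by auto
  qed (use vp2 p2 x2 A_in(4) in blast)+
  have N3: "\<And>y. A p3 y \<longleftrightarrow> y = v \<or> y = p0 \<or> y = p2 \<or> y = x"
  proof (rule four)
    show "distinct [v, p0, p2, x]" using neq neq2 d2 dx x0 by auto
  qed (use p13 p2 x3 A_in(4) in blast)+
  have Nx: "\<And>y. A x y \<longleftrightarrow> y = p0 \<or> y = p1 \<or> y = p2 \<or> y = p3"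
  proof (rule four)
    show "distinct [p0, p1, p2, p3]" using d2 c0(2) neq by auto
  qed (use x0 x1 x2 x3 A_in(4) in blast)+
  have "gverts G \<subseteq> {v, x, p0, p2, p1, p3}"
    by (rule closed_set[OF _ vV]) (use Nv N0 N1 N2 N3 Nx in auto)
  moreover have "{v, x, p0, p2, p1, p3} \<subseteq> gverts G" using A_in(1) v p13 vp2 x0 A_in(2) by blast
  ultimately have verts: "set [v, x, p0, p2, p1, p3] = gverts G" by auto
  have dist: "distinct [v, x, p0, p2, p1, p3]"
    using neq neq2 d2 dx x0 c0(2) by auto
  show ?thesis
  proof (rule octahedronI[OF verts dist])
    fix i j :: nat assume "i < 6" "j < 6"
    then have "i \<in> {0, 1, 2, 3, 4, 5}" "j \<in> {0, 1, 2, 3, 4, 5}" by auto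
    then show "A ([v, x, p0, p2, p1, p3] ! i) ([v, x, p0, p2, p1, p3] ! j) \<longleftrightarrow> i div 2 \<noteq> j div 2"
      using dist by (auto simp: Nv N0 N1 N2 N3 Nx)
  qed
qed

text \<open>If every edge lies in one triangle, the triangles are the vertices of a cubic graph, two being
  adjacent when they meet; the vertices of \<open>G\<close> are its edges.\<close>

lemma line_graph_of_triangles:
  assumes one: "\<And>x y. A x y \<Longrightarrow> card (common x y) = 1"
  obtains S :: "nat ugraph" where "connected_graph S" "cubic S" "triangle_free_cubic S" "graph_isomorphic G (line_graph S)"
proof -
  have uni: "z = w" if zw: "A x y" "A x z" "A y z" "A x w" "A y w" for x y z w
  proof -
    obtain s where "common x y = {s}" using one[OF zw(1)] by (auto simp: card_1_singleton_iff)
    moreover have "z \<in> common x y" "w \<in> common x y" using zw by (auto simp: common_def)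
    ultimately show ?thesis by simp
  qed
  have ex: "\<exists>z. A x z \<and> A y z" if "A x y" for x y
    using one[OF that] by (auto simp: card_1_singleton_iff common_def)
  define \<Delta> where "\<Delta> = {T. \<exists>x y z. T = {x, y, z} \<and> A x y \<and> A y z \<and> A x z}"
  have \<Delta>_sub: "T \<subseteq> gverts G" if "T \<in> \<Delta>" for T using that A_in(1,2) by (auto simp: \<Delta>_def)
  have card_T: "card T = 3" if "T \<in> \<Delta>" for T
  proof -
    obtain x y z where "T = {x, y, z}" "A x y" "A y z" "A x z" using \<open>T \<in> \<Delta>\<close> unfolding \<Delta>_def by blast
    moreover from this have "x \<noteq> y" "y \<noteq> z" "x \<noteq> z" using A_neq by blast+
    ultimately show ?thesis by simp
  qed
  have clique: "A x y" if "T \<in> \<Delta>" "x \<in> T" "y \<in> T" "x \<noteq> y" for T x y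
    using that A_in(4) unfolding \<Delta>_def by blast
  have finV: "finite (gverts G)" using simple by (simp add: simple_graph_def)
  have fin\<Delta>: "finite \<Delta>" by (rule finite_subset[of _ "Pow (gverts G)"]) (use \<Delta>_sub finV in auto)
  have T_unique: "T = S" if TS: "T \<in> \<Delta>" "S \<in> \<Delta>" "x \<in> T" "y \<in> T" "x \<in> S" "y \<in> S" "x \<noteq> y" for T S x y
  proof -
    have xy: "A x y" using clique TS by blast
    have third: "\<exists>z. T = {x, y, z} \<and> A x z \<and> A y z" if T: "T \<in> \<Delta>" "x \<in> T" "y \<in> T" for T
    proof -
      have "card (T - {x, y}) = 1" using card_T[OF T(1)] T \<open>x \<noteq> y\<close> by (simp add: card_Diff_subset)
      then obtain z where z: "T - {x, y} = {z}" by (auto simp: card_1_singleton_iff)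
      then have "T = {x, y, z}" "z \<noteq> x" "z \<noteq> y" using T by blast+
      then show ?thesis using clique[OF T(1)] T by blast
    qed
    show ?thesis using third[OF TS(1,3,4)] third[OF TS(2,5,6)] uni[OF xy] by metis
  qed
  have T_edge: "\<exists>T\<in>\<Delta>. x \<in> T \<and> y \<in> T" if "A x y" for x y
    using ex[OF that] that unfolding \<Delta>_def by blast
  \<comment> \<open>The four neighbours of \<open>x\<close> split into two adjacent pairs, one for
    each triangle at \<open>x\<close>.\<close>
  have two_T: "\<exists>T S. T \<in> \<Delta> \<and> S \<in> \<Delta> \<and> T \<noteq> S \<and> x \<in> T \<and> x \<in> S \<and> (\<forall>R\<in>\<Delta>. x \<in> R \<longrightarrow> R = T \<or> R = S)" if x: "x \<in> gverts G" for x
  proof -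
    have "{y. A x y} \<noteq> {}" using card_nbrs[OF x] by (metis card.empty zero_neq_numeral)
    then obtain p where p: "A x p" by blast
    obtain T where T: "T \<in> \<Delta>" "x \<in> T" "p \<in> T" using T_edge[OF p] by blast
    have fT: "finite T" using card_T[OF T(1)] by (intro card_ge_0_finite) simp
    have "card (T - {x}) = 2" using card_T[OF T(1)] T(2) by simp
    moreover have sub: "T - {x} \<subseteq> {y. A x y}" using clique[OF T(1,2)] by blast
    ultimately have c2: "card ({y. A x y} - (T - {x})) = 2" using card_nbrs[OF x] fT by (simp add: card_Diff_subset)
    then have "{y. A x y} - (T - {x}) \<noteq> {}" by (metis card.empty zero_neq_numeral)
    then obtain r where r: "A x r" "r \<notin> T" using A_in(3) by blast
    obtain S where S: "S \<in> \<Delta>" "x \<in> S" "r \<in> S" using T_edge[OF r(1)] by blast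
    have "T \<noteq> S" using r S by blast
    have fS: "finite S" using card_T[OF S(1)] by (intro card_ge_0_finite) simp
    have disj: "(T - {x}) \<inter> (S - {x}) = {}" using T_unique[OF T(1) S(1) T(2) _ S(2)] \<open>T \<noteq> S\<close> by blast
    have "(T - {x}) \<union> (S - {x}) = {y. A x y}"
    proof (rule card_subset_eq[OF finite_nbrs])
      show "(T - {x}) \<union> (S - {x}) \<subseteq> {y. A x y}" using sub clique[OF S(1,2)] by blast
      show "card ((T - {x}) \<union> (S - {x})) = card {y. A x y}"
        using card_nbrs[OF x] disj fT fS card_T[OF T(1)] card_T[OF S(1)] T(2) S(2) by (simp add: card_Un_disjoint)
    qed
    then have all: "y \<in> T \<or> y \<in> S" if "A x y" for y using that by blast
    have "R = T \<or> R = S" if R: "R \<in> \<Delta>" "x \<in> R" for R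
    proof -
      have "card (R - {x}) = 2" using card_T[OF R(1)] R(2) by simp
      then obtain y where y: "y \<in> R" "y \<noteq> x" by (auto simp: card_2_iff)
      then have "y \<in> T \<or> y \<in> S" using clique[OF R] all by blast
      then show ?thesis using T_unique[OF R(1) T(1) R(2) y(1) T(2)] T_unique[OF R(1) S(1) R(2) y(1) S(2)] y(2) by metis
    qed
    then show ?thesis using T S \<open>T \<noteq> S\<close> by blast
  qed
  \<comment> \<open>Numbering the triangles gives the cubic graph natural numbers as vertices, the
    type in the theorem.\<close>
  obtain I :: "nat \<Rightarrow> 'a set" where I: "bij_betw I {..<card \<Delta>} \<Delta>"
    using ex_bij_betw_nat_finite[OF fin\<Delta>] by (metis atLeast0LessThan)
  define n where "n = card \<Delta>"
  have I_in: "I i \<in> \<Delta>" if "i < n" for i using I that by (auto simp: bij_betw_def n_def)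
  have I_inj: "I i = I j \<longleftrightarrow> i = j" if "i < n" "j < n" for i j
    using I that by (auto simp: bij_betw_def n_def inj_on_eq_iff)
  have I_surj: "\<exists>i<n. I i = T" if "T \<in> \<Delta>" for T
  proof -
    have "T \<in> I ` {..<card \<Delta>}" using I that by (simp add: bij_betw_def)
    then show ?thesis by (auto simp: n_def)
  qed
  define S where "S = graph_of {..<n} (\<lambda>i j. I i \<inter> I j \<noteq> {})"
  have S_verts: "gverts S = {..<n}" by (simp add: S_def gverts_graph_of)
  have S_adj: "adjacent S i j \<longleftrightarrow> i < n \<and> j < n \<and> i \<noteq> j \<and> I i \<inter> I j \<noteq> {}" for i j
    unfolding S_def by (subst adjacent_graph_of) auto
  have S_simple: "simple_graph S"
    by (auto simp: simple_graph_def S_def graph_of_def)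
  have meet: "x = y" if m: "i < n" "j < n" "i \<noteq> j" "x \<in> I i" "x \<in> I j" "y \<in> I i" "y \<in> I j" for i j x y
  proof (rule ccontr)
    assume "x \<noteq> y"
    then have "I i = I j" using T_unique[OF I_in[OF m(1)] I_in[OF m(2)] m(4,6,5,7)] by blast
    then show False using I_inj m(1-3) by blast
  qed
  have at_x: "\<exists>i j. i < n \<and> j < n \<and> i \<noteq> j \<and> x \<in> I i \<and> x \<in> I j \<and> (\<forall>k<n. x \<in> I k \<longrightarrow> k = i \<or> k = j)"
    if "x \<in> gverts G" for x
  proof -
    obtain T T' where T: "T \<in> \<Delta>" "T' \<in> \<Delta>" "T \<noteq> T'" "x \<in> T" "x \<in> T'" "\<forall>R\<in>\<Delta>. x \<in> R \<longrightarrow> R = T \<or> R = T'"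
      using two_T[OF \<open>x \<in> gverts G\<close>] by blast
    obtain i where i: "i < n" "I i = T" using I_surj[OF T(1)] by blast
    obtain j where j: "j < n" "I j = T'" using I_surj[OF T(2)] by blast
    have "k = i \<or> k = j" if "k < n" "x \<in> I k" for k
      using T(6) I_in[OF that(1)] that I_inj[OF that(1) i(1)] I_inj[OF that(1) j(1)] i j by blast
    then show ?thesis using T i j by (intro exI[of _ i] exI[of _ j]) auto
  qed
  have I_V: "x \<in> gverts G" if "i < n" "x \<in> I i" for i x using \<Delta>_sub I_in that by blast
  have only: "k = i \<or> k = j"
    if m: "i < n" "j < n" "i \<noteq> j" "x \<in> I i" "x \<in> I j" "k < n" "x \<in> I k" for i j k x
  proof -
    obtain i' j' where all: "\<forall>k<n. x \<in> I k \<longrightarrow> k = i' \<or> k = j'" using at_x[OF I_V[OF m(1,4)]] by blast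
    show ?thesis using all[rule_format, OF m(1,4)] all[rule_format, OF m(2,5)] all[rule_format, OF m(6,7)] m(3) by auto
  qed
  \<comment> \<open>A vertex of \<open>G\<close> becomes the edge between the two triangles that
    contain it.\<close>
  define \<psi> where "\<psi> x = {i. i < n \<and> x \<in> I i}" for x
  have \<psi>: "\<psi> x = {i, j}" if "i < n" "j < n" "i \<noteq> j" "x \<in> I i" "x \<in> I j" for i j x
    using only[OF that] that unfolding \<psi>_def by blast
  have bij: "bij_betw \<psi> (gverts G) (gedges S)"
    unfolding bij_betw_def
  proof
    show "inj_on \<psi> (gverts G)"
    proof
      fix x y assume xy: "x \<in> gverts G" "y \<in> gverts G" "\<psi> x = \<psi> y"
      obtain i j where ij: "i < n" "j < n" "i \<noteq> j" "x \<in> I i" "x \<in> I j" using at_x[OF xy(1)] by blast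
      then have "i \<in> \<psi> y" "j \<in> \<psi> y" using xy(3) unfolding \<psi>_def by blast+
      then show "x = y" using meet[OF ij(1-3)] ij by (simp add: \<psi>_def)
    qed
    show "\<psi> ` gverts G = gedges S"
    proof
      show "\<psi> ` gverts G \<subseteq> gedges S"
      proof
        fix e assume "e \<in> \<psi> ` gverts G"
        then obtain x where x: "x \<in> gverts G" "e = \<psi> x" by blast
        obtain i j where ij: "i < n" "j < n" "i \<noteq> j" "x \<in> I i" "x \<in> I j" using at_x[OF x(1)] by blast
        then have "adjacent S i j" by (auto simp: S_adj)
        then show "e \<in> gedges S" using \<psi>[OF ij] x by (simp add: adjacent_def)
      qed
      show "gedges S \<subseteq> \<psi> ` gverts G"
      proof
        fix e assume e: "e \<in> gedges S"
        then have "card e = 2" using S_simple by (simp add: simple_graph_def)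
        then obtain i j where ij: "e = {i, j}" by (auto simp: card_2_iff)
        then have "adjacent S i j" using e by (simp add: adjacent_def)
        then obtain x where x: "i < n" "j < n" "i \<noteq> j" "x \<in> I i" "x \<in> I j" by (auto simp: S_adj)
        then show "e \<in> \<psi> ` gverts G" using \<psi>[OF x] ij I_V by blast
      qed
    qed
  qed
  have "A x y \<longleftrightarrow> adjacent (line_graph S) (\<psi> x) (\<psi> y)" if xy: "x \<in> gverts G" "y \<in> gverts G" for x y
  proof
    assume a: "A x y"
    then obtain T where "T \<in> \<Delta>" "x \<in> T" "y \<in> T" using T_edge by blast
    then obtain i where "i \<in> \<psi> x \<inter> \<psi> y" using I_surj by (auto simp: \<psi>_def)
    moreover have "\<psi> x \<noteq> \<psi> y" using bij xy a A_in(3) by (auto simp: bij_betw_def inj_on_eq_iff)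
    ultimately show "adjacent (line_graph S) (\<psi> x) (\<psi> y)"
      using bij xy unfolding adjacent_line_graph bij_betw_def by blast
  next
    assume "adjacent (line_graph S) (\<psi> x) (\<psi> y)"
    then obtain i where "i < n" "x \<in> I i" "y \<in> I i" "x \<noteq> y" unfolding adjacent_line_graph \<psi>_def by blast
    then show "A x y" using clique I_in by blast
  qed
  with bij have iso: "graph_isomorphic G (line_graph S)"
    unfolding graph_isomorphic_def graph_iso_def by (auto simp: gverts_line_graph)
  have cub: "cubic S"
    unfolding regular_graph_def valency_def neighbours_in[OF S_simple]
  proof
    fix i assume "i \<in> gverts S"
    then have i: "i < n" by (simp add: S_verts)
    \<comment> \<open>The three vertices of triangle \<open>i\<close> correspond to its neighbours,
      since each lies in exactly one other triangle.\<close>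
    define oth where "oth x = (THE j. j < n \<and> j \<noteq> i \<and> x \<in> I j)" for x
    have oth: "oth x < n \<and> oth x \<noteq> i \<and> x \<in> I (oth x)" and oth_eq: "\<And>j. j < n \<Longrightarrow> j \<noteq> i \<Longrightarrow> x \<in> I j \<Longrightarrow> oth x = j"
      if "x \<in> I i" for x
    proof -
      obtain i' j' where "i' < n" "j' < n" "i' \<noteq> j'" "x \<in> I i'" "x \<in> I j'" using at_x[OF I_V[OF i \<open>x \<in> I i\<close>]] by blast
      then obtain j where j: "j < n" "j \<noteq> i" "x \<in> I j" by metis
      then have ex1: "\<exists>!j. j < n \<and> j \<noteq> i \<and> x \<in> I j"
        using only[OF i j(1) j(2)[symmetric] \<open>x \<in> I i\<close> j(3)] by blast
      show "oth x < n \<and> oth x \<noteq> i \<and> x \<in> I (oth x)" unfolding oth_def by (rule theI'[OF ex1])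
      show "oth x = j" if "j < n" "j \<noteq> i" "x \<in> I j" for j
        unfolding oth_def by (rule the1_equality[OF ex1]) (use that in blast)
    qed
    have "bij_betw oth (I i) {j. adjacent S i j}"
      unfolding bij_betw_def
    proof
      show "inj_on oth (I i)"
      proof
        fix x y assume "x \<in> I i" "y \<in> I i" "oth x = oth y"
        then show "x = y" using meet[OF i, of "oth x" x y] oth by metis
      qed
      show "oth ` I i = {j. adjacent S i j}"
      proof
        show "oth ` I i \<subseteq> {j. adjacent S i j}" using oth i by (fastforce simp: S_adj)
        show "{j. adjacent S i j} \<subseteq> oth ` I i"
        proof
          fix j assume "j \<in> {j. adjacent S i j}"
          then obtain x where "j < n" "j \<noteq> i" "x \<in> I i" "x \<in> I j" by (auto simp: S_adj)
          then show "j \<in> oth ` I i" using oth_eq by (metis imageI)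
        qed
      qed
    qed
    then show "card {u. adjacent S i u} = 3" using card_T[OF I_in[OF i]] by (simp add: bij_betw_same_card)
  qed
  \<comment> \<open>The meeting points of three pairwise adjacent triangles would form a triangle
    sharing an edge with \<open>I i\<close>, hence equal to it; but one of these points lies outside
    \<open>I i\<close>.\<close>
  have tri_free: "\<not> adjacent S i k" if path: "adjacent S i j" "adjacent S j k" for i j k
  proof
    assume "adjacent S i k"
    with path obtain x y z where xyz: "x \<in> I i" "x \<in> I j" "y \<in> I j" "y \<in> I k" "z \<in> I i" "z \<in> I k"
      and ijk: "i < n" "j < n" "k < n" "i \<noteq> j" "j \<noteq> k" "i \<noteq> k"
      unfolding S_adj by blast
    have "x \<notin> I k" using only[OF ijk(1,2,4) xyz(1,2) ijk(3)] ijk by blast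
    then have "x \<noteq> y" "x \<noteq> z" using xyz by auto
    have "y \<notin> I i" using only[OF ijk(2,3,5) xyz(3,4) ijk(1)] ijk by blast
    then have "y \<noteq> z" using xyz by auto
    have "A x y" "A x z" "A y z"
      using clique[OF I_in[OF ijk(2)] xyz(2,3)] clique[OF I_in[OF ijk(1)] xyz(1,5)]
        clique[OF I_in[OF ijk(3)] xyz(4,6)] \<open>x \<noteq> y\<close> \<open>x \<noteq> z\<close> \<open>y \<noteq> z\<close> by auto
    then have "{x, y, z} \<in> \<Delta>" unfolding \<Delta>_def by blast
    then have "{x, y, z} = I i" using T_unique[OF _ I_in[OF ijk(1)], of "{x, y, z}" x z] xyz \<open>x \<noteq> z\<close> by blast
    then show False using \<open>y \<notin> I i\<close> by blast
  qed
  have con: "connected_graph S"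
    unfolding connected_graph_iff[OF S_simple]
  proof (intro conjI ballI)
    obtain x y where "A x y" using ex_triangle by blast
    then have "\<Delta> \<noteq> {}" using T_edge by blast
    then show "gverts S \<noteq> {}" using I_surj S_verts by fastforce
    have direct: "(adjacent S)\<^sup>*\<^sup>* i j" if "i < n" "j < n" "x \<in> I i" "x \<in> I j" for i j x
      using that by (cases "i = j") (auto simp: S_adj intro!: r_into_rtranclp)
    have walk: "\<forall>j<n. y \<in> I j \<longrightarrow> (adjacent S)\<^sup>*\<^sup>* i j" if i: "i < n" "x \<in> I i" and xy: "A\<^sup>*\<^sup>* x y" for i x y
      using xy
    proof (induction rule: rtranclp_induct)
      case base
      then show ?case using direct i by blast
    next
      case (step y z)
      obtain T where "T \<in> \<Delta>" "y \<in> T" "z \<in> T" using T_edge[OF step.hyps(2)] by blast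
      then obtain k where k: "k < n" "y \<in> I k" "z \<in> I k" using I_surj by blast
      show ?case
      proof (intro allI impI)
        fix j assume "j < n" "z \<in> I j"
        then have "(adjacent S)\<^sup>*\<^sup>* k j" using direct k by blast
        moreover have "(adjacent S)\<^sup>*\<^sup>* i k" using step.IH k by blast
        ultimately show "(adjacent S)\<^sup>*\<^sup>* i j" by (rule rtranclp_trans[rotated])
      qed
    qed
    fix i j assume "i \<in> gverts S" "j \<in> gverts S"
    then have ij: "i < n" "j < n" by (auto simp: S_verts)
    have "I i \<noteq> {}" "I j \<noteq> {}" using card_T[OF I_in[OF ij(1)]] card_T[OF I_in[OF ij(2)]] by auto
    then obtain x y where "x \<in> I i" "y \<in> I j" by blast
    then show "(adjacent S)\<^sup>*\<^sup>* i j" using walk[OF ij(1), of x y] reachable I_V ij by blast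
  qed
  have "triangle_free_cubic S"
    by (rule triangle_free_cubic.intro[OF S_simple cubic_graphI[OF S_simple con cub]]) (rule tri_free)
  with con cub iso that show ?thesis by blast
qed

end

theorem theorem1p1:
  fixes \<Gamma> :: "'a ugraph"
  assumes "simple_graph \<Gamma>"
    and "connected_graph \<Gamma>"
    and "\<not> is_complete \<Gamma>"
    and "girth \<Gamma> = 3"
    and "regular_graph \<Gamma> 4"
  shows "graph_isomorphic (line_graph (complete_graph 4)) (complete_multipartite 3 2) \<and>
    (s_geodesic_transitive 2 \<Gamma> \<longleftrightarrow>
       graph_isomorphic \<Gamma> (line_graph (complete_graph 4)) \<or>
       (\<exists>\<Sigma> :: nat ugraph. simple_graph \<Sigma> \<and> connected_graph \<Sigma> \<and> cubic \<Sigma> \<and> arc_transitive 3 \<Sigma> \<and>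
          graph_isomorphic \<Gamma> (line_graph \<Sigma>))) \<and>
    (geodesic_transitive \<Gamma> \<longleftrightarrow>
       (\<exists>\<Sigma> :: nat ugraph. simple_graph \<Sigma> \<and> cubic \<Sigma> \<and> distance_transitive \<Sigma> \<and> geodesic_root \<Sigma> \<and>
          graph_isomorphic \<Gamma> (line_graph \<Sigma>))) \<and>
    (\<forall>\<Sigma> :: nat ugraph. simple_graph \<Sigma> \<and> geodesic_root \<Sigma> \<longrightarrow> cubic \<Sigma> \<and> distance_transitive \<Sigma>)"
proof -
  have roots: "cubic \<Sigma> \<and> distance_transitive \<Sigma> \<and>
      (\<forall>k\<ge>1. aut_transitive_on (line_graph \<Sigma>) (geodesics (line_graph \<Sigma>) k))"
    if root: "simple_graph \<Sigma>" "geodesic_root \<Sigma>" for \<Sigma> :: "nat ugraph"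
  proof -
    obtain t g where "transitive_cage_graph \<Sigma> t g" by (rule geodesic_root_imp_cage[OF root])
    then interpret transitive_cage_graph \<Sigma> t g .
    show ?thesis using cubic_G distance_transitive_G line_graph_geodesics_transitive by blast
  qed
  have transfer: "aut_transitive_on \<Gamma> (geodesics \<Gamma> k)"
    if "graph_isomorphic \<Gamma> (line_graph \<Sigma>)" "aut_transitive_on (line_graph \<Sigma>) (geodesics (line_graph \<Sigma>) k)"
    for \<Sigma> :: "nat ugraph" and k
    using aut_transitive_geodesics_isomorphic[OF graph_isomorphic_sym] that by blast
  obtain d where d: "gdiam \<Gamma> = enat d" using connected_gdiam_finite assms(1,2) by blast
  have d2: "2 \<le> gdiam \<Gamma>" by (rule gdiam_ge_2) (use assms in auto)
  then have "2 \<le> d" by (simp add: d numeral_eq_enat)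
  have analysis: "graph_isomorphic \<Gamma> (line_graph (complete_graph 4)) \<or>
      (\<exists>\<Sigma> :: nat ugraph. connected_graph \<Sigma> \<and> cubic \<Sigma> \<and> triangle_free_cubic \<Sigma> \<and> graph_isomorphic \<Gamma> (line_graph \<Sigma>))"
    if "aut_transitive_on \<Gamma> (geodesics \<Gamma> 1)"
  proof -
    interpret tetravalent \<Gamma> by unfold_locales (use assms that in auto)
    from card_common_cases show ?thesis
    proof
      assume one: "\<forall>x y. A x y \<longrightarrow> card (common x y) = 1"
      obtain S :: "nat ugraph" where "connected_graph S" "cubic S" "triangle_free_cubic S" "graph_isomorphic \<Gamma> (line_graph S)"
        by (rule line_graph_of_triangles) (use one in auto)
      then show ?thesis by blast
    next
      assume "\<forall>x y. A x y \<longrightarrow> card (common x y) = 2"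
      then have "graph_isomorphic \<Gamma> (complete_multipartite 3 2)" by (intro octahedron) auto
      then show ?thesis using graph_isomorphic_trans graph_isomorphic_sym[OF line_graph_K4] by blast
    qed
  qed
  have K4: "aut_transitive_on \<Gamma> (geodesics \<Gamma> k)" if "graph_isomorphic \<Gamma> (line_graph (complete_graph 4))" "1 \<le> k" for k
    using transfer that roots[OF simple_K4 geodesic_root_K4] by blast
  have "s_geodesic_transitive 2 \<Gamma> \<longleftrightarrow>
       graph_isomorphic \<Gamma> (line_graph (complete_graph 4)) \<or>
       (\<exists>\<Sigma> :: nat ugraph. simple_graph \<Sigma> \<and> connected_graph \<Sigma> \<and> cubic \<Sigma> \<and> arc_transitive 3 \<Sigma> \<and>
          graph_isomorphic \<Gamma> (line_graph \<Sigma>))" (is "?L \<longleftrightarrow> ?R")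
  proof
    assume ?L
    then have trans: "aut_transitive_on \<Gamma> (geodesics \<Gamma> k)" if "1 \<le> k" "k \<le> 2" for k
      using that by (simp add: s_geodesic_transitive_def)
    from analysis[OF trans[of 1]] show ?R
    proof
      assume "\<exists>\<Sigma> :: nat ugraph. connected_graph \<Sigma> \<and> cubic \<Sigma> \<and> triangle_free_cubic \<Sigma> \<and> graph_isomorphic \<Gamma> (line_graph \<Sigma>)"
      then obtain \<Sigma> :: "nat ugraph" where S: "connected_graph \<Sigma>" "cubic \<Sigma>" "triangle_free_cubic \<Sigma>" "graph_isomorphic \<Gamma> (line_graph \<Sigma>)"
        by blast
      then have "arc_transitive 3 \<Sigma>"
        using triangle_free_cubic.arc_transitive_3 aut_transitive_geodesics_isomorphic[OF S(4)] trans by blast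
      then show ?R using S triangle_free_cubic.simple by blast
    qed auto
  next
    assume ?R
    then have "aut_transitive_on \<Gamma> (geodesics \<Gamma> k)" if "1 \<le> k" "k \<le> 2" for k
      using K4 transfer arc_transitive_3_geodesics that by blast
    then show ?L using d2 by (simp add: s_geodesic_transitive_def numeral_eq_enat)
  qed
  moreover have "geodesic_transitive \<Gamma> \<longleftrightarrow>
       (\<exists>\<Sigma> :: nat ugraph. simple_graph \<Sigma> \<and> cubic \<Sigma> \<and> distance_transitive \<Sigma> \<and> geodesic_root \<Sigma> \<and>
          graph_isomorphic \<Gamma> (line_graph \<Sigma>))" (is "?L \<longleftrightarrow> ?R")
  proof
    assume ?L
    then have trans: "aut_transitive_on \<Gamma> (geodesics \<Gamma> k)" if "1 \<le> k" "k \<le> d" for k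
      using that d by (auto simp: geodesic_transitive_def s_geodesic_transitive_def)
    have "aut_transitive_on \<Gamma> (geodesics \<Gamma> 1)" using trans[of 1] \<open>2 \<le> d\<close> by simp
    from analysis[OF this] show ?R
    proof
      assume "graph_isomorphic \<Gamma> (line_graph (complete_graph 4))"
      then show ?R using simple_K4 geodesic_root_K4 roots by blast
    next
      assume "\<exists>\<Sigma> :: nat ugraph. connected_graph \<Sigma> \<and> cubic \<Sigma> \<and> triangle_free_cubic \<Sigma> \<and> graph_isomorphic \<Gamma> (line_graph \<Sigma>)"
      then obtain \<Sigma> :: "nat ugraph" where S: "triangle_free_cubic \<Sigma>" "graph_isomorphic \<Gamma> (line_graph \<Sigma>)" by blast
      interpret triangle_free_cubic \<Sigma> by (rule S)
      \<comment> \<open>A geodesic of length \<open>k\<close> in the line graph carries over to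
        \<Gamma>, so \<open>k\<close> is at most the diameter \<open>d\<close> and the assumed
        transitivity applies.\<close>
      have "aut_transitive_on (line_graph \<Sigma>) (geodesics (line_graph \<Sigma>) k)"
        if k: "1 \<le> k" "es \<in> geodesics (line_graph \<Sigma>) k" for k es
      proof -
        obtain f where "graph_iso f (line_graph \<Sigma>) \<Gamma>"
          using graph_isomorphic_sym[OF S(2)] by (auto simp: graph_isomorphic_def)
        from geodesics_map[OF this k(2)] have "k \<le> d" by (rule geodesic_le_gdiam[OF _ d])
        then show ?thesis using aut_transitive_geodesics_isomorphic[OF S(2)] trans k(1) by blast
      qed
      then obtain t g where "arc_transitive_cage (gverts \<Sigma>) (adjacent \<Sigma>) t g"
        by (rule geodesic_transitive_cage)
      then have "geodesic_root \<Sigma>" by (rule arc_transitive_cage_root)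
      then show ?R using roots simple S(2) by blast
    qed
  next
    assume ?R
    then have "aut_transitive_on \<Gamma> (geodesics \<Gamma> k)" if "1 \<le> k" for k
      using transfer roots that by blast
    then show ?L using d \<open>2 \<le> d\<close> by (auto simp: geodesic_transitive_def s_geodesic_transitive_def)
  qed
  ultimately show ?thesis using line_graph_K4 roots by blast
qed

end
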